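(* Let $S,\Sigma$ be real symmetric positive definite $n\times n$ matrices. Any two systems with drifts $A_1,A_2\in\mathcal{A}(S,\Sigma)$ (and common diffusion matrix $\Sigma$) generate identical correlation matrices, identical Mantegna distances $d_{ij}=\sqrt{2(1-\rho_{ij})}$, identical minimum spanning trees, and identical undirected centralities, at every sampling of the same point-in-time record, while their transmission directions may differ arbitrarily. Correlations of temporally aggregated records, that is, of sums of consecutive observations rather than coarser samples of the same series, are not covered: they involve the symmetric parts of $C(h)$ at lags $h\ge1$, which do depend on $Q$.
   Context: A prime denotes transpose. $\mathcal{A}(S,\Sigma)=\{(\tfrac12\Sigma+Q)S^{-1}:\ Q\in\mathbb{R}^{n\times n},\ Q'=-Q\}$. The system with drift $A\in\mathcal{A}(S,\Sigma)$ is the stationary Ornstein--Uhlenbeck process $dx_t=-Ax_t\,dt+\Sigma^{1/2}dW_t$ in $\mathbb{R}^n$, $W$ a standard Brownian motion; every such $A$ has all eigenvalues of positive real part, satisfies the Lyapunov equation $AS+SA'=\Sigma$, and gives stationary covariance $\mathbb{E}[x_tx_t']=S$. $C(h)=\mathbb{E}[x_{t+h}x_t']$ is the lagged covariance (lags counted in observation intervals in the last sentence of the claim). The antisymmetric matrix $Q=AS-\tfrac12\Sigma$ is the circulation of the system; the transmission direction of a system is what is carried by its circulation. $\rho_{ij}=S_{ij}/\sqrt{S_{ii}S_{jj}}$ is the contemporaneous correlation of series $i$ and $j$. The minimum spanning tree is a deterministic functional of the distance matrix $(d_{ij})$, and undirected centralities are functionals of the resulting graph. A sampling of the point-in-time record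 is the sequence of values $x_t$ observed on a grid of any spacing. *)

theory Defs
  imports "HOL-Probability.Probability"
begin

definition sym_posdef :: "real^'n^'n \<Rightarrow> bool" where
  "sym_posdef S \<longleftrightarrow> transpose S = S \<and> (\<forall>v. v \<noteq> 0 \<longrightarrow> v \<bullet> (S *v v) > 0)"

definition antisymmetric :: "real^'n^'n \<Rightarrow> bool" where
  "antisymmetric Q \<longleftrightarrow> transpose Q = - Q"

definition drift :: "real^'n^'n \<Rightarrow> real^'n^'n \<Rightarrow> real^'n^'n \<Rightarrow> real^'n^'n" where
  "drift S \<Sigma> Q = ((1/2) *\<^sub>R \<Sigma> + Q) ** matrix_inv S"

definition drift_class :: "real^'n^'n \<Rightarrow> real^'n^'n \<Rightarrow> (real^'n^'n) set" where
  "drift_class S \<Sigma> = {drift S \<Sigma> Q | Q. antisymmetric Q}"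

definition circulation :: "real^'n^'n \<Rightarrow> real^'n^'n \<Rightarrow> real^'n^'n \<Rightarrow> real^'n^'n" where
  "circulation S \<Sigma> A = A ** S - (1/2) *\<^sub>R \<Sigma>"

definition sym_part :: "real^'n^'n \<Rightarrow> real^'n^'n" where
  "sym_part C = (1/2) *\<^sub>R (C + transpose C)"

definition standard_brownian_motion ::
    "'a measure \<Rightarrow> (real \<Rightarrow> 'a \<Rightarrow> real^'n) \<Rightarrow> bool" where
  "standard_brownian_motion M W \<longleftrightarrow>
     prob_space M \<and>
     (\<forall>t\<ge>0. W t \<in> borel_measurable M) \<and>
     (AE \<omega> in M. W 0 \<omega> = 0) \<and>
     (AE \<omega> in M. continuous_on {0..} (\<lambda>t. W t \<omega>)) \<and>
     (\<forall>s t. 0 \<le> s \<and> s < t \<longrightarrow>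
        (\<forall>i. distributed M lborel (\<lambda>\<omega>. (W t \<omega> - W s \<omega>) $ i) (normal_density 0 (sqrt (t - s)))) \<and>
        prob_space.indep_vars M (\<lambda>_. borel) (\<lambda>i \<omega>. (W t \<omega> - W s \<omega>) $ i) UNIV) \<and>
     (\<forall>\<tau> :: nat \<Rightarrow> real. 0 \<le> \<tau> 0 \<and> strict_mono \<tau> \<longrightarrow>
        prob_space.indep_vars M (\<lambda>_. borel) (\<lambda>k \<omega>. W (\<tau> (Suc k)) \<omega> - W (\<tau> k) \<omega>) UNIV)"

text \<open>The restriction of a process to the time set \<open>[0, \<infinity>)\<close>, as a random element of
  the product space \<open>PiM {0..} (\<lambda>_. borel)\<close>.\<close>

definition process_path :: "(real \<Rightarrow> 'a \<Rightarrow> real^'n) \<Rightarrow> 'a \<Rightarrow> real \<Rightarrow> real^'n" where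
  "process_path x \<omega> = (\<lambda>t\<in>{0..}. x t \<omega>)"

definition stationary :: "'a measure \<Rightarrow> (real \<Rightarrow> 'a \<Rightarrow> real^'n) \<Rightarrow> bool" where
  "stationary M x \<longleftrightarrow>
     (\<forall>s\<ge>0. distr M (PiM {0..} (\<lambda>_. borel)) (process_path (\<lambda>t. x (s + t))) =
             distr M (PiM {0..} (\<lambda>_. borel)) (process_path x))"

text \<open>Stationary solutions on \<open>[0, \<infinity>)\<close> of \<open>dx = - A x dt + \<Sigma>\<^sup>1\<^sup>/\<^sup>2 dW\<close>. The noise is additive, so the
  stochastic integral is \<open>\<Sigma>\<^sup>1\<^sup>/\<^sup>2 W t\<close> and the equation can be read path by path. The matrix \<open>R\<close> is
  the (unique) symmetric positive definite square root of \<open>\<Sigma>\<close>. The driving Brownian motion is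
  independent of the initial value, as is usual for strong solutions; no moment or Gaussianity
  assumption is made on the initial value.\<close>

definition stationary_OU ::
    "'a measure \<Rightarrow> real^'n^'n \<Rightarrow> real^'n^'n \<Rightarrow> (real \<Rightarrow> 'a \<Rightarrow> real^'n) \<Rightarrow> bool" where
  "stationary_OU M A \<Sigma> x \<longleftrightarrow>
     prob_space M \<and>
     (\<forall>t\<ge>0. x t \<in> borel_measurable M) \<and>
     (AE \<omega> in M. continuous_on {0..} (\<lambda>t. x t \<omega>)) \<and>
     stationary M x \<and>
     (\<exists>R W. sym_posdef R \<and> R ** R = \<Sigma> \<and>
        standard_brownian_motion M W \<and>
        prob_space.indep_set M
          (sets (vimage_algebra (space M) (x 0) borel))
          (sets (vimage_algebra (space M) (process_path W) (PiM {0..} (\<lambda>_. borel)))) \<and>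
        (AE \<omega> in M. \<forall>t\<ge>0.
           x t \<omega> = x 0 \<omega> - integral {0..t} (\<lambda>s. A *v x s \<omega>) + R *v W t \<omega>))"

text \<open>The uncentred form \<open>C(h) = E[x(t+h) x(t)']\<close>. It is a covariance because a stationary
  Ornstein--Uhlenbeck process has mean zero; \<open>covariance_matrix\<close> below is centred.\<close>

definition lagged_cov ::
    "'a measure \<Rightarrow> (real \<Rightarrow> 'a \<Rightarrow> real^'n) \<Rightarrow> real \<Rightarrow> real \<Rightarrow> real^'n^'n" where
  "lagged_cov M x t h = (\<chi> i j. integral\<^sup>L M (\<lambda>\<omega>. x (t + h) \<omega> $ i * x t \<omega> $ j))"

definition covariance_matrix :: "'a measure \<Rightarrow> ('a \<Rightarrow> real^'n) \<Rightarrow> real^'n^'n" where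
  "covariance_matrix M X =
     (\<chi> i j. integral\<^sup>L M (\<lambda>\<omega>. (X \<omega> $ i - integral\<^sup>L M (\<lambda>\<omega>'. X \<omega>' $ i)) *
                               (X \<omega> $ j - integral\<^sup>L M (\<lambda>\<omega>'. X \<omega>' $ j))))"

definition correlation_of :: "real^'n^'n \<Rightarrow> real^'n^'n" where
  "correlation_of V = (\<chi> i j. V $ i $ j / sqrt (V $ i $ i * V $ j $ j))"

definition correlation_matrix :: "'a measure \<Rightarrow> ('a \<Rightarrow> real^'n) \<Rightarrow> real^'n^'n" where
  "correlation_matrix M X = correlation_of (covariance_matrix M X)"

definition mantegna_distance :: "real^'n^'n \<Rightarrow> real^'n^'n" where
  "mantegna_distance \<rho> = (\<chi> i j. sqrt (2 * (1 - \<rho> $ i $ j)))"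

definition sampling_grid :: "(nat \<Rightarrow> real) \<Rightarrow> bool" where
  "sampling_grid \<tau> \<longleftrightarrow> 0 \<le> \<tau> 0 \<and> strict_mono \<tau>"

definition aggregate :: "nat \<Rightarrow> real \<Rightarrow> (real \<Rightarrow> 'a \<Rightarrow> real^'n) \<Rightarrow> real \<Rightarrow> 'a \<Rightarrow> real^'n" where
  "aggregate m \<delta> x t \<omega> = (\<Sum>l<m. x (t + real l * \<delta>) \<omega>)"

text \<open>Vertices are the series, that is the elements of the index type; an undirected graph on them
  is given by its set of edges, each edge being a two-element set of vertices.\<close>

definition complete_edges :: "'n set set" where
  "complete_edges = {{i, j} | i j. i \<noteq> j}"

definition connected_edges :: "'n set set \<Rightarrow> bool" where
  "connected_edges T \<longleftrightarrow> (\<forall>i j. (i, j) \<in> {(u, v). {u, v} \<in> T}\<^sup>*)"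

definition acyclic_edges :: "'n set set \<Rightarrow> bool" where
  "acyclic_edges T \<longleftrightarrow>
     \<not> (\<exists>vs. 3 \<le> length vs \<and> distinct vs \<and> {last vs, hd vs} \<in> T \<and>
          (\<forall>k. Suc k < length vs \<longrightarrow> {vs ! k, vs ! Suc k} \<in> T))"

definition is_spanning_tree :: "'n set set \<Rightarrow> bool" where
  "is_spanning_tree T \<longleftrightarrow> T \<subseteq> complete_edges \<and> connected_edges T \<and> acyclic_edges T"

text \<open>The sum runs over ordered pairs, so that each edge is met twice.\<close>

definition total_length :: "real^'n^'n \<Rightarrow> 'n set set \<Rightarrow> real" where
  "total_length d T = (\<Sum>(i, j)\<in>{(i, j). {i, j} \<in> T}. d $ i $ j) / 2"

definition is_mst :: "real^'n^'n \<Rightarrow> 'n set set \<Rightarrow> bool" where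
  "is_mst d T \<longleftrightarrow> is_spanning_tree T \<and>
     (\<forall>T'. is_spanning_tree T' \<longrightarrow> total_length d T \<le> total_length d T')"

text \<open>A deterministic choice of a minimum spanning tree from the distance matrix; ties are broken
  in an arbitrary but fixed way.\<close>

definition mst_functional :: "(real^'n^'n \<Rightarrow> 'n set set) \<Rightarrow> bool" where
  "mst_functional mst \<longleftrightarrow> (\<forall>d. is_mst d (mst d))"

text \<open>The graph that centralities are computed from: the edges of the tree together with their
  lengths, so that length-based centralities are included. A centrality is an arbitrary map from
  such graphs to vertex scores.\<close>

type_synonym 'n weighted_graph = "'n set set \<times> ('n \<Rightarrow> 'n \<Rightarrow> real)"

definition tree_graph :: "(real^'n^'n \<Rightarrow> 'n set set) \<Rightarrow> real^'n^'n \<Rightarrow> 'n weighted_graph" where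
  "tree_graph mst d = (mst d, \<lambda>i j. if {i, j} \<in> mst d then d $ i $ j else 0)"

end

(* The noise is additive, so second moments can be read off the integral equation
   x_t = x_0 - A int_0^t x ds + R W_t without stochastic calculus or matrix exponentials.
   Since v . S^-1 v decays along the noiseless flow, x_T has at most half the energy of x_0 plus an
   integrable noise term; as x_T and x_0 have the same law, x_0 is square integrable. Independence
   of x_0 and W turns the equation into C' = -A C for the lagged covariance C, and comparing the
   covariance t Sigma of R W_t with the right-hand side to first order in t gives the Lyapunov
   equation for C(0), whose only symmetric solution is S. Hence no contemporaneous quantity sees Q.
   For the dependence of the lagged covariances on Q, choose Q so that A rotates a plane of two
   generalised eigenvectors of (Sigma, S) with a prescribed angular frequency w. Taking w times the
   lag equal to pi and to 2 pi gives opposite signs. *)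

theory Submission
  imports Defs
begin

subsection \<open>Symmetric positive definite matrices and the Lyapunov equation\<close>

text \<open>No moment of x_0 is assumed, so taking expectations in the contraction estimate would be
  circular: the inequality says nothing when both sides are infinite. The energies are therefore
  truncated before they are compared, and orthogonality of x_0 and W, which presupposes second
  moments, can enter only afterwards. Paths of W are not differentiable, so the energy is
  differentiated along x - R W. Uniqueness for the Lyapunov equation is read off an extremal
  generalised eigenvector of the unknown relative to S, which replaces a stability argument for A.
  For aggregated records, differing covariances do not suffice: a correlation divides by variances
  that depend on Q as well. The two systems of the final example are therefore separated by a sign:
  one off-diagonal entry is negative for the first and zero for the second, whatever the
  normalisation.\<close>

lemma dot_matrix_transpose: "x \<bullet> (A *v y) = (transpose A *v x) \<bullet> (y :: real^'n)"
  for A :: "real^'n^'m"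
  by (simp add: dot_lmul_matrix)

lemma symmetric_dot: "transpose Y = Y \<Longrightarrow> x \<bullet> (Y *v y) = y \<bullet> (Y *v (x :: real^'n))"
  by (metis dot_matrix_transpose inner_commute)

lemma antisymmetric_dot: "antisymmetric Q \<Longrightarrow> x \<bullet> (Q *v y) = - (y \<bullet> (Q *v x))"
  using dot_matrix_transpose[of x Q y]
  by (simp add: antisymmetric_def inner_commute del: transpose_matrix_vector)
    (simp flip: inner_minus_right add: scaleR_matrix_vector_assoc[of "-1" Q x, simplified])

lemma antisymmetric_dot_self: "antisymmetric Q \<Longrightarrow> x \<bullet> (Q *v x) = 0"
  using antisymmetric_dot[of Q x x] by simp

lemma sym_posdef_sym: "sym_posdef S \<Longrightarrow> transpose S = S"
  by (simp add: sym_posdef_def)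

lemma sym_posdef_pos: "sym_posdef S \<Longrightarrow> v \<noteq> 0 \<Longrightarrow> v \<bullet> (S *v v) > 0"
  by (simp add: sym_posdef_def)

lemma sym_posdef_invertible:
  assumes "sym_posdef S"
  shows "S ** matrix_inv S = mat 1" "matrix_inv S ** S = mat 1"
proof -
  have "S *v x = 0 \<Longrightarrow> x = 0" for x
    using sym_posdef_pos[OF assms, of x] by auto
  then have "\<exists>B. B ** S = mat 1"
    using matrix_left_invertible_ker by blast
  then have "invertible S"
    using invertible_left_inverse by blast
  then have "S ** matrix_inv S = mat 1 \<and> matrix_inv S ** S = mat 1"
    unfolding invertible_def matrix_inv_def by (rule someI_ex)
  then show "S ** matrix_inv S = mat 1" "matrix_inv S ** S = mat 1"
    by blast+
qed

text \<open>Fermat's rule without derivatives: for small s a nonzero linear term would beat the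
  quadratic one.\<close>

lemma linear_le_square_imp_zero:
  fixes b c :: real
  assumes "\<And>s. 2 * s * b \<le> s\<^sup>2 * c"
  shows "b = 0"
proof (rule ccontr)
  assume b: "b \<noteq> 0"
  \<comment> \<open>c may be zero or negative, so a positive k above it is taken; s = b / k then
    gives 2 b^2 / k <= b^2 / k.\<close>
  obtain k where k: "k > 0" "c \<le> k" using that[of "\<bar>c\<bar> + 1"] by linarith
  have "2 * (b / k) * b \<le> (b / k)\<^sup>2 * c" by (rule assms)
  moreover have "(b / k)\<^sup>2 * c \<le> (b / k)\<^sup>2 * k" by (intro mult_left_mono) (auto simp: k)
  moreover have "(b / k)\<^sup>2 * k = b\<^sup>2 / k" using k by (simp add: power2_eq_square)
  moreover have "b\<^sup>2 / k > 0" using b k by simp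
  moreover have "2 * (b / k) * b = 2 * (b\<^sup>2 / k)" by (simp add: power2_eq_square)
  ultimately show False by linarith
qed

text \<open>The eigenvector maximises the Rayleigh quotient \<open>v \<bullet> Yv / v \<bullet> Sv\<close> over the hyperplane.\<close>

lemma generalized_eigenvector:
  fixes S Y :: "real^'n^'n"
  assumes S: "sym_posdef S" and Y: "transpose Y = Y" and v0: "v0 \<noteq> 0" "v0 \<bullet> p = 0"
  obtains v \<mu> where "v \<bullet> p = 0" "v \<bullet> (S *v v) = 1"
    "\<And>u. u \<bullet> p = 0 \<Longrightarrow> u \<bullet> (Y *v v) = \<mu> * (u \<bullet> (S *v v))"
    "\<And>u. u \<bullet> p = 0 \<Longrightarrow> u \<bullet> (Y *v u) \<le> \<mu> * (u \<bullet> (S *v u))"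
proof -
  have St: "transpose S = S" and Spos: "\<And>v. v \<noteq> 0 \<Longrightarrow> v \<bullet> (S *v v) > 0"
    using S by (auto simp: sym_posdef_def)
  \<comment> \<open>The quotient is invariant under scaling, so its maximum over the compact unit
    sphere of the hyperplane is its maximum over all nonzero vectors there.\<close>
  define K where "K = {v. v \<bullet> p = 0} \<inter> sphere 0 1"
  define f where "f v = v \<bullet> (Y *v v) / (v \<bullet> (S *v v))" for v
  have "closed {v. v \<bullet> p = 0}" by (intro closed_Collect_eq continuous_intros)
  then have "compact K" unfolding K_def by (intro closed_Int_compact) auto
  moreover have "(1 / norm v0) *\<^sub>R v0 \<in> K" using v0 by (simp add: K_def)
  then have "K \<noteq> {}" by blast
  moreover have "v \<bullet> (S *v v) \<noteq> 0" if "v \<in> K" for v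
    using Spos[of v] that by (cases "v = 0") (auto simp: K_def)
  then have "continuous_on K f"
    unfolding f_def
    by (intro continuous_intros linear_continuous_on matrix_vector_mul_bounded_linear) blast
  ultimately obtain v where v: "v \<in> K" "\<And>u. u \<in> K \<Longrightarrow> f u \<le> f v"
    using continuous_attains_sup[of K f] by blast
  have vp: "v \<bullet> p = 0" and vS: "v \<bullet> (S *v v) > 0"
    using v(1) Spos[of v] by (cases "v = 0"; simp add: K_def)+
  define h where "h u = u \<bullet> (Y *v u) - f v * (u \<bullet> (S *v u))" for u
  have h_le: "h u \<le> 0" if "u \<bullet> p = 0" for u
  proof (cases "u = 0")
    case False
    have "f ((1 / norm u) *\<^sub>R u) \<le> f v" using False that by (intro v(2)) (simp add: K_def)
    moreover have "f ((1 / norm u) *\<^sub>R u) = f u"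
      using False by (simp add: f_def matrix_vector_mult_scaleR)
    ultimately have "f u \<le> f v" by simp
    then show ?thesis using Spos[OF False] by (simp add: f_def[of u] h_def pos_divide_le_eq)
  qed (simp add: h_def)
  have hv: "h v = 0" using vS by (simp add: h_def f_def)
  have stat: "u \<bullet> (Y *v v) = f v * (u \<bullet> (S *v v))" if u: "u \<bullet> p = 0" for u
  proof -
    have "u \<bullet> (Y *v v) - f v * (u \<bullet> (S *v v)) = 0"
    proof (rule linear_le_square_imp_zero)
      fix s :: real
      \<comment> \<open>Since h <= 0 on the hyperplane and h v = 0, the expansion in s leaves a
        linear term bounded by a quadratic one.\<close>
      have "h (v + s *\<^sub>R u) \<le> 0" by (rule h_le) (simp add: inner_add_left vp u)
      also have "h (v + s *\<^sub>R u) = h v + 2 * s * (u \<bullet> (Y *v v) - f v * (u \<bullet> (S *v v))) + s\<^sup>2 * h u"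
        using symmetric_dot[OF St, of u v] symmetric_dot[OF Y, of u v]
        by (simp add: h_def matrix_vector_right_distrib matrix_vector_mult_scaleR inner_add_left
            inner_add_right power2_eq_square algebra_simps)
      finally show "2 * s * (u \<bullet> (Y *v v) - f v * (u \<bullet> (S *v v))) \<le> s\<^sup>2 * (- h u)"
        using hv by simp
    qed
    then show ?thesis by simp
  qed
  define w where "w = (1 / sqrt (v \<bullet> (S *v v))) *\<^sub>R v"
  show thesis
  proof (rule that[of w "f v"])
    show "w \<bullet> p = 0" using vp by (simp add: w_def)
    show "w \<bullet> (S *v w) = 1"
      using vS by (simp add: w_def matrix_vector_mult_scaleR)
    show "u \<bullet> (Y *v w) = f v * (u \<bullet> (S *v w))" if "u \<bullet> p = 0" for u
      using stat[OF that] by (simp add: w_def matrix_vector_mult_scaleR)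
    show "u \<bullet> (Y *v u) \<le> f v * (u \<bullet> (S *v u))" if "u \<bullet> p = 0" for u
      using h_le[OF that] by (simp add: h_def)
  qed
qed

text \<open>Maximising v . v / v . S v over the whole space yields as \<mu> the reciprocal of the
  smallest eigenvalue of S.\<close>

lemma sym_posdef_lower_bound:
  fixes S :: "real^'n^'n"
  assumes "sym_posdef S"
  obtains \<sigma> where "\<sigma> > 0" "\<And>v. \<sigma> * (v \<bullet> v) \<le> v \<bullet> (S *v v)"
proof -
  \<comment> \<open>\<open>p = 0\<close> removes the hyperplane constraint, and
    \<open>axis undefined 1\<close> merely supplies a nonzero vector.\<close>
  obtain v \<mu> where v: "v \<bullet> (S *v v) = 1" "\<And>u. u \<bullet> v = \<mu> * (u \<bullet> (S *v v))"
      "\<And>u. u \<bullet> u \<le> \<mu> * (u \<bullet> (S *v u))"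
    using generalized_eigenvector[OF assms, of "mat 1" "axis undefined 1" 0]
    by (auto simp: transpose_mat axis_eq_0_iff)
  have "v \<noteq> 0" using v(1) by auto
  then have "\<mu> > 0" using v(1) v(2)[of v] by (metis inner_gt_zero_iff mult_1_right)
  then show thesis using v(3) by (intro that[of "1 / \<mu>"]) (auto simp: field_simps)
qed

lemma matrix_norm_bound:
  fixes A :: "real^'n^'m"
  obtains K where "K > 0" "\<And>v. norm (A *v v) \<le> K * norm v"
  using bounded_linear.pos_bounded[OF matrix_vector_mul_bounded_linear[of A]] that
  by (auto simp: mult.commute)

text \<open>At an eigenvector v of Y relative to S, the quadratic form of A Y + Y A' is \<mu> times
  that of A S + S A', which is v . \<Sigma> v > 0. So the largest eigenvalue \<mu> is 0 and Y is
  negative semidefinite; the same applies to -Y.\<close>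

lemma homogeneous_lyapunov:
  fixes A S \<Sigma> Y :: "real^'n^'n"
  assumes S: "sym_posdef S" and \<Sigma>: "sym_posdef \<Sigma>" and Y: "transpose Y = Y"
    and AS: "A ** S + S ** transpose A = \<Sigma>" and AY: "A ** Y + Y ** transpose A = 0"
  shows "Y = 0"
proof -
  have nonpos: "u \<bullet> (Y *v u) \<le> 0"
    if Y: "transpose Y = Y" and AY: "A ** Y + Y ** transpose A = 0" for Y :: "real^'n^'n" and u
  proof -
    obtain v \<mu> where v: "v \<bullet> (S *v v) = 1"
      "\<And>u. u \<bullet> (Y *v v) = \<mu> * (u \<bullet> (S *v v))" "\<And>u. u \<bullet> (Y *v u) \<le> \<mu> * (u \<bullet> (S *v u))"
      using generalized_eigenvector[OF S Y, of "axis undefined 1" 0] by (auto simp: axis_eq_0_iff)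
    have quad: "v \<bullet> ((A ** X + X ** transpose A) *v v) = 2 * ((transpose A *v v) \<bullet> (X *v v))"
      if "transpose X = X" for X :: "real^'n^'n"
      using symmetric_dot[OF that, of v "transpose A *v v"]
      by (simp add: matrix_vector_mult_add_rdistrib inner_add_right dot_matrix_transpose
          flip: matrix_vector_mul_assoc del: transpose_matrix_vector)
    have "2 * (\<mu> * ((transpose A *v v) \<bullet> (S *v v))) = 0"
      using quad[OF Y] v(2) AY by simp
    moreover have "2 * ((transpose A *v v) \<bullet> (S *v v)) = v \<bullet> (\<Sigma> *v v)"
      using quad[of S] S AS by (simp add: sym_posdef_def)
    moreover have "v \<bullet> (\<Sigma> *v v) > 0"
      using v(1) by (intro sym_posdef_pos[OF \<Sigma>]) auto
    ultimately have "\<mu> = 0" by auto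
    then show ?thesis using v(3)[of u] by simp
  qed
  have "A ** (- Y) + (- Y) ** transpose A = - (A ** Y + Y ** transpose A)"
    by (simp add: vec_eq_iff matrix_matrix_mult_def sum_negf)
  then have "A ** (- Y) + (- Y) ** transpose A = 0" using AY by simp
  moreover have "transpose (- Y) = - Y" using Y by (simp add: vec_eq_iff transpose_def)
  ultimately have "u \<bullet> (- Y *v u) \<le> 0" for u
    by (intro nonpos)
  moreover have "- Y *v u = - (Y *v u)" for u
    by (simp add: vec_eq_iff matrix_vector_mult_def sum_negf)
  ultimately have quad0: "u \<bullet> (Y *v u) = 0" for u
    using nonpos[OF Y AY, of u] by (metis antisym inner_minus_right neg_le_0_iff_le)
  \<comment> \<open>Polarisation: a symmetric bilinear form is determined by its quadratic
    form.\<close>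
  have "u \<bullet> (Y *v w) = 0" for u w
    using quad0[of "u + w"] quad0[of u] quad0[of w] symmetric_dot[OF Y, of u w]
    by (simp add: matrix_vector_right_distrib inner_add_left inner_add_right)
  then have "Y *v w = 0" for w by (metis inner_eq_zero_iff)
  then show ?thesis by (metis matrix_eq matrix_vector_mult_0)
qed

section \<open>Drifts with prescribed circulation\<close>

lemma drift_times: "sym_posdef S \<Longrightarrow> drift S \<Sigma> Q ** S = (1/2) *\<^sub>R \<Sigma> + Q"
  by (simp add: drift_def sym_posdef_invertible flip: matrix_mul_assoc)

lemma drift_lyapunov:
  assumes S: "sym_posdef S" and \<Sigma>: "sym_posdef \<Sigma>" and Q: "antisymmetric Q"
  shows "drift S \<Sigma> Q ** S + S ** transpose (drift S \<Sigma> Q) = \<Sigma>"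
proof -
  have "S ** transpose (drift S \<Sigma> Q) = transpose (drift S \<Sigma> Q ** S)"
    using S by (simp add: matrix_transpose_mul sym_posdef_def)
  also have "\<dots> = transpose ((1/2) *\<^sub>R \<Sigma> + Q)" by (simp add: drift_times[OF S])
  also have "\<dots> = (1/2) *\<^sub>R \<Sigma> - Q"
  proof -
    have "transpose ((1/2) *\<^sub>R \<Sigma> + Q) = (1/2) *\<^sub>R transpose \<Sigma> + transpose Q"
      by (simp add: vec_eq_iff transpose_def)
    then show ?thesis using sym_posdef_sym[OF \<Sigma>] Q by (simp add: antisymmetric_def)
  qed
  finally show ?thesis
    using drift_times[OF S, of \<Sigma> Q] by (simp flip: scaleR_add_left)
qed

lemma circulation_drift: "sym_posdef S \<Longrightarrow> circulation S \<Sigma> (drift S \<Sigma> Q) = Q"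
  by (simp add: circulation_def drift_times)

text \<open>Writing v = S w turns A v = 0 into w . \<Sigma> w = 0, because Q has zero quadratic
  form. Invertibility later recovers the time integral of x from the equation and forces the mean to
  vanish.\<close>

lemma drift_invertible:
  assumes S: "sym_posdef S" and \<Sigma>: "sym_posdef \<Sigma>" and Q: "antisymmetric Q"
  shows "invertible (drift S \<Sigma> Q)"
proof -
  have "v = 0" if v: "drift S \<Sigma> Q *v v = 0" for v
  proof -
    define w where "w = matrix_inv S *v v"
    have v_eq: "v = S *v w"
      using sym_posdef_invertible[OF S] by (simp add: w_def matrix_vector_mul_assoc)
    then have "((1/2) *\<^sub>R \<Sigma> + Q) *v w = 0"
      using v by (simp add: matrix_vector_mul_assoc drift_times[OF S])
    then have "w \<bullet> (((1/2) *\<^sub>R \<Sigma> + Q) *v w) = 0" by simp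
    then have "w \<bullet> (\<Sigma> *v w) = 0"
      by (simp add: matrix_vector_mult_add_rdistrib inner_add_right antisymmetric_dot_self[OF Q]
          flip: scaleR_matrix_vector_assoc)
    then have "w = 0" using sym_posdef_pos[OF \<Sigma>, of w] by auto
    then show "v = 0" using v_eq by simp
  qed
  then show ?thesis
    using matrix_left_invertible_ker invertible_left_inverse by metis
qed

subsection \<open>Linear differential equations\<close>

text \<open>At interior times the one-sided derivative is the ordinary one; at 0 it enters only
  through continuity.\<close>

lemma halfline_deriv_nonpos_imp_le:
  fixes f :: "real \<Rightarrow> real"
  assumes f: "\<And>t. 0 \<le> t \<Longrightarrow> (f has_real_derivative f' t) (at t within {0..})"
    and le: "\<And>t. 0 \<le> t \<Longrightarrow> t \<le> T \<Longrightarrow> f' t \<le> 0" and T: "0 \<le> T"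
  shows "f T \<le> f 0"
proof (rule DERIV_nonpos_imp_decreasing_open[OF T])
  show "\<exists>y. (f has_real_derivative y) (at t) \<and> y \<le> 0" if "0 < t" "t < T" for t
  proof (intro exI conjI)
    show "(f has_real_derivative f' t) (at t)"
      using f[of t] that at_within_interior[of t "{0..}"] by simp
    show "f' t \<le> 0" using le that by simp
  qed
  have "continuous_on {0..} f"
    using f DERIV_continuous continuous_on_eq_continuous_within by (metis atLeast_iff)
  then show "continuous_on {0..T} f" by (rule continuous_on_subset) auto
qed

text \<open>The squared difference of two solutions grows at most like exp(2 K t), with K a norm
  bound for A, and it starts at 0. This is what identifies lagged covariances with explicit
  solutions.\<close>

lemma linear_ode_unique:
  fixes g k :: "real \<Rightarrow> real^'n" and A :: "real^'n^'n"
  assumes g: "\<And>t. 0 \<le> t \<Longrightarrow> (g has_vector_derivative - (A *v g t)) (at t within {0..})"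
    and k: "\<And>t. 0 \<le> t \<Longrightarrow> (k has_vector_derivative - (A *v k t)) (at t within {0..})"
    and "g 0 = k 0" "0 \<le> T"
  shows "g T = k T"
proof -
  obtain K where K: "K > 0" "\<And>v. norm (A *v v) \<le> K * norm v" using matrix_norm_bound[of A] by blast
  define z where "z t = g t - k t" for t
  have z: "(z has_vector_derivative - (A *v z t)) (at t within {0..})" if "0 \<le> t" for t
    unfolding z_def using has_vector_derivative_diff[OF g[OF that] k[OF that]]
    by (simp add: algebra_simps)
  have zz: "((\<lambda>t. z t \<bullet> z t) has_real_derivative - 2 * (z t \<bullet> (A *v z t))) (at t within {0..})"
    if "0 \<le> t" for t
    using bounded_bilinear.has_vector_derivative[OF bounded_bilinear_inner z z, OF that that]
    by (simp add: has_real_derivative_iff_has_vector_derivative inner_commute)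
  have "exp (- 2 * K * T) * (z T \<bullet> z T) \<le> exp (- 2 * K * 0) * (z 0 \<bullet> z 0)"
  proof (rule halfline_deriv_nonpos_imp_le[where f = "\<lambda>t. exp (- 2 * K * t) * (z t \<bullet> z t)"])
    fix t :: real assume t: "0 \<le> t"
    show "((\<lambda>t. exp (- 2 * K * t) * (z t \<bullet> z t)) has_real_derivative
        - 2 * exp (- 2 * K * t) * (K * (z t \<bullet> z t) + z t \<bullet> (A *v z t))) (at t within {0..})"
      by (rule derivative_eq_intros zz[OF t] refl)+ (simp add: algebra_simps)
    have "\<bar>z t \<bullet> (A *v z t)\<bar> \<le> norm (z t) * (K * norm (z t))"
      using Cauchy_Schwarz_ineq2[of "z t" "A *v z t"] mult_left_mono[OF K(2)[of "z t"], of "norm (z t)"]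
      by simp
    then have "- (z t \<bullet> (A *v z t)) \<le> K * (z t \<bullet> z t)"
      by (simp add: dot_square_norm power2_eq_square algebra_simps)
    then show "- 2 * exp (- 2 * K * t) * (K * (z t \<bullet> z t) + z t \<bullet> (A *v z t)) \<le> 0"
      by (simp add: mult_nonneg_nonneg)
  qed (use assms in auto)
  moreover have "z 0 = 0" using assms by (simp add: z_def)
  ultimately have "z T \<bullet> z T \<le> 0" by (simp add: mult_le_0_iff)
  then have "z T = 0" by (metis inner_gt_zero_iff linorder_not_le)
  then show ?thesis by (simp add: z_def)
qed

section \<open>Explicit solutions in an invariant plane\<close>

lemma has_vector_derivative_plane:
  assumes "(f has_real_derivative f') (at t within X)" "(h has_real_derivative h') (at t within X)"
  shows "((\<lambda>t. f t *\<^sub>R u + h t *\<^sub>R z) has_vector_derivative f' *\<^sub>R u + h' *\<^sub>R (z :: 'a::real_normed_vector))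
    (at t within X)"
  by (intro has_vector_derivative_add)
    (use has_vector_derivative_scaleR[OF assms(1) has_vector_derivative_const, of u]
      has_vector_derivative_scaleR[OF assms(2) has_vector_derivative_const, of z] in simp_all)

text \<open>On the span of u and z the map N = A - \<mu> satisfies N u = z and N^2 = -w^2, so exp(-t
  N) = cos(w t) - (sin(w t) / w) N there. Thus \<open>k\<close> is exp(-t A) u.\<close>

lemma damped_rotation_solution:
  fixes A :: "real^'n^'n"
  assumes "A *v u = \<mu> *\<^sub>R u + z" "A *v z = \<mu> *\<^sub>R z - w\<^sup>2 *\<^sub>R u" "w \<noteq> 0"
    and k: "k = (\<lambda>t. (exp (- \<mu> * t) * cos (w * t)) *\<^sub>R u + (- exp (- \<mu> * t) * sin (w * t) / w) *\<^sub>R z)"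
  shows "(k has_vector_derivative - (A *v k t)) (at t within X)"
proof -
  have "((\<lambda>t. exp (- \<mu> * t) * cos (w * t)) has_real_derivative
      - exp (- \<mu> * t) * (\<mu> * cos (w * t) + w * sin (w * t))) (at t within X)"
    by (auto intro!: derivative_eq_intros simp: algebra_simps)
  moreover have "((\<lambda>t. - exp (- \<mu> * t) * sin (w * t) / w) has_real_derivative
      exp (- \<mu> * t) * (\<mu> * sin (w * t) / w - cos (w * t))) (at t within X)"
    using assms(3) by (auto intro!: derivative_eq_intros simp: field_simps)
  ultimately show ?thesis
    unfolding k
    by (rule has_vector_derivative_eq_rhs[OF has_vector_derivative_plane])
      (use assms(3) in \<open>simp only: matrix_vector_right_distrib matrix_vector_mult_scaleR assms(1,2),
        simp add: vec_eq_iff field_simps power2_eq_square\<close>)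
qed

text \<open>The limit w = 0 of the rotation: N = A - \<mu> satisfies N^2 u = 0, so exp(-t N) u = u -
  t z. The case z = 0, where u is an eigenvector, is included.\<close>

lemma damped_shear_solution:
  fixes A :: "real^'n^'n"
  assumes "A *v u = \<mu> *\<^sub>R u + z" "A *v z = \<mu> *\<^sub>R z"
    and k: "k = (\<lambda>t. exp (- \<mu> * t) *\<^sub>R u + (- exp (- \<mu> * t) * t) *\<^sub>R z)"
  shows "(k has_vector_derivative - (A *v k t)) (at t within X)"
proof -
  have "((\<lambda>t. exp (- \<mu> * t)) has_real_derivative - \<mu> * exp (- \<mu> * t)) (at t within X)"
    by (auto intro!: derivative_eq_intros simp: algebra_simps)
  moreover have "((\<lambda>t. - exp (- \<mu> * t) * t) has_real_derivative
      exp (- \<mu> * t) * (\<mu> * t - 1)) (at t within X)"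
    by (auto intro!: derivative_eq_intros simp: algebra_simps)
  ultimately show ?thesis
    unfolding k
    by (rule has_vector_derivative_eq_rhs[OF has_vector_derivative_plane])
      (simp only: matrix_vector_right_distrib matrix_vector_mult_scaleR assms(1,2),
        simp add: vec_eq_iff algebra_simps)
qed

text \<open>In the basis u_i = S v_i of two generalised eigenvectors, A - \<mu> has the matrix with
  rows (\<nu>, c) and (-c, -\<nu>), where c is the strength of the circulation in the plane; its
  square is \<nu>^2 - c^2. The vector v and the rate \<mu> come before w, so that drifts of
  different frequency can be tested on the same vector.\<close>

lemma rotating_drift:
  fixes S \<Sigma> :: "real^'n^'n"
  assumes S: "sym_posdef S" and \<Sigma>: "sym_posdef \<Sigma>" and n: "2 \<le> CARD('n)"
  obtains v \<mu> where "v \<bullet> (S *v v) = 1"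
    "\<And>w. \<exists>Q z. antisymmetric Q \<and> drift S \<Sigma> Q *v (S *v v) = \<mu> *\<^sub>R (S *v v) + z \<and>
       drift S \<Sigma> Q *v z = \<mu> *\<^sub>R z - w\<^sup>2 *\<^sub>R (S *v v)"
proof -
  have "(axis undefined 1 :: real^'n) \<noteq> 0" by (simp add: axis_eq_0_iff)
  then obtain v1 l1 where v1: "v1 \<bullet> (S *v v1) = 1"
      "\<And>u. u \<bullet> (\<Sigma> *v v1) = l1 * (u \<bullet> (S *v v1))"
    by (rule generalized_eigenvector[OF S sym_posdef_sym[OF \<Sigma>] _ inner_zero_right])
      (rule that, simp_all)
  define u1 where "u1 = S *v v1"
  \<comment> \<open>A second dimension supplies a nonzero vector in the hyperplane orthogonal to
    \<open>u1\<close>, from which the second eigenvector is taken.\<close>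
  have "2 \<le> DIM(real^'n)" using n by simp
  then obtain v0 where "v0 \<noteq> 0" "orthogonal u1 v0" by (rule orthogonal_to_vector_exists)
  then have v0: "v0 \<noteq> 0" "v0 \<bullet> u1 = 0" by (simp_all add: orthogonal_def inner_commute)
  obtain v2 l2 where v2: "v2 \<bullet> u1 = 0" "v2 \<bullet> (S *v v2) = 1"
      "\<And>u. u \<bullet> u1 = 0 \<Longrightarrow> u \<bullet> (\<Sigma> *v v2) = l2 * (u \<bullet> (S *v v2))"
    by (rule generalized_eigenvector[OF S sym_posdef_sym[OF \<Sigma>] v0]) (rule that, simp_all)
  define u2 where "u2 = S *v v2"
  have v12: "v1 \<bullet> u2 = 0"
    using v2(1) symmetric_dot[OF sym_posdef_sym[OF S], of v1 v2] by (simp add: u1_def u2_def)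
  \<comment> \<open>The eigenvector relation is known only for vectors orthogonal to
    \<open>u1\<close>. Subtracting a multiple of \<open>v1\<close> reaches that hyperplane, and both
    sides vanish at \<open>v1\<close>.\<close>
  have "u \<bullet> (\<Sigma> *v v2) = l2 * (u \<bullet> u2)" for u
  proof -
    have "v1 \<bullet> (\<Sigma> *v v2) = 0"
      using symmetric_dot[OF sym_posdef_sym[OF \<Sigma>], of v1 v2] v1(2)[of v2] v2(1) by (simp add: u1_def)
    moreover have "(u - (u \<bullet> u1) *\<^sub>R v1) \<bullet> u1 = 0" using v1(1) by (simp add: u1_def inner_diff_left)
    ultimately show ?thesis
      using v2(3)[of "u - (u \<bullet> u1) *\<^sub>R v1"] v12 by (simp add: inner_diff_left u2_def)
  qed
  then have \<Sigma>v2: "\<Sigma> *v v2 = l2 *\<^sub>R u2" by (intro vector_eq_ldot[THEN iffD1]) simp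
  have \<Sigma>v1: "\<Sigma> *v v1 = l1 *\<^sub>R u1" using v1(2) by (intro vector_eq_ldot[THEN iffD1]) (simp add: u1_def)
  define \<mu> \<nu> where "\<mu> = (l1 + l2) / 4" and "\<nu> = (l1 - l2) / 4"
  have \<mu>\<nu>: "l1 / 2 = \<mu> + \<nu>" "l2 / 2 = \<mu> - \<nu>" by (simp_all add: \<mu>_def \<nu>_def field_simps)
  show thesis
  proof (rule that[of v1 \<mu>])
    show "v1 \<bullet> (S *v v1) = 1" by fact
    fix w :: real
    \<comment> \<open>Chosen so that \<nu>^2 - c^2 = -w^2: the circulation must outweigh the gap
      between the two decay rates before the plane rotates.\<close>
    define c where "c = sqrt (w\<^sup>2 + \<nu>\<^sup>2)"
    have c: "c * c = w\<^sup>2 + \<nu>\<^sup>2" by (simp add: c_def)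
    define Q :: "real^'n^'n" where "Q = (\<chi> i j. c * (u1 $ i * u2 $ j - u2 $ i * u1 $ j))"
    define A where "A = drift S \<Sigma> Q"
    have Q: "antisymmetric Q"
      by (simp add: antisymmetric_def Q_def vec_eq_iff transpose_def algebra_simps)
    have Qv: "Q *v x = c *\<^sub>R ((x \<bullet> u2) *\<^sub>R u1 - (x \<bullet> u1) *\<^sub>R u2)" for x
      by (simp add: Q_def vec_eq_iff matrix_vector_mult_def inner_vec_def sum_distrib_left
          sum_distrib_right sum_subtractf algebra_simps)
    have AS: "A *v (S *v x) = (1/2) *\<^sub>R (\<Sigma> *v x) + Q *v x" for x
      by (simp add: A_def matrix_vector_mul_assoc drift_times[OF S] matrix_vector_mult_add_rdistrib
          flip: scaleR_matrix_vector_assoc)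
    have A1: "A *v u1 = (\<mu> + \<nu>) *\<^sub>R u1 - c *\<^sub>R u2"
      using AS[of v1] v1(1) v12 by (simp add: \<Sigma>v1 Qv \<mu>\<nu> flip: u1_def)
    have A2: "A *v u2 = (\<mu> - \<nu>) *\<^sub>R u2 + c *\<^sub>R u1"
      using AS[of v2] v2(1,2) by (simp add: \<Sigma>v2 Qv \<mu>\<nu> flip: u2_def)
    let ?z = "\<nu> *\<^sub>R u1 - c *\<^sub>R u2"
    have "A *v u1 = \<mu> *\<^sub>R u1 + ?z" by (simp add: A1 algebra_simps)
    moreover have "A *v ?z = \<mu> *\<^sub>R ?z + (\<nu>\<^sup>2 - c * c) *\<^sub>R u1"
      by (simp add: A1 A2 matrix_vector_mult_diff_distrib matrix_vector_mult_scaleR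
          algebra_simps power2_eq_square)
    ultimately show "\<exists>Q z. antisymmetric Q \<and> drift S \<Sigma> Q *v (S *v v1) = \<mu> *\<^sub>R (S *v v1) + z \<and>
       drift S \<Sigma> Q *v z = \<mu> *\<^sub>R z - w\<^sup>2 *\<^sub>R (S *v v1)"
      using Q by (intro exI[of _ Q] exI[of _ ?z]) (simp add: A_def c flip: u1_def)
  qed
qed

subsection \<open>Second moments of random vectors\<close>

lemma abs_mult_le_sum_squares: "\<bar>a * b\<bar> \<le> a\<^sup>2 + b\<^sup>2" for a b :: real
proof -
  have "2 * (\<bar>a\<bar> * \<bar>b\<bar>) \<le> a\<^sup>2 + b\<^sup>2"
    using sum_squares_bound[of "\<bar>a\<bar>" "\<bar>b\<bar>"] by (simp add: mult.assoc)
  moreover have "0 \<le> \<bar>a\<bar> * \<bar>b\<bar>" by simp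
  ultimately show ?thesis unfolding abs_mult by linarith
qed

lemma integrable_mult_if_squares:
  fixes f g :: "'a \<Rightarrow> real"
  assumes [measurable]: "f \<in> borel_measurable M" "g \<in> borel_measurable M"
    and "integrable M (\<lambda>x. (f x)\<^sup>2)" "integrable M (\<lambda>x. (g x)\<^sup>2)"
  shows "integrable M (\<lambda>x. f x * g x)"
proof (rule Bochner_Integration.integrable_bound)
  show "integrable M (\<lambda>x. (f x)\<^sup>2 + (g x)\<^sup>2)" using assms by simp
  show "AE x in M. norm (f x * g x) \<le> norm ((f x)\<^sup>2 + (g x)\<^sup>2)"
    by (simp add: abs_mult_le_sum_squares)
qed simp

definition square_integrable :: "'a measure \<Rightarrow> ('a \<Rightarrow> real^'n) \<Rightarrow> bool" where
  "square_integrable M X \<longleftrightarrow>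
     X \<in> borel_measurable M \<and> (\<forall>i. integrable M (\<lambda>\<omega>. (X \<omega> $ i)\<^sup>2))"

text \<open>E[X Y']. Means are treated as second moments too: against the constant
  \<open>vec 1\<close> every column is the mean of X.\<close>

definition cross_moment :: "'a measure \<Rightarrow> ('a \<Rightarrow> real^'n) \<Rightarrow> ('a \<Rightarrow> real^'m) \<Rightarrow> real^'m^'n" where
  "cross_moment M X Y = (\<chi> i j. \<integral>\<omega>. X \<omega> $ i * Y \<omega> $ j \<partial>M)"

lemma square_integrable_measurable:
  "square_integrable M X \<Longrightarrow> X \<in> borel_measurable M"
  by (simp add: square_integrable_def)

lemma borel_measurable_vec_nth:
  fixes X :: "'a \<Rightarrow> real^'n"
  shows "X \<in> borel_measurable M \<Longrightarrow> (\<lambda>\<omega>. X \<omega> $ i) \<in> borel_measurable M"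
  by (erule measurable_compose) (intro borel_measurable_continuous_onI continuous_intros)

lemma square_integrable_component_measurable:
  "square_integrable M X \<Longrightarrow> (\<lambda>\<omega>. X \<omega> $ i) \<in> borel_measurable M"
  by (intro borel_measurable_vec_nth square_integrable_measurable)

lemma square_integrable_mult:
  "square_integrable M X \<Longrightarrow> square_integrable M Y \<Longrightarrow> integrable M (\<lambda>\<omega>. X \<omega> $ i * Y \<omega> $ j)"
  by (intro integrable_mult_if_squares square_integrable_component_measurable)
    (auto simp: square_integrable_def)

lemma square_integrableI:
  fixes X :: "'a \<Rightarrow> real^'n"
  assumes "X \<in> borel_measurable M" "integrable M (\<lambda>\<omega>. X \<omega> \<bullet> X \<omega>)"
  shows "square_integrable M X"
  unfolding square_integrable_def
proof (intro conjI allI assms(1))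
  fix i
  have [measurable]: "(\<lambda>\<omega>. X \<omega> $ i) \<in> borel_measurable M"
    using assms(1) by (rule borel_measurable_vec_nth)
  have "(v $ i)\<^sup>2 \<le> v \<bullet> v" for v :: "real^'n"
    using member_le_sum[of i UNIV "\<lambda>i. v $ i \<bullet> v $ i"] by (simp add: inner_vec_def power2_eq_square)
  then show "integrable M (\<lambda>\<omega>. (X \<omega> $ i)\<^sup>2)"
    by (intro Bochner_Integration.integrable_bound[OF assms(2)]) auto
qed

lemma square_integrable_inner:
  fixes X :: "'a \<Rightarrow> real^'n"
  shows "square_integrable M X \<Longrightarrow> square_integrable M Y \<Longrightarrow> integrable M (\<lambda>\<omega>. X \<omega> \<bullet> Y \<omega>)"
  unfolding inner_vec_def by (auto intro: square_integrable_mult)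

lemma square_integrable_matrix:
  fixes X :: "'a \<Rightarrow> real^'n" and A :: "real^'n^'m"
  assumes X: "square_integrable M X"
  shows "square_integrable M (\<lambda>\<omega>. A *v X \<omega>)"
proof (rule square_integrableI)
  show "(\<lambda>\<omega>. A *v X \<omega>) \<in> borel_measurable M"
    by (rule borel_measurable_continuous_on[OF _ square_integrable_measurable[OF X]])
      (intro linear_continuous_on matrix_vector_mul_bounded_linear)
  have "integrable M (\<lambda>\<omega>. \<Sum>i\<in>UNIV. \<Sum>j\<in>UNIV. \<Sum>k\<in>UNIV. A $ i $ j * A $ i $ k * (X \<omega> $ j * X \<omega> $ k))"
    using square_integrable_mult[OF X X] by auto
  also have "(\<lambda>\<omega>. \<Sum>i\<in>UNIV. \<Sum>j\<in>UNIV. \<Sum>k\<in>UNIV. A $ i $ j * A $ i $ k * (X \<omega> $ j * X \<omega> $ k)) =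
      (\<lambda>\<omega>. (A *v X \<omega>) \<bullet> (A *v X \<omega>))"
    by (simp add: inner_vec_def matrix_vector_mult_def sum_product mult_ac)
  finally show "integrable M (\<lambda>\<omega>. (A *v X \<omega>) \<bullet> (A *v X \<omega>))" .
qed

lemma square_integrable_add:
  fixes X Y :: "'a \<Rightarrow> real^'n"
  assumes X: "square_integrable M X" and Y: "square_integrable M Y"
  shows "square_integrable M (\<lambda>\<omega>. X \<omega> + Y \<omega>)"
proof (rule square_integrableI)
  show "(\<lambda>\<omega>. X \<omega> + Y \<omega>) \<in> borel_measurable M"
    using X Y by (intro borel_measurable_add square_integrable_measurable)
  show "integrable M (\<lambda>\<omega>. (X \<omega> + Y \<omega>) \<bullet> (X \<omega> + Y \<omega>))"
    using square_integrable_inner[OF X X] square_integrable_inner[OF X Y] square_integrable_inner[OF Y Y]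
      square_integrable_inner[OF Y X]
    by (simp add: inner_add_left inner_add_right)
qed

lemma square_integrable_diff:
  fixes X Y :: "'a \<Rightarrow> real^'n"
  assumes X: "square_integrable M X" and Y: "square_integrable M Y"
  shows "square_integrable M (\<lambda>\<omega>. X \<omega> - Y \<omega>)"
proof (rule square_integrableI)
  show "(\<lambda>\<omega>. X \<omega> - Y \<omega>) \<in> borel_measurable M"
    using X Y by (intro borel_measurable_diff square_integrable_measurable)
  show "integrable M (\<lambda>\<omega>. (X \<omega> - Y \<omega>) \<bullet> (X \<omega> - Y \<omega>))"
    using square_integrable_inner[OF X X] square_integrable_inner[OF X Y] square_integrable_inner[OF Y Y]
      square_integrable_inner[OF Y X]
    by (simp add: inner_diff_left inner_diff_right)
qed

lemma square_integrable_zero: "square_integrable M (\<lambda>_. 0 :: real^'n)"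
  by (simp add: square_integrable_def)

lemma square_integrable_sum:
  fixes X :: "'i \<Rightarrow> 'a \<Rightarrow> real^'n"
  assumes "\<And>i. i \<in> I \<Longrightarrow> square_integrable M (X i)"
  shows "square_integrable M (\<lambda>\<omega>. \<Sum>i\<in>I. X i \<omega>)"
  using assms
  by (induction I rule: infinite_finite_induct)
    (simp_all add: square_integrable_zero square_integrable_add)

lemma square_integrable_cong_AE:
  assumes "AE \<omega> in M. X \<omega> = Y \<omega>" "square_integrable M X" "Y \<in> borel_measurable M"
  shows "square_integrable M Y"
proof -
  have Y: "(\<lambda>\<omega>. Y \<omega> $ i) \<in> borel_measurable M" for i
    using assms(3) by (rule borel_measurable_vec_nth)
  have "integrable M (\<lambda>\<omega>. (Y \<omega> $ i)\<^sup>2)" for i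
  proof (rule integrable_cong_AE_imp)
    show "integrable M (\<lambda>\<omega>. (X \<omega> $ i)\<^sup>2)" using assms(2) by (simp add: square_integrable_def)
    show "(\<lambda>\<omega>. (Y \<omega> $ i)\<^sup>2) \<in> borel_measurable M" using Y by simp
    show "AE \<omega> in M. (X \<omega> $ i)\<^sup>2 = (Y \<omega> $ i)\<^sup>2" using assms(1) by eventually_elim simp
  qed
  then show ?thesis using assms(3) by (simp add: square_integrable_def)
qed

lemma cross_moment_cong_AE:
  assumes "AE \<omega> in M. X \<omega> = X' \<omega>" "AE \<omega> in M. Y \<omega> = Y' \<omega>"
    and "X \<in> borel_measurable M" "X' \<in> borel_measurable M"
    and "Y \<in> borel_measurable M" "Y' \<in> borel_measurable M"
  shows "cross_moment M X Y = cross_moment M X' Y'"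
proof -
  have "(\<integral>\<omega>. X \<omega> $ i * Y \<omega> $ j \<partial>M) = (\<integral>\<omega>. X' \<omega> $ i * Y' \<omega> $ j \<partial>M)" for i j
    using assms
    by (intro integral_cong_AE borel_measurable_times borel_measurable_vec_nth) auto
  then show ?thesis by (simp add: cross_moment_def)
qed

lemma cross_moment_transpose: "transpose (cross_moment M X Y) = cross_moment M Y X"
  by (simp add: cross_moment_def transpose_def vec_eq_iff mult.commute)

lemma cross_moment_add_left:
  assumes "square_integrable M X" "square_integrable M X'" "square_integrable M Y"
  shows "cross_moment M (\<lambda>\<omega>. X \<omega> + X' \<omega>) Y = cross_moment M X Y + cross_moment M X' Y"
  by (simp add: cross_moment_def vec_eq_iff distrib_right square_integrable_mult assms)

lemma cross_moment_diff_left: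
  assumes "square_integrable M X" "square_integrable M X'" "square_integrable M Y"
  shows "cross_moment M (\<lambda>\<omega>. X \<omega> - X' \<omega>) Y = cross_moment M X Y - cross_moment M X' Y"
  by (simp add: cross_moment_def vec_eq_iff left_diff_distrib square_integrable_mult assms)

lemma cross_moment_matrix_left:
  assumes "square_integrable M X" "square_integrable M Y"
  shows "cross_moment M (\<lambda>\<omega>. A *v X \<omega>) Y = A ** cross_moment M X Y"
  by (simp add: cross_moment_def vec_eq_iff matrix_vector_mult_def matrix_matrix_mult_def
      sum_distrib_right mult.assoc square_integrable_mult assms)

lemma cross_moment_add_right:
  assumes "square_integrable M X" "square_integrable M Y" "square_integrable M Y'"
  shows "cross_moment M X (\<lambda>\<omega>. Y \<omega> + Y' \<omega>) = cross_moment M X Y + cross_moment M X Y'"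
  by (simp add: cross_moment_def vec_eq_iff distrib_left square_integrable_mult assms)

lemma cross_moment_diff_right:
  assumes "square_integrable M X" "square_integrable M Y" "square_integrable M Y'"
  shows "cross_moment M X (\<lambda>\<omega>. Y \<omega> - Y' \<omega>) = cross_moment M X Y - cross_moment M X Y'"
  by (simp add: cross_moment_def vec_eq_iff right_diff_distrib square_integrable_mult assms)

lemma cross_moment_matrix_right:
  assumes "square_integrable M X" "square_integrable M Y"
  shows "cross_moment M X (\<lambda>\<omega>. A *v Y \<omega>) = cross_moment M X Y ** transpose A"
  using arg_cong[OF cross_moment_matrix_left[OF assms(2,1), of A], of transpose]
  by (simp add: cross_moment_transpose matrix_transpose_mul)

lemma cross_moment_sum_right:
  assumes "\<And>i. i \<in> I \<Longrightarrow> square_integrable M (Y i)" "square_integrable M X"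
  shows "cross_moment M X (\<lambda>\<omega>. \<Sum>i\<in>I. Y i \<omega>) = (\<Sum>i\<in>I. cross_moment M X (Y i))"
  by (simp add: cross_moment_def vec_eq_iff sum_distrib_left square_integrable_mult assms)

text \<open>Rounding the time down to a grid of mesh 1 / (n + 1) makes the process a countable
  selection of measurable functions; continuity of the paths recovers it in the limit. Fubini
  requires this joint measurability.\<close>

lemma continuous_process_measurable:
  fixes f :: "real \<Rightarrow> 'a \<Rightarrow> real"
  assumes meas: "\<And>s. f s \<in> borel_measurable M"
    and cont: "\<And>\<omega>. \<omega> \<in> space M \<Longrightarrow> continuous_on UNIV (\<lambda>s. f s \<omega>)"
  shows "(\<lambda>(s, \<omega>). f s \<omega>) \<in> borel_measurable (borel \<Otimes>\<^sub>M M)"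
proof -
  define h :: "nat \<Rightarrow> real \<Rightarrow> real" where "h n s = real_of_int \<lfloor>s * Suc n\<rfloor> / Suc n" for n s
  have h_lim: "(\<lambda>n. h n s) \<longlonglongrightarrow> s" for s
  proof (rule LIMSEQ_I)
    fix r :: real assume "0 < r"
    then obtain N where N: "inverse (real (Suc N)) < r" using reals_Archimedean by blast
    have "norm (h n s - s) < r" if "n \<ge> N" for n
    proof -
      have "\<bar>real_of_int \<lfloor>s * Suc n\<rfloor> - s * Suc n\<bar> \<le> 1" by linarith
      moreover have "h n s - s = (real_of_int \<lfloor>s * Suc n\<rfloor> - s * Suc n) / Suc n"
        unfolding h_def diff_divide_distrib by simp
      ultimately have "\<bar>h n s - s\<bar> \<le> inverse (Suc n)"
        by (simp add: abs_divide inverse_eq_divide divide_right_mono)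
      also have "\<dots> \<le> inverse (Suc N)" using that by (simp add: field_simps)
      finally show ?thesis using N by simp
    qed
    then show "\<exists>no. \<forall>n\<ge>no. norm (h n s - s) < r" by blast
  qed
  show ?thesis
  proof (rule borel_measurable_LIMSEQ_real)
    show "(\<lambda>p. f (h n (fst p)) (snd p)) \<in> borel_measurable (borel \<Otimes>\<^sub>M M)" for n
    proof -
      define F where "F i p = f (real_of_int i / Suc n) (snd p)" for i and p :: "real \<times> 'a"
      have "F i \<in> borel_measurable (borel \<Otimes>\<^sub>M M)" for i
        unfolding F_def using meas by (rule measurable_compose[OF measurable_snd])
      moreover have "(\<lambda>p :: real \<times> 'a. \<lfloor>fst p * Suc n\<rfloor>) \<in> (borel \<Otimes>\<^sub>M M) \<rightarrow>\<^sub>M count_space UNIV"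
        by measurable
      ultimately have "(\<lambda>p :: real \<times> 'a. F \<lfloor>fst p * Suc n\<rfloor> p) \<in> borel_measurable (borel \<Otimes>\<^sub>M M)"
        by (rule measurable_compose_countable)
      then show ?thesis by (simp add: F_def h_def)
    qed
    fix p :: "real \<times> 'a" assume "p \<in> space (borel \<Otimes>\<^sub>M M)"
    then have "snd p \<in> space M" by (auto simp: space_pair_measure)
    then have "isCont (\<lambda>s. f s (snd p)) (fst p)"
      using cont by (simp add: continuous_on_eq_continuous_at)
    from isCont_tendsto_compose[OF this h_lim]
    show "(\<lambda>n. f (h n (fst p)) (snd p)) \<longlonglongrightarrow> (\<lambda>(s, \<omega>). f s \<omega>) p"
      by (simp add: case_prod_beta)
  qed
qed

text \<open>Fubini on the product of [0, T] and M. The uniform bound K makes the time integral of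
  the first absolute moments finite.\<close>

lemma integral_of_continuous_process:
  fixes f :: "real \<Rightarrow> 'a \<Rightarrow> real"
  assumes "prob_space M"
    and meas: "\<And>s. f s \<in> borel_measurable M"
    and cont: "\<And>\<omega>. \<omega> \<in> space M \<Longrightarrow> continuous_on UNIV (\<lambda>s. f s \<omega>)"
    and bound: "\<And>s. 0 \<le> s \<Longrightarrow> s \<le> T \<Longrightarrow> integrable M (f s)"
      "\<And>s. 0 \<le> s \<Longrightarrow> s \<le> T \<Longrightarrow> (\<integral>\<omega>. \<bar>f s \<omega>\<bar> \<partial>M) \<le> K"
  shows "integrable M (\<lambda>\<omega>. integral {0..T} (\<lambda>s. f s \<omega>))"
    and "(\<lambda>s. \<integral>\<omega>. f s \<omega> \<partial>M) integrable_on {0..T}"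
    and "(\<integral>\<omega>. integral {0..T} (\<lambda>s. f s \<omega>) \<partial>M) = integral {0..T} (\<lambda>s. \<integral>\<omega>. f s \<omega> \<partial>M)"
proof -
  interpret prob_space M by fact
  interpret P: pair_sigma_finite lborel M ..
  define g where "g s \<omega> = indicator {0..T} s * f s \<omega>" for s \<omega>
  have [measurable]: "(\<lambda>(s, \<omega>). f s \<omega>) \<in> borel_measurable (lborel \<Otimes>\<^sub>M M)"
    using continuous_process_measurable[OF meas cont] by simp
  have g_meas[measurable]: "case_prod g \<in> borel_measurable (lborel \<Otimes>\<^sub>M M)"
    unfolding g_def case_prod_beta' by measurable
  have "integrable (lborel \<Otimes>\<^sub>M M) (case_prod g)"
  proof (rule P.Fubini_integrable)
    show "case_prod g \<in> borel_measurable (lborel \<Otimes>\<^sub>M M)" by fact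
    show "AE s in lborel. integrable M (\<lambda>\<omega>. case_prod g (s, \<omega>))"
      using bound(1) by (auto simp: g_def split: split_indicator)
    show "integrable lborel (\<lambda>s. \<integral>\<omega>. norm (case_prod g (s, \<omega>)) \<partial>M)"
    proof (rule Bochner_Integration.integrable_bound)
      show "integrable lborel (\<lambda>s. K * indicator {0..T} s)"
        by (intro integrable_mult_right integrable_real_indicator) (auto simp: emeasure_lborel_Icc_eq)
      show "(\<lambda>s. \<integral>\<omega>. norm (case_prod g (s, \<omega>)) \<partial>M) \<in> borel_measurable lborel"
        by measurable
      show "AE s in lborel. norm (\<integral>\<omega>. norm (case_prod g (s, \<omega>)) \<partial>M) \<le> norm (K * indicator {0..T} s)"
        using order_trans[OF bound(2) abs_ge_self]
        by (intro AE_I2) (auto simp: g_def abs_mult split: split_indicator)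
    qed
  qed
  note int = this
  \<comment> \<open>The equation uses the Henstock-Kurzweil integral of a path, Fubini the Lebesgue
    integral; the two agree on continuous paths.\<close>
  have pathwise: "(\<integral>s. g s \<omega> \<partial>lborel) = integral {0..T} (\<lambda>s. f s \<omega>)" if "\<omega> \<in> space M" for \<omega>
  proof -
    have "set_integrable lborel {0..T} (\<lambda>s. f s \<omega>)"
      using cont[OF that] by (intro borel_integrable_atLeastAtMost') (auto intro: continuous_on_subset)
    from set_borel_integral_eq_integral(2)[OF this] show ?thesis
      by (simp add: set_lebesgue_integral_def g_def)
  qed
  have "integrable M (\<lambda>\<omega>. \<integral>s. g s \<omega> \<partial>lborel)" using P.integrable_snd[OF int] by simp
  then show "integrable M (\<lambda>\<omega>. integral {0..T} (\<lambda>s. f s \<omega>))"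
    by (simp add: pathwise cong: Bochner_Integration.integrable_cong)
  have "integrable lborel (\<lambda>s. \<integral>\<omega>. g s \<omega> \<partial>M)" using P.integrable_fst[OF int] by simp
  then have si: "set_integrable lborel {0..T} (\<lambda>s. \<integral>\<omega>. f s \<omega> \<partial>M)"
    by (simp add: set_integrable_def g_def)
  from set_borel_integral_eq_integral(1)[OF si]
  show "(\<lambda>s. \<integral>\<omega>. f s \<omega> \<partial>M) integrable_on {0..T}" .
  have "(\<integral>\<omega>. integral {0..T} (\<lambda>s. f s \<omega>) \<partial>M) = (\<integral>\<omega>. (\<integral>s. g s \<omega> \<partial>lborel) \<partial>M)"
    by (intro Bochner_Integration.integral_cong) (simp_all add: pathwise)
  also have "\<dots> = (\<integral>s. (\<integral>\<omega>. g s \<omega> \<partial>M) \<partial>lborel)" by (rule P.Fubini_integral[OF int])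
  also have "\<dots> = integral {0..T} (\<lambda>s. \<integral>\<omega>. f s \<omega> \<partial>M)"
    using set_borel_integral_eq_integral(2)[OF si] by (simp add: set_lebesgue_integral_def g_def)
  finally show "(\<integral>\<omega>. integral {0..T} (\<lambda>s. f s \<omega>) \<partial>M) = integral {0..T} (\<lambda>s. \<integral>\<omega>. f s \<omega> \<partial>M)" .
qed

text \<open>Comparing the expectations of \<open>min u n\<close> and \<open>min v n\<close>, which agree, bounds the expectation
  of \<open>min v n - min (q v) n\<close> uniformly in \<open>n\<close>; Fatou's lemma then bounds that of \<open>(1 - q) v\<close>.\<close>

lemma integrable_if_contractive_in_law:
  fixes u v Z :: "'a \<Rightarrow> real"
  assumes "prob_space M"
    and [measurable]: "u \<in> borel_measurable M" "v \<in> borel_measurable M" and Z: "integrable M Z"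
    and nonneg: "\<And>\<omega>. \<omega> \<in> space M \<Longrightarrow> 0 \<le> u \<omega>" "\<And>\<omega>. \<omega> \<in> space M \<Longrightarrow> 0 \<le> v \<omega>"
      "\<And>\<omega>. \<omega> \<in> space M \<Longrightarrow> 0 \<le> Z \<omega>"
    and law: "distr M borel u = distr M borel v"
    and le: "\<And>\<omega>. \<omega> \<in> space M \<Longrightarrow> u \<omega> \<le> q * v \<omega> + Z \<omega>" and q: "0 \<le> q" "q < 1"
  shows "integrable M v"
proof -
  interpret prob_space M by fact
  have int_min: "integrable M (\<lambda>\<omega>. min (w \<omega>) (real n))"
    if [measurable]: "w \<in> borel_measurable M" and "\<And>\<omega>. \<omega> \<in> space M \<Longrightarrow> 0 \<le> w \<omega>" for w n
    using that(2) by (intro integrable_const_bound[where B = "real n"] AE_I2) auto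
  have iu: "integrable M (\<lambda>\<omega>. min (u \<omega>) (real n))"
    and iv: "integrable M (\<lambda>\<omega>. min (v \<omega>) (real n))"
    and iq: "integrable M (\<lambda>\<omega>. min (q * v \<omega>) (real n))" for n
    using nonneg q by (auto intro!: int_min)
  define d where "d n \<omega> = min (v \<omega>) (real n) - min (q * v \<omega>) (real n)" for n \<omega>
  have [measurable]: "d n \<in> borel_measurable M" for n unfolding d_def by measurable
  have d_nonneg: "0 \<le> d n \<omega>" if "\<omega> \<in> space M" for n \<omega>
    using nonneg(2)[OF that] q mult_right_mono[of q 1 "v \<omega>"] by (auto simp: d_def min_def)
  have d_int: "integrable M (d n)" for n unfolding d_def using iv iq by simp
  have "expectation (d n) \<le> expectation Z" for n
  proof -
    have "expectation (\<lambda>\<omega>. min (v \<omega>) (real n)) = expectation (\<lambda>\<omega>. min (u \<omega>) (real n))"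
      using integral_distr[of v M borel "\<lambda>x. min x (real n)"]
        integral_distr[of u M borel "\<lambda>x. min x (real n)"] law by simp
    \<comment> \<open>As Z >= 0, truncation only has to act on the first summand: min (q v + Z) n <=
      min (q v) n + Z.\<close>
    also have "\<dots> \<le> expectation (\<lambda>\<omega>. min (q * v \<omega>) (real n) + Z \<omega>)"
    proof (rule integral_mono[OF iu])
      show "min (u \<omega>) (real n) \<le> min (q * v \<omega>) (real n) + Z \<omega>" if "\<omega> \<in> space M" for \<omega>
        using le[OF that] nonneg(3)[OF that] by linarith
    qed (use iq Z in simp)
    also have "\<dots> = expectation (\<lambda>\<omega>. min (q * v \<omega>) (real n)) + expectation Z"
      using iq Z by simp
    moreover have "expectation (d n) =
        expectation (\<lambda>\<omega>. min (v \<omega>) (real n)) - expectation (\<lambda>\<omega>. min (q * v \<omega>) (real n))"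
      unfolding d_def using iv iq by simp
    ultimately show ?thesis by simp
  qed
  then have d_le: "(\<integral>\<^sup>+\<omega>. ennreal (d n \<omega>) \<partial>M) \<le> ennreal (expectation Z)" for n
    using d_int d_nonneg by (subst nn_integral_eq_integral) (auto intro: ennreal_leI)
  have "(\<integral>\<^sup>+\<omega>. ennreal ((1 - q) * v \<omega>) \<partial>M) = (\<integral>\<^sup>+\<omega>. liminf (\<lambda>n. ennreal (d n \<omega>)) \<partial>M)"
  proof (rule nn_integral_cong)
    fix \<omega> assume \<omega>: "\<omega> \<in> space M"
    \<comment> \<open>From n >= v on neither minimum truncates, since q v <= v.\<close>
    have "d n \<omega> = (1 - q) * v \<omega>" if "n \<ge> nat \<lceil>v \<omega>\<rceil>" for n
    proof -
      have "v \<omega> \<le> real n" using that by linarith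
      moreover have "q * v \<omega> \<le> v \<omega>" using q nonneg(2)[OF \<omega>] mult_right_mono[of q 1 "v \<omega>"] by simp
      ultimately show ?thesis by (simp add: d_def min_def left_diff_distrib)
    qed
    then have "\<forall>\<^sub>F n in sequentially. d n \<omega> = (1 - q) * v \<omega>"
      by (rule eventually_sequentiallyI)
    then have "(\<lambda>n. ennreal (d n \<omega>)) \<longlonglongrightarrow> ennreal ((1 - q) * v \<omega>)"
      by (intro tendsto_eventually) (rule eventually_mono, assumption, simp)
    then show "ennreal ((1 - q) * v \<omega>) = liminf (\<lambda>n. ennreal (d n \<omega>))"
      by (intro lim_imp_Liminf[symmetric]) auto
  qed
  also have "\<dots> \<le> liminf (\<lambda>n. \<integral>\<^sup>+\<omega>. ennreal (d n \<omega>) \<partial>M)" by (rule nn_integral_liminf) simp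
  also have "\<dots> \<le> limsup (\<lambda>n. \<integral>\<^sup>+\<omega>. ennreal (d n \<omega>) \<partial>M)" by (rule Liminf_le_Limsup) simp
  also have "\<dots> \<le> ennreal (expectation Z)" by (intro Limsup_bounded always_eventually allI d_le)
  finally have "(\<integral>\<^sup>+\<omega>. ennreal ((1 - q) * v \<omega>) \<partial>M) < \<infinity>" by (simp add: le_less_trans)
  then have "integrable M (\<lambda>\<omega>. (1 - q) * v \<omega>)"
    using nonneg(2) q by (intro integrableI_nonneg AE_I2) auto
  then show ?thesis using q by simp
qed

subsection \<open>The energy estimate\<close>

lemma integral_halfline_has_vector_derivative:
  fixes f :: "real \<Rightarrow> 'b::banach"
  assumes "continuous_on {0..} f" "0 \<le> t"
  shows "((\<lambda>u. integral {0..u} f) has_vector_derivative f t) (at t within {0..})"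
proof -
  have "((\<lambda>u. integral {0..u} f) has_vector_derivative f t) (at t within {0..t + 1})"
    using assms by (intro integral_has_vector_derivative) (auto intro: continuous_on_subset)
  moreover have "at t within {0..t + 1} = at t within {0..}"
    by (rule at_within_nhd[of t "{..<t + 1}"]) auto
  ultimately show ?thesis by simp
qed

text \<open>The right side minus the left is the form at a - b.\<close>

lemma quadratic_form_add_le:
  fixes P :: "real^'n^'n"
  assumes "\<And>v. 0 \<le> v \<bullet> (P *v v)"
  shows "(a + b) \<bullet> (P *v (a + b)) \<le> 2 * (a \<bullet> (P *v a)) + 2 * (b \<bullet> (P *v b))"
  using assms[of "a - b"]
  by (simp add: matrix_vector_right_distrib matrix_vector_mult_diff_distrib inner_add_left
      inner_add_right inner_diff_left inner_diff_right)

lemma sym_posdef_matrix_inv: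
  assumes S: "sym_posdef S"
  shows "sym_posdef (matrix_inv S)"
proof -
  let ?P = "matrix_inv S"
  have SP: "S *v (?P *v v) = v" and PS: "?P *v (S *v v) = v" for v
    using sym_posdef_invertible[OF S] by (simp_all add: matrix_vector_mul_assoc)
  have "transpose ?P ** S = mat 1"
    using arg_cong[OF sym_posdef_invertible(1)[OF S], of transpose] sym_posdef_sym[OF S]
    by (simp add: matrix_transpose_mul transpose_mat)
  then have "transpose ?P = ?P"
    by (metis matrix_mul_assoc matrix_mul_lid matrix_mul_rid sym_posdef_invertible(1)[OF S])
  moreover have "0 < v \<bullet> (?P *v v)" if "v \<noteq> 0" for v
  proof -
    have "?P *v v \<noteq> 0" using that SP[of v] by auto
    from sym_posdef_pos[OF S this] show ?thesis by (simp add: SP inner_commute)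
  qed
  ultimately show ?thesis by (simp add: sym_posdef_def)
qed

text \<open>The energy \<open>v \<bullet> S\<^sup>-\<^sup>1 v\<close> decays along the noiseless flow. It is applied to the state minus the
  noise, which is differentiable in time.\<close>

lemma energy_estimate:
  fixes S \<Sigma> Q R :: "real^'n^'n"
  assumes S: "sym_posdef S" and \<Sigma>: "sym_posdef \<Sigma>" and Q: "antisymmetric Q"
  obtains \<kappa> c where "\<kappa> > 0" "c > 0"
    "\<And>\<xi> \<eta> T. continuous_on UNIV \<xi> \<Longrightarrow> continuous_on UNIV \<eta> \<Longrightarrow> 0 \<le> T \<Longrightarrow>
       (\<And>t. 0 \<le> t \<Longrightarrow> \<xi> t = \<xi> 0 - drift S \<Sigma> Q *v integral {0..t} \<xi> + R *v \<eta> t) \<Longrightarrow>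
       (\<xi> T - R *v \<eta> T) \<bullet> (matrix_inv S *v (\<xi> T - R *v \<eta> T)) \<le>
         exp (- \<kappa> * T) * (\<xi> 0 \<bullet> (matrix_inv S *v \<xi> 0)) + c * integral {0..T} (\<lambda>s. \<eta> s \<bullet> \<eta> s)"
proof -
  define A P where "A = drift S \<Sigma> Q" and "P = matrix_inv S"
  have Psym: "transpose P = P"
    using sym_posdef_sym[OF sym_posdef_matrix_inv[OF S]] by (simp add: P_def)
  have SP: "S *v (P *v v) = v" for v
    using sym_posdef_invertible[OF S] by (simp add: matrix_vector_mul_assoc P_def)
  obtain \<sigma> where \<sigma>: "\<sigma> > 0" "\<And>v. \<sigma> * (v \<bullet> v) \<le> v \<bullet> (\<Sigma> *v v)"
    using sym_posdef_lower_bound[OF \<Sigma>] by blast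
  obtain k1 where k1: "k1 > 0" "\<And>v. norm (S *v v) \<le> k1 * norm v" using matrix_norm_bound[of S] by blast
  obtain k2 where k2: "k2 > 0" "\<And>v. norm ((A ** R) *v v) \<le> k2 * norm v"
    using matrix_norm_bound[of "A ** R"] by blast
  \<comment> \<open>Half of the dissipation p . \<Sigma> p >= \<sigma> (p . p) pays for the decay
    rate \<kappa>, through y . p <= k1 (p . p). The other half absorbs the cross term with the noise
    and leaves the constant c.\<close>
  define \<kappa> c where "\<kappa> = \<sigma> / (2 * k1)" and "c = 2 * k2\<^sup>2 / \<sigma>"
  have pos: "\<kappa> > 0" "c > 0" using \<sigma> k1 k2 by (simp_all add: \<kappa>_def c_def)
  have decay: "2 * ((P *v y) \<bullet> (A *v (y + R *v h))) \<ge> \<kappa> * (y \<bullet> (P *v y)) - c * (h \<bullet> h)" for y h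
  proof -
    define p r where "p = P *v y" and "r = (A ** R) *v h"
    \<comment> \<open>In the dual variable p = S^-1 y the circulation drops out of the
      dissipation.\<close>
    have "A *v y = ((1/2) *\<^sub>R \<Sigma> + Q) *v p"
      by (simp add: A_def drift_def p_def P_def matrix_vector_mul_assoc)
    then have pA: "2 * (p \<bullet> (A *v y)) = p \<bullet> (\<Sigma> *v p)"
      by (simp add: matrix_vector_mult_add_rdistrib inner_add_right antisymmetric_dot_self[OF Q]
          flip: scaleR_matrix_vector_assoc)
    have "y \<bullet> p = (S *v p) \<bullet> p" by (simp add: p_def SP)
    also have "\<dots> \<le> norm (S *v p) * norm p" by (rule norm_cauchy_schwarz)
    also have "\<dots> \<le> k1 * norm p * norm p" by (intro mult_right_mono k1) simp
    finally have "y \<bullet> p \<le> k1 * (p \<bullet> p)" by (simp add: dot_square_norm power2_eq_square)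
    then have "\<kappa> * (y \<bullet> p) \<le> \<kappa> * (k1 * (p \<bullet> p))" using pos by (intro mult_left_mono) auto
    also have "\<dots> = \<sigma> / 2 * (p \<bullet> p)" using k1 by (simp add: \<kappa>_def)
    finally have 1: "\<kappa> * (y \<bullet> p) \<le> \<sigma> / 2 * (p \<bullet> p)" .
    have "norm r \<le> k2 * norm h" unfolding r_def by (rule k2)
    then have "(norm r)\<^sup>2 \<le> (k2 * norm h)\<^sup>2" by (rule power_mono) simp
    then have "2 / \<sigma> * (r \<bullet> r) \<le> 2 / \<sigma> * ((k2 * norm h)\<^sup>2)"
      using \<sigma> by (intro mult_left_mono) (auto simp: dot_square_norm)
    also have "\<dots> = c * (h \<bullet> h)" by (simp add: c_def dot_square_norm power_mult_distrib)
    finally have 2: "2 / \<sigma> * (r \<bullet> r) \<le> c * (h \<bullet> h)" .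
    \<comment> \<open>Young's inequality with weight \<sigma>, as a completed square.\<close>
    have "0 \<le> (\<sigma> *\<^sub>R p + 2 *\<^sub>R r) \<bullet> (\<sigma> *\<^sub>R p + 2 *\<^sub>R r) / (2 * \<sigma>)" using \<sigma> by simp
    also have "\<dots> = \<sigma> / 2 * (p \<bullet> p) + 2 * (p \<bullet> r) + 2 / \<sigma> * (r \<bullet> r)"
      using \<sigma> by (simp add: inner_add_left inner_add_right inner_commute field_simps)
    finally have 3: "2 * (p \<bullet> r) \<ge> - (\<sigma> / 2 * (p \<bullet> p)) - 2 / \<sigma> * (r \<bullet> r)" by simp
    have "A *v (y + R *v h) = A *v y + r"
      by (simp add: r_def matrix_vector_right_distrib matrix_vector_mul_assoc)
    then have "2 * (p \<bullet> (A *v (y + R *v h))) = p \<bullet> (\<Sigma> *v p) + 2 * (p \<bullet> r)"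
      using pA by (simp add: inner_add_right)
    then have "2 * (p \<bullet> (A *v (y + R *v h))) \<ge> \<kappa> * (y \<bullet> p) - c * (h \<bullet> h)"
      using 1 2 3 \<sigma>(2)[of p] by linarith
    then show ?thesis by (simp add: p_def)
  qed
  have "(\<xi> T - R *v \<eta> T) \<bullet> (P *v (\<xi> T - R *v \<eta> T)) \<le>
         exp (- \<kappa> * T) * (\<xi> 0 \<bullet> (P *v \<xi> 0)) + c * integral {0..T} (\<lambda>s. \<eta> s \<bullet> \<eta> s)"
    if \<xi>: "continuous_on UNIV \<xi>" and \<eta>: "continuous_on UNIV \<eta>" and T: "0 \<le> T"
      and eq: "\<And>t. 0 \<le> t \<Longrightarrow> \<xi> t = \<xi> 0 - A *v integral {0..t} \<xi> + R *v \<eta> t" for \<xi> \<eta> T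
  proof -
    define y where "y t = \<xi> 0 - A *v integral {0..t} \<xi>" for t
    have y_eq: "y t = \<xi> t - R *v \<eta> t" if "0 \<le> t" for t using eq[OF that] by (simp add: y_def)
    have y0: "y 0 = \<xi> 0" by (simp add: y_def)
    have y': "(y has_vector_derivative - (A *v \<xi> t)) (at t within {0..})" if "0 \<le> t" for t
    proof -
      have "((\<lambda>t. integral {0..t} \<xi>) has_vector_derivative \<xi> t) (at t within {0..})"
        using \<xi> that by (intro integral_halfline_has_vector_derivative) (auto intro: continuous_on_subset)
      from bounded_linear.has_vector_derivative[OF matrix_vector_mul_bounded_linear[of A] this]
      show ?thesis unfolding y_def by (auto intro!: derivative_eq_intros)
    qed
    define g where "g t = y t \<bullet> (P *v y t)" for t
    have g': "(g has_real_derivative - 2 * ((P *v y t) \<bullet> (A *v \<xi> t))) (at t within {0..})"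
      if "0 \<le> t" for t
    proof -
      have "((\<lambda>t. P *v y t) has_vector_derivative P *v (- (A *v \<xi> t))) (at t within {0..})"
        by (rule bounded_linear.has_vector_derivative[OF matrix_vector_mul_bounded_linear y'[OF that]])
      from bounded_bilinear.has_vector_derivative[OF bounded_bilinear_inner y'[OF that] this]
      have "(g has_vector_derivative y t \<bullet> (P *v (- (A *v \<xi> t))) + (- (A *v \<xi> t)) \<bullet> (P *v y t))
          (at t within {0..})"
        unfolding g_def .
      also have "y t \<bullet> (P *v (- (A *v \<xi> t))) + (- (A *v \<xi> t)) \<bullet> (P *v y t) =
          - 2 * ((P *v y t) \<bullet> (A *v \<xi> t))"
        using symmetric_dot[OF Psym, of "y t" "- (A *v \<xi> t)"] by (simp add: inner_commute)
      finally show ?thesis by (simp add: has_real_derivative_iff_has_vector_derivative)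
    qed
    have \<eta>\<eta>: "continuous_on {0..} (\<lambda>s. \<eta> s \<bullet> \<eta> s)"
      using \<eta> by (intro continuous_intros) (auto intro: continuous_on_subset)
    define H where "H t = integral {0..t} (\<lambda>s. \<eta> s \<bullet> \<eta> s)" for t
    have H': "(H has_real_derivative \<eta> t \<bullet> \<eta> t) (at t within {0..})" if "0 \<le> t" for t
      unfolding H_def has_real_derivative_iff_has_vector_derivative
      by (rule integral_halfline_has_vector_derivative[OF \<eta>\<eta> that])
    \<comment> \<open>The noise term carries the fixed weight exp(\<kappa> T), which dominates
      exp(\<kappa> t) up to time T. Dividing by it at the end leaves the noise integral with the
      factor c alone.\<close>
    have "exp (\<kappa> * T) * g T - c * exp (\<kappa> * T) * H T \<le> exp (\<kappa> * 0) * g 0 - c * exp (\<kappa> * T) * H 0"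
    proof (rule halfline_deriv_nonpos_imp_le[where f = "\<lambda>t. exp (\<kappa> * t) * g t - c * exp (\<kappa> * T) * H t"])
      fix t :: real assume t: "0 \<le> t"
      show "((\<lambda>t. exp (\<kappa> * t) * g t - c * exp (\<kappa> * T) * H t) has_real_derivative
          exp (\<kappa> * t) * (\<kappa> * g t - 2 * ((P *v y t) \<bullet> (A *v \<xi> t))) - c * exp (\<kappa> * T) * (\<eta> t \<bullet> \<eta> t))
          (at t within {0..})"
        by (rule derivative_eq_intros g'[OF t] H'[OF t] refl)+ (simp add: algebra_simps)
      assume "t \<le> T"
      then have "exp (\<kappa> * t) \<le> exp (\<kappa> * T)" using pos by simp
      then have "exp (\<kappa> * t) * (c * (\<eta> t \<bullet> \<eta> t)) \<le> exp (\<kappa> * T) * (c * (\<eta> t \<bullet> \<eta> t))"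
        using pos by (intro mult_right_mono) auto
      moreover have "\<kappa> * g t - 2 * ((P *v y t) \<bullet> (A *v \<xi> t)) \<le> c * (\<eta> t \<bullet> \<eta> t)"
        using decay[of "y t" "\<eta> t"] y_eq[OF t] by (simp add: g_def)
      then have "exp (\<kappa> * t) * (\<kappa> * g t - 2 * ((P *v y t) \<bullet> (A *v \<xi> t))) \<le> exp (\<kappa> * t) * (c * (\<eta> t \<bullet> \<eta> t))"
        by (intro mult_left_mono) auto
      ultimately show "exp (\<kappa> * t) * (\<kappa> * g t - 2 * ((P *v y t) \<bullet> (A *v \<xi> t))) -
          c * exp (\<kappa> * T) * (\<eta> t \<bullet> \<eta> t) \<le> 0"
        by (simp add: algebra_simps)
    qed (use T in auto)
    moreover have "H 0 = 0" by (simp add: H_def)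
    ultimately have "exp (\<kappa> * T) * (g T - c * H T) \<le> g 0" by (simp add: algebra_simps)
    then have "exp (- \<kappa> * T) * (exp (\<kappa> * T) * (g T - c * H T)) \<le> exp (- \<kappa> * T) * g 0"
      by (intro mult_left_mono) auto
    moreover have "exp (- \<kappa> * T) * (exp (\<kappa> * T) * (g T - c * H T)) = g T - c * H T"
      by (simp add: mult.assoc[symmetric] flip: exp_add)
    ultimately have "g T - c * H T \<le> exp (- \<kappa> * T) * g 0" by (simp only:)
    then show ?thesis by (simp add: g_def H_def y0 y_eq[OF T])
  qed
  then show thesis using that[OF pos] unfolding A_def P_def by blast
qed

subsection \<open>Moments of the stationary process\<close>

lemma tendsto_matrix_mult:
  fixes f :: "'a \<Rightarrow> real^'n^'m" and g :: "'a \<Rightarrow> real^'k^'n"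
  assumes "(f \<longlongrightarrow> a) F" "(g \<longlongrightarrow> b) F"
  shows "((\<lambda>x. f x ** g x) \<longlongrightarrow> a ** b) F"
  unfolding matrix_matrix_mult_def by (intro tendsto_intros assms)

lemma tendsto_transpose:
  fixes f :: "'a \<Rightarrow> real^'n^'m"
  assumes "(f \<longlongrightarrow> a) F"
  shows "((\<lambda>x. transpose (f x)) \<longlongrightarrow> transpose a) F"
  unfolding transpose_def by (intro tendsto_intros assms)

text \<open>Every property is required of all sample points and, for the paths, of all real times: this
  is the situation after discarding a null set and freezing the processes before time \<open>0\<close>.\<close>

locale ou_process = prob_space M
  for M :: "'a measure" +
  fixes x W :: "real \<Rightarrow> 'a \<Rightarrow> real^'n" and S \<Sigma> Q R :: "real^'n^'n"
  assumes S: "sym_posdef S" and \<Sigma>: "sym_posdef \<Sigma>" and Q: "antisymmetric Q"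
    and R: "transpose R = R" "R ** R = \<Sigma>"
    and x_meas: "\<And>t. x t \<in> borel_measurable M"
    and W_meas: "\<And>t. W t \<in> borel_measurable M"
    and x_cont: "\<And>\<omega>. \<omega> \<in> space M \<Longrightarrow> continuous_on UNIV (\<lambda>t. x t \<omega>)"
    and W_cont: "\<And>\<omega>. \<omega> \<in> space M \<Longrightarrow> continuous_on UNIV (\<lambda>t. W t \<omega>)"
    and sde: "\<And>\<omega> t. \<omega> \<in> space M \<Longrightarrow> 0 \<le> t \<Longrightarrow>
      x t \<omega> = x 0 \<omega> - drift S \<Sigma> Q *v integral {0..t} (\<lambda>s. x s \<omega>) + R *v W t \<omega>"
    and pair_law: "\<And>s h. 0 \<le> s \<Longrightarrow> 0 \<le> h \<Longrightarrow>
      distr M (borel \<Otimes>\<^sub>M borel) (\<lambda>\<omega>. (x (s + h) \<omega>, x s \<omega>)) =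
      distr M (borel \<Otimes>\<^sub>M borel) (\<lambda>\<omega>. (x h \<omega>, x 0 \<omega>))"
    and W_sq: "\<And>t. 0 \<le> t \<Longrightarrow> square_integrable M (W t)"
    and W_mean: "\<And>t. 0 \<le> t \<Longrightarrow> cross_moment M (W t) (\<lambda>_. vec 1 :: real^'n) = 0"
    and W_cov: "\<And>t. 0 \<le> t \<Longrightarrow> cross_moment M (W t) (W t) = t *\<^sub>R mat 1"
    and W_orth: "\<And>t. 0 \<le> t \<Longrightarrow> square_integrable M (x 0) \<Longrightarrow> cross_moment M (W t) (x 0) = 0"
begin

abbreviation "A \<equiv> drift S \<Sigma> Q"

definition "I t \<omega> = integral {0..t} (\<lambda>s. x s \<omega>)"

lemma pair_meas: "(\<lambda>\<omega>. (x s \<omega>, x t \<omega>)) \<in> M \<rightarrow>\<^sub>M borel \<Otimes>\<^sub>M borel"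
  by (intro measurable_Pair x_meas)

lemma stationary_integrable:
  fixes g :: "(real^'n) \<times> (real^'n) \<Rightarrow> real"
  assumes "0 \<le> s" "0 \<le> h" and g: "g \<in> borel_measurable (borel \<Otimes>\<^sub>M borel)"
  shows "integrable M (\<lambda>\<omega>. g (x (s + h) \<omega>, x s \<omega>)) \<longleftrightarrow> integrable M (\<lambda>\<omega>. g (x h \<omega>, x 0 \<omega>))"
  using integrable_distr_eq[OF pair_meas[of "s + h" s] g] integrable_distr_eq[OF pair_meas[of h 0] g]
    pair_law[OF assms(1,2)] by simp

lemma stationary_integral:
  fixes g :: "(real^'n) \<times> (real^'n) \<Rightarrow> real"
  assumes "0 \<le> s" "0 \<le> h" and g: "g \<in> borel_measurable (borel \<Otimes>\<^sub>M borel)"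
  shows "(\<integral>\<omega>. g (x (s + h) \<omega>, x s \<omega>) \<partial>M) = (\<integral>\<omega>. g (x h \<omega>, x 0 \<omega>) \<partial>M)"
  using integral_distr[OF pair_meas[of "s + h" s] g] integral_distr[OF pair_meas[of h 0] g]
    pair_law[OF assms(1,2)] by simp

text \<open>\<open>W_orth\<close> becomes available only through this fact, so the argument rests on
  the pathwise energy estimate and on the equality in law of x_T and x_0.\<close>

lemma square_integrable_x0: "square_integrable M (x 0)"
proof -
  define P where "P = matrix_inv S"
  have P: "sym_posdef P" using sym_posdef_matrix_inv[OF S] by (simp add: P_def)
  define E where "E v = v \<bullet> (P *v v)" for v
  have E_nonneg: "0 \<le> E v" for v
    unfolding E_def using sym_posdef_pos[OF P, of v] by (cases "v = 0") auto
  have "continuous_on UNIV E"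
    unfolding E_def
    by (intro continuous_intros linear_continuous_on matrix_vector_mul_bounded_linear)
  then have E_meas: "E \<in> borel_measurable borel" by (rule borel_measurable_continuous_onI)
  obtain \<kappa> c where \<kappa>: "\<kappa> > 0" "c > 0" and est:
    "\<And>\<xi> \<eta> T. continuous_on UNIV \<xi> \<Longrightarrow> continuous_on UNIV \<eta> \<Longrightarrow> 0 \<le> T \<Longrightarrow>
       (\<And>t. 0 \<le> t \<Longrightarrow> \<xi> t = \<xi> 0 - drift S \<Sigma> Q *v integral {0..t} \<xi> + R *v \<eta> t) \<Longrightarrow>
       E (\<xi> T - R *v \<eta> T) \<le> exp (- \<kappa> * T) * E (\<xi> 0) + c * integral {0..T} (\<lambda>s. \<eta> s \<bullet> \<eta> s)"
    unfolding E_def P_def using energy_estimate[OF S \<Sigma> Q, of R] by blast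
  \<comment> \<open>The factor 1/4 anticipates the doubling in \<open>quadratic_form_add_le\<close>
    when the noise is added back; the contraction factor that remains is 1/2.\<close>
  define T where "T = ln 4 / \<kappa>"
  have T: "0 \<le> T" "exp (- \<kappa> * T) = 1 / 4"
    using \<kappa> by (simp_all add: T_def exp_minus)
  define Z where "Z \<omega> = 2 * (c * integral {0..T} (\<lambda>s. W s \<omega> \<bullet> W s \<omega>)) + 2 * E (R *v W T \<omega>)" for \<omega>
  have W2: "integrable M (\<lambda>\<omega>. W s \<omega> \<bullet> W s \<omega>)" if "0 \<le> s" for s
    using W_sq[OF that] by (simp add: square_integrable_inner)
  have W2_exp: "(\<integral>\<omega>. W s \<omega> \<bullet> W s \<omega> \<partial>M) = s * CARD('n)" if s: "0 \<le> s" for s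
  proof -
    have "(\<integral>\<omega>. W s \<omega> $ i * W s \<omega> $ i \<partial>M) = s" for i
      using arg_cong[OF W_cov[OF s], of "\<lambda>X. X $ i $ i"] by (simp add: cross_moment_def mat_def)
    then show ?thesis
      using square_integrable_mult[OF W_sq[OF s] W_sq[OF s]] by (simp add: inner_vec_def)
  qed
  have Z_int: "integrable M Z"
  proof -
    have "integrable M (\<lambda>\<omega>. integral {0..T} (\<lambda>s. W s \<omega> \<bullet> W s \<omega>))"
    proof (rule integral_of_continuous_process(1)[OF prob_space_axioms])
      show "(\<lambda>\<omega>. W s \<omega> \<bullet> W s \<omega>) \<in> borel_measurable M" for s
        using W_meas by (intro borel_measurable_inner)
      show "continuous_on UNIV (\<lambda>s. W s \<omega> \<bullet> W s \<omega>)" if "\<omega> \<in> space M" for \<omega>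
        using W_cont[OF that] by (intro continuous_intros)
      show "(\<integral>\<omega>. \<bar>W s \<omega> \<bullet> W s \<omega>\<bar> \<partial>M) \<le> T * CARD('n)" if "0 \<le> s" "s \<le> T" for s
        using W2_exp[OF that(1)] that by (simp add: mult_right_mono)
    qed (use W2 in auto)
    moreover have "integrable M (\<lambda>\<omega>. E (R *v W T \<omega>))"
      unfolding E_def using T W_sq by (intro square_integrable_inner square_integrable_matrix) auto
    ultimately show ?thesis unfolding Z_def by simp
  qed
  have "integrable M (\<lambda>\<omega>. E (x 0 \<omega>))"
  proof (rule integrable_if_contractive_in_law[OF prob_space_axioms _ _ Z_int])
    \<comment> \<open>The case h = 0 of \<open>pair_law\<close> contains the law at a single time,
      extracted by the first projection.\<close>
    have law: "distr M borel (\<lambda>\<omega>. E (x s \<omega>)) =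
        distr (distr M (borel \<Otimes>\<^sub>M borel) (\<lambda>\<omega>. (x s \<omega>, x s \<omega>))) borel (E \<circ> fst)" for s
      by (subst distr_distr) (auto simp: comp_def pair_meas intro: measurable_compose[OF measurable_fst E_meas])
    show "distr M borel (\<lambda>\<omega>. E (x T \<omega>)) = distr M borel (\<lambda>\<omega>. E (x 0 \<omega>))"
      using pair_law[OF T(1), of 0] by (simp add: law)
    show "E (x T \<omega>) \<le> 1 / 2 * E (x 0 \<omega>) + Z \<omega>" if \<omega>: "\<omega> \<in> space M" for \<omega>
    proof -
      have "E (x T \<omega> - R *v W T \<omega>) \<le> 1 / 4 * E (x 0 \<omega>) + c * integral {0..T} (\<lambda>s. W s \<omega> \<bullet> W s \<omega>)"
        using est[OF x_cont[OF \<omega>] W_cont[OF \<omega>] T(1) sde[OF \<omega>]] unfolding T(2) .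
      moreover have "E (x T \<omega>) \<le> 2 * E (x T \<omega> - R *v W T \<omega>) + 2 * E (R *v W T \<omega>)"
        using quadratic_form_add_le[of P "x T \<omega> - R *v W T \<omega>" "R *v W T \<omega>"] E_nonneg
        by (simp add: E_def)
      ultimately show ?thesis by (simp add: Z_def)
    qed
    show "0 \<le> Z \<omega>" if "\<omega> \<in> space M" for \<omega>
      unfolding Z_def using \<kappa> E_nonneg
      by (intro add_nonneg_nonneg mult_nonneg_nonneg integral_nonneg integrable_continuous_interval
          continuous_intros continuous_on_subset[OF W_cont[OF that]]) auto
  qed (use E_nonneg x_meas E_meas in \<open>auto intro: measurable_compose\<close>)
  moreover obtain \<sigma> where \<sigma>: "\<sigma> > 0" "\<And>v. \<sigma> * (v \<bullet> v) \<le> E v"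
    unfolding E_def using sym_posdef_lower_bound[OF P] by blast
  ultimately have "integrable M (\<lambda>\<omega>. \<sigma> * (x 0 \<omega> \<bullet> x 0 \<omega>))"
    by (rule_tac Bochner_Integration.integrable_bound)
      (auto simp: E_nonneg intro!: borel_measurable_inner borel_measurable_times x_meas)
  then show ?thesis
    using \<sigma>(1) by (intro square_integrableI x_meas) simp
qed

lemma square_integrable_x: "0 \<le> t \<Longrightarrow> square_integrable M (x t)"
proof -
  assume t: "0 \<le> t"
  have "(\<lambda>p :: (real^'n) \<times> (real^'n). fst p \<bullet> fst p) \<in> borel_measurable (borel \<Otimes>\<^sub>M borel)"
    by (intro borel_measurable_inner measurable_fst)
  from stationary_integrable[OF t order_refl this]
  show ?thesis
    using square_integrable_inner[OF square_integrable_x0 square_integrable_x0]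
    by (intro square_integrableI x_meas) simp
qed

text \<open>A is invertible, so the integral equation exhibits \<open>I t\<close> as a linear image
  of x_0, x_t and W_t.\<close>

lemma square_integrable_I: "0 \<le> t \<Longrightarrow> square_integrable M (I t)"
proof -
  assume t: "0 \<le> t"
  obtain A' where A': "A' ** A = mat 1"
    using drift_invertible[OF S \<Sigma> Q] by (auto simp: invertible_def)
  have "square_integrable M (\<lambda>\<omega>. A' *v (x 0 \<omega> - x t \<omega> + R *v W t \<omega>))" (is "square_integrable M ?f")
    using t by (intro square_integrable_matrix square_integrable_add square_integrable_diff
        square_integrable_x W_sq) auto
  moreover have I_eq: "I t \<omega> = ?f \<omega>" if "\<omega> \<in> space M" for \<omega>
  proof -
    have "A *v I t \<omega> = x 0 \<omega> - x t \<omega> + R *v W t \<omega>"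
      using sde[OF that t] by (simp add: I_def)
    then show ?thesis using A' by (metis matrix_vector_mul_assoc matrix_vector_mul_lid)
  qed
  ultimately show ?thesis
    using measurable_cong[of M "I t" ?f borel, OF I_eq]
    by (auto simp: square_integrable_def I_eq cong: Bochner_Integration.integrable_cong)
qed

section \<open>The lagged covariance and its integral equation\<close>

definition "C t = cross_moment M (x t) (x 0)"

lemma lagged_cross_moment:
  assumes "0 \<le> s" "0 \<le> h"
  shows "cross_moment M (x (s + h)) (x s) = C h"
proof -
  have "(\<lambda>p :: (real^'n) \<times> (real^'n). fst p $ i * snd p $ j) \<in> borel_measurable (borel \<Otimes>\<^sub>M borel)"
    for i j :: 'n
    by (intro borel_measurable_times borel_measurable_vec_nth measurable_fst measurable_snd)
  from stationary_integral[OF assms this] show ?thesis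
    by (simp add: C_def cross_moment_def vec_eq_iff)
qed

text \<open>By stationarity the bound is the same for all s, as the exchange of expectation and time
  integral requires.\<close>

lemma cross_moment_x_bound:
  assumes "0 \<le> s" "square_integrable M Y"
  shows "(\<integral>\<omega>. \<bar>x s \<omega> $ i * Y \<omega> $ j\<bar> \<partial>M) \<le> C 0 $ i $ i + (\<integral>\<omega>. (Y \<omega> $ j)\<^sup>2 \<partial>M)"
proof -
  have "C 0 $ i $ i = (\<integral>\<omega>. (x s \<omega> $ i)\<^sup>2 \<partial>M)"
    using lagged_cross_moment[OF assms(1) order_refl] by (simp add: cross_moment_def power2_eq_square vec_eq_iff)
  moreover have ix: "integrable M (\<lambda>\<omega>. (x s \<omega> $ i)\<^sup>2)" and iY: "integrable M (\<lambda>\<omega>. (Y \<omega> $ j)\<^sup>2)"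
    using square_integrable_x[OF assms(1)] assms(2) by (auto simp: square_integrable_def)
  moreover have "(\<integral>\<omega>. \<bar>x s \<omega> $ i * Y \<omega> $ j\<bar> \<partial>M) \<le> (\<integral>\<omega>. (x s \<omega> $ i)\<^sup>2 + (Y \<omega> $ j)\<^sup>2 \<partial>M)"
    using ix iY square_integrable_mult[OF square_integrable_x[OF assms(1)] assms(2)]
    by (intro integral_mono) (auto simp: abs_mult_le_sum_squares)
  ultimately show ?thesis by simp
qed

lemma cross_moment_I:
  assumes t: "0 \<le> t" and Y: "square_integrable M Y"
  shows "(\<lambda>s. cross_moment M (x s) Y $ i $ j) integrable_on {0..t}"
    and "cross_moment M (I t) Y $ i $ j = integral {0..t} (\<lambda>s. cross_moment M (x s) Y $ i $ j)"
proof -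
  note * = integral_of_continuous_process[of M "\<lambda>s \<omega>. x s \<omega> $ i * Y \<omega> $ j" t,
      OF prob_space_axioms _ _ _ cross_moment_x_bound[OF _ Y]]
  have 1: "(\<lambda>\<omega>. x s \<omega> $ i * Y \<omega> $ j) \<in> borel_measurable M" for s
    by (rule borel_measurable_times[OF borel_measurable_vec_nth[OF x_meas]
        square_integrable_component_measurable[OF Y]])
  have 2: "continuous_on UNIV (\<lambda>s. x s \<omega> $ i * Y \<omega> $ j)" if "\<omega> \<in> space M" for \<omega>
    using x_cont[OF that] by (intro continuous_intros)
  have 3: "integrable M (\<lambda>\<omega>. x s \<omega> $ i * Y \<omega> $ j)" if "0 \<le> s" for s
    using Y by (intro square_integrable_mult square_integrable_x that)
  have pathwise: "integral {0..t} (\<lambda>s. x s \<omega> $ i * Y \<omega> $ j) = I t \<omega> $ i * Y \<omega> $ j" if "\<omega> \<in> space M" for \<omega>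
  proof -
    have "(\<lambda>s. x s \<omega>) integrable_on {0..t}"
      by (intro integrable_continuous_interval continuous_on_subset[OF x_cont[OF that]]) auto
    then show ?thesis by (simp add: I_def)
  qed
  show "(\<lambda>s. cross_moment M (x s) Y $ i $ j) integrable_on {0..t}"
    using *(2)[OF 1 2 3] by (simp add: cross_moment_def)
  have "(\<integral>\<omega>. I t \<omega> $ i * Y \<omega> $ j \<partial>M) = (\<integral>\<omega>. integral {0..t} (\<lambda>s. x s \<omega> $ i * Y \<omega> $ j) \<partial>M)"
    by (intro Bochner_Integration.integral_cong refl) (simp only: pathwise)
  also have "\<dots> = integral {0..t} (\<lambda>s. \<integral>\<omega>. x s \<omega> $ i * Y \<omega> $ j \<partial>M)"
    using *(3)[OF 1 2 3] by simp
  finally show "cross_moment M (I t) Y $ i $ j = integral {0..t} (\<lambda>s. cross_moment M (x s) Y $ i $ j)"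
    by (simp add: cross_moment_def)
qed

text \<open>One estimate serves exact values (b = 0), size bounds (a = 0) and first-order expansions
  (b of order t).\<close>

lemma cross_moment_I_approx:
  assumes t: "0 \<le> t" and Y: "square_integrable M Y"
    and bound: "\<And>s. 0 \<le> s \<Longrightarrow> s \<le> t \<Longrightarrow> \<bar>cross_moment M (x s) Y $ i $ j - a\<bar> \<le> b"
  shows "\<bar>cross_moment M (I t) Y $ i $ j - t * a\<bar> \<le> t * b"
proof -
  have "cross_moment M (I t) Y $ i $ j - t * a =
      integral {0..t} (\<lambda>s. cross_moment M (x s) Y $ i $ j - a)"
    using cross_moment_I[OF t Y, of i j] t
    by (subst Henstock_Kurzweil_Integration.integral_diff) auto
  also have "norm \<dots> \<le> integral {0..t} (\<lambda>_. b)"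
    using bound cross_moment_I(1)[OF t Y]
    by (intro Henstock_Kurzweil_Integration.integral_norm_bound_integral
        Henstock_Kurzweil_Integration.integrable_diff) auto
  finally show ?thesis using t by simp
qed

lemma sde_I: "\<omega> \<in> space M \<Longrightarrow> 0 \<le> t \<Longrightarrow> R *v W t \<omega> = x t \<omega> - x 0 \<omega> + A *v I t \<omega>"
  using sde[of \<omega> t] by (simp add: I_def)

text \<open>Pairing the equation with a test variable Y is how it enters all moment computations; Y
  will be a constant, x_0, x_t and \<open>I t\<close>.\<close>

lemma cross_moment_noise:
  assumes t: "0 \<le> t" and Y: "square_integrable M Y"
  shows "R ** cross_moment M (W t) Y =
    cross_moment M (x t) Y - cross_moment M (x 0) Y + A ** cross_moment M (I t) Y"
proof -
  note sq = W_sq[OF t] square_integrable_x[OF t] square_integrable_x0 square_integrable_I[OF t] Y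
    square_integrable_matrix square_integrable_diff
  have "R ** cross_moment M (W t) Y = cross_moment M (\<lambda>\<omega>. R *v W t \<omega>) Y"
    by (simp add: cross_moment_matrix_left sq)
  also have "\<dots> = cross_moment M (\<lambda>\<omega>. x t \<omega> - x 0 \<omega> + A *v I t \<omega>) Y"
    using sde_I[OF _ t] by (simp add: cross_moment_def cong: Bochner_Integration.integral_cong)
  also have "\<dots> = cross_moment M (x t) Y - cross_moment M (x 0) Y + A ** cross_moment M (I t) Y"
    by (simp add: cross_moment_add_left cross_moment_diff_left cross_moment_matrix_left sq)
  finally show ?thesis .
qed

text \<open>The mean m is constant by stationarity, so the expected equation over [0, 1] reads 0 = A
  m, and A is invertible.\<close>

lemma mean_zero:
  assumes t: "0 \<le> t"
  shows "(\<integral>\<omega>. x t \<omega> $ i \<partial>M) = 0"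
proof -
  let ?one = "\<lambda>_. vec 1 :: real^'n"
  have one: "square_integrable M ?one" by (simp add: square_integrable_def)
  have stat: "cross_moment M (x s) ?one = cross_moment M (x 0) ?one" if "0 \<le> s" for s
  proof -
    have "(\<lambda>p :: (real^'n) \<times> (real^'n). fst p $ i) \<in> borel_measurable (borel \<Otimes>\<^sub>M borel)" for i :: 'n
      by (intro borel_measurable_vec_nth measurable_fst)
    from stationary_integral[OF that order_refl this] show ?thesis
      by (simp add: cross_moment_def vec_eq_iff)
  qed
  have "cross_moment M (I 1) ?one $ i $ j = cross_moment M (x 0) ?one $ i $ j" for i j
  proof -
    have "\<bar>cross_moment M (I 1) ?one $ i $ j - 1 * cross_moment M (x 0) ?one $ i $ j\<bar> \<le> 1 * 0"
    proof (rule cross_moment_I_approx[OF zero_le_one one])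
      fix s :: real assume "0 \<le> s"
      show "\<bar>cross_moment M (x s) ?one $ i $ j - cross_moment M (x 0) ?one $ i $ j\<bar> \<le> 0"
        unfolding stat[OF \<open>0 \<le> s\<close>] by simp
    qed
    then show ?thesis by simp
  qed
  then have "cross_moment M (I 1) ?one = cross_moment M (x 0) ?one" by (simp add: vec_eq_iff)
  moreover have "A ** cross_moment M (I 1) ?one = 0"
    using cross_moment_noise[OF zero_le_one one] stat[OF zero_le_one] W_mean[of 1] by simp
  ultimately have "A ** cross_moment M (x 0) ?one = 0" by simp
  moreover obtain A' where "A' ** A = mat 1"
    using drift_invertible[OF S \<Sigma> Q] by (auto simp: invertible_def)
  ultimately have "cross_moment M (x 0) ?one = 0"
    by (metis matrix_mul_assoc matrix_mul_lid times0_right)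
  then have "cross_moment M (x t) ?one = 0" using stat[OF t] by simp
  then show ?thesis by (simp add: cross_moment_def vec_eq_iff)
qed

text \<open>Pairing with x_0 removes the noise by orthogonality; this is C' = -A C in integrated
  form.\<close>

lemma C_integral_equation:
  assumes t: "0 \<le> t"
  shows "C t = C 0 - A ** cross_moment M (I t) (x 0)"
  using cross_moment_noise[OF t square_integrable_x0] W_orth[OF t square_integrable_x0]
  by (simp add: C_def eq_diff_eq add_eq_0_iff2 diff_add_eq)

lemma C0_sym: "transpose (C 0) = C 0"
  by (simp add: C_def cross_moment_transpose)

lemma cross_moment_x_x:
  obtains m where "m \<ge> 0" "\<And>s u i j. 0 \<le> s \<Longrightarrow> 0 \<le> u \<Longrightarrow> \<bar>cross_moment M (x s) (x u) $ i $ j\<bar> \<le> m"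
proof -
  define m where "m = 2 * (\<Sum>i\<in>UNIV. \<bar>C 0 $ i $ i\<bar>)"
  have C_le: "C 0 $ i $ i \<le> (\<Sum>i\<in>UNIV. \<bar>C 0 $ i $ i\<bar>)" for i
    using member_le_sum[of i UNIV "\<lambda>i. \<bar>C 0 $ i $ i\<bar>"] by auto
  show thesis
  proof (rule that[of m])
    show "m \<ge> 0" by (simp add: m_def sum_nonneg)
    fix s u :: real and i j assume s: "0 \<le> s" and u: "0 \<le> u"
    have "\<bar>cross_moment M (x s) (x u) $ i $ j\<bar> \<le> (\<integral>\<omega>. \<bar>x s \<omega> $ i * x u \<omega> $ j\<bar> \<partial>M)"
      by (simp add: cross_moment_def integral_abs_bound)
    also have "\<dots> \<le> C 0 $ i $ i + (\<integral>\<omega>. (x u \<omega> $ j)\<^sup>2 \<partial>M)"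
      by (rule cross_moment_x_bound[OF s square_integrable_x[OF u]])
    also have "(\<integral>\<omega>. (x u \<omega> $ j)\<^sup>2 \<partial>M) = C 0 $ j $ j"
      using lagged_cross_moment[OF u order_refl] by (simp add: cross_moment_def power2_eq_square vec_eq_iff)
    also have "C 0 $ i $ i + C 0 $ j $ j \<le> m" using C_le[of i] C_le[of j] by (simp add: m_def)
    finally show "\<bar>cross_moment M (x s) (x u) $ i $ j\<bar> \<le> m" .
  qed
qed

text \<open>Moments of x are bounded uniformly in time, so the integral term in the equation for C
  is of order t. Stationarity later transfers the estimate to E[x_s x_t'], which depends on t - s
  only.\<close>

lemma C_lipschitz_at_0:
  obtains L where "L \<ge> 0" "\<And>t i j. 0 \<le> t \<Longrightarrow> \<bar>C t $ i $ j - C 0 $ i $ j\<bar> \<le> L * t"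
proof -
  obtain m where m: "m \<ge> 0" "\<And>s u i j. 0 \<le> s \<Longrightarrow> 0 \<le> u \<Longrightarrow> \<bar>cross_moment M (x s) (x u) $ i $ j\<bar> \<le> m"
    using cross_moment_x_x by blast
  define L where "L = (\<Sum>i\<in>UNIV. \<Sum>k\<in>UNIV. \<bar>A $ i $ k\<bar>) * m"
  show thesis
  proof (rule that[of L])
    show "L \<ge> 0" using m by (simp add: L_def sum_nonneg)
    fix t i j assume t: "0 \<le> (t::real)"
    have K: "\<bar>cross_moment M (I t) (x 0) $ k $ j\<bar> \<le> t * m" for k
      using cross_moment_I_approx[OF t square_integrable_x0, of k j 0 m] m(2) by simp
    have "\<bar>C t $ i $ j - C 0 $ i $ j\<bar> = \<bar>\<Sum>k\<in>UNIV. A $ i $ k * cross_moment M (I t) (x 0) $ k $ j\<bar>"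
      using C_integral_equation[OF t] by (simp add: matrix_matrix_mult_def)
    also have "\<dots> \<le> (\<Sum>k\<in>UNIV. \<bar>A $ i $ k\<bar> * (t * m))"
      by (rule order_trans[OF sum_abs]) (auto intro!: sum_mono mult_left_mono K simp: abs_mult)
    also have "\<dots> = (\<Sum>k\<in>UNIV. \<bar>A $ i $ k\<bar>) * (m * t)" 
      by (simp add: sum_distrib_left sum_distrib_right mult_ac)
    also have "\<dots> \<le> (\<Sum>i\<in>UNIV. \<Sum>k\<in>UNIV. \<bar>A $ i $ k\<bar>) * (m * t)"
      using m t member_le_sum[of i UNIV "\<lambda>i. \<Sum>k\<in>UNIV. \<bar>A $ i $ k\<bar>"]
      by (intro mult_right_mono) (auto simp: sum_nonneg)
    finally show "\<bar>C t $ i $ j - C 0 $ i $ j\<bar> \<le> L * t" by (simp add: L_def mult_ac)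
  qed
qed

text \<open>Expanding the covariance \<open>t \<Sigma>\<close> of the noise through the equation and letting \<open>t\<close> tend to \<open>0\<close>
  gives the Lyapunov equation, whose solution is unique.\<close>

lemma stationary_covariance: "C 0 = S"
proof -
  \<comment> \<open>L t is t C(0) up to order t^2, while J t, with two time integrals, is itself of
    order t^2.\<close>
  define L J where "L t = cross_moment M (I t) (x t)" and "J t = cross_moment M (I t) (I t)" for t
  have noise: "t *\<^sub>R \<Sigma> = A ** L t + transpose (A ** L t) + (A ** J t) ** transpose A"
    if t: "0 \<le> t" for t
  proof -
    note sq = W_sq[OF t] square_integrable_x[OF t] square_integrable_x0 square_integrable_I[OF t]
      square_integrable_matrix square_integrable_diff square_integrable_add
    let ?N = "\<lambda>\<omega>. x t \<omega> - x 0 \<omega> + A *v I t \<omega>"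
    have RW: "R ** cross_moment M (W t) Y = cross_moment M ?N Y" if "square_integrable M Y" for Y :: "'a \<Rightarrow> real^'n"
      using cross_moment_noise[OF t that]
      by (simp add: cross_moment_add_left cross_moment_diff_left cross_moment_matrix_left sq that)
    have "t *\<^sub>R \<Sigma> = R ** cross_moment M (W t) (W t) ** transpose R"
      using W_cov[OF t] R by (simp add: matrix_scalar_ac flip: scalar_matrix_assoc)
    also have "\<dots> = R ** cross_moment M (W t) (\<lambda>\<omega>. R *v W t \<omega>)"
      by (simp add: cross_moment_matrix_right sq flip: matrix_mul_assoc)
    also have "cross_moment M (W t) (\<lambda>\<omega>. R *v W t \<omega>) = cross_moment M (W t) ?N"
      using sde_I[OF _ t] by (simp add: cross_moment_def cong: Bochner_Integration.integral_cong)
    \<comment> \<open>The x_0 part of the second factor disappears because noise and initial value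
      are orthogonal.\<close>
    also have "R ** \<dots> = R ** cross_moment M (W t) (x t) + R ** (cross_moment M (W t) (I t) ** transpose A)"
      using W_orth[OF t square_integrable_x0]
      by (simp add: cross_moment_add_right cross_moment_diff_right cross_moment_matrix_right sq
          matrix_add_ldistrib)
    also have "\<dots> = (cross_moment M (x t) (x t) - cross_moment M (x 0) (x t) + A ** L t) +
        (cross_moment M (x t) (I t) - cross_moment M (x 0) (I t) + A ** J t) ** transpose A"
      using cross_moment_noise[OF t square_integrable_x[OF t]] cross_moment_noise[OF t square_integrable_I[OF t]]
      by (simp add: L_def J_def matrix_mul_assoc)
    \<comment> \<open>Stationarity makes this difference C(0) - C(t)', and the integral equation
      turns it into a moment of \<open>I t\<close> that cancels against another summand.\<close>
    also have "cross_moment M (x t) (x t) - cross_moment M (x 0) (x t) =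
        cross_moment M (x 0) (I t) ** transpose A"
    proof -
      have "cross_moment M (x t) (x t) = C 0" using lagged_cross_moment[OF t order_refl] by simp
      moreover have "cross_moment M (x 0) (x t) = transpose (C t)"
        by (simp add: C_def cross_moment_transpose)
      moreover have "transpose (C t) = C 0 - cross_moment M (x 0) (I t) ** transpose A"
      proof -
        have "transpose (C 0 - A ** cross_moment M (I t) (x 0)) =
            transpose (C 0) - transpose (A ** cross_moment M (I t) (x 0))"
          by (simp add: transpose_def vec_eq_iff)
        then show ?thesis
          using C_integral_equation[OF t] by (simp add: C0_sym matrix_transpose_mul cross_moment_transpose)
      qed
      ultimately show ?thesis by simp
    qed
    also have "transpose (A ** L t) = cross_moment M (x t) (I t) ** transpose A"
      by (simp add: L_def matrix_transpose_mul cross_moment_transpose)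
    moreover have "(X - Y + Z) ** B = X ** B - Y ** B + Z ** B" for X Y Z B :: "real^'n^'n"
      by (simp add: matrix_matrix_mult_def vec_eq_iff algebra_simps sum.distrib sum_subtractf)
    ultimately show ?thesis by simp
  qed
  obtain m where m: "m \<ge> 0" "\<And>s u i j. 0 \<le> s \<Longrightarrow> 0 \<le> u \<Longrightarrow> \<bar>cross_moment M (x s) (x u) $ i $ j\<bar> \<le> m"
    using cross_moment_x_x by blast
  obtain l where l: "l \<ge> 0" "\<And>t i j. 0 \<le> t \<Longrightarrow> \<bar>C t $ i $ j - C 0 $ i $ j\<bar> \<le> l * t"
    using C_lipschitz_at_0 by blast
  have L_approx: "\<bar>L t $ i $ j - t * C 0 $ i $ j\<bar> \<le> t * (l * t)" if t: "0 \<le> t" for t i j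
    unfolding L_def
  proof (rule cross_moment_I_approx[OF t square_integrable_x[OF t]])
    fix s assume s: "0 \<le> s" "s \<le> t"
    have "cross_moment M (x s) (x t) = transpose (C (t - s))"
      using lagged_cross_moment[of s "t - s"] s cross_moment_transpose[of M "x t" "x s"] by simp
    then have "cross_moment M (x s) (x t) $ i $ j = C (t - s) $ j $ i" by (simp add: transpose_def)
    moreover have "C 0 $ i $ j = C 0 $ j $ i"
      using arg_cong[OF C0_sym, of "\<lambda>X. X $ i $ j"] by (simp add: transpose_def)
    moreover have "l * (t - s) \<le> l * t" using l s by (intro mult_left_mono) auto
    ultimately show "\<bar>cross_moment M (x s) (x t) $ i $ j - C 0 $ i $ j\<bar> \<le> l * t"
      using l(2)[of "t - s" j i] s by simp
  qed
  have J_small: "\<bar>J t $ i $ j\<bar> \<le> t * (t * m)" if t: "0 \<le> t" for t i j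
  proof -
    \<comment> \<open>The estimate for time integrals is applied twice, first with the other
      variable fixed; each application contributes a factor t.\<close>
    have "\<bar>cross_moment M (x s) (I t) $ i $ j - 0\<bar> \<le> t * m" if "0 \<le> s" for s
    proof -
      have "cross_moment M (x s) (I t) $ i $ j = cross_moment M (I t) (x s) $ j $ i"
        by (simp add: cross_moment_def mult.commute)
      then show ?thesis
        using cross_moment_I_approx[OF t square_integrable_x[OF that], of j i 0 m] m(2) that by simp
    qed
    then show ?thesis
      using cross_moment_I_approx[OF t square_integrable_I[OF t], of i j 0 "t * m"] by (simp add: J_def)
  qed
  have lim0: "((\<lambda>t. k * t) \<longlongrightarrow> 0) (at_right (0::real))" for k
    by (intro tendsto_mult_right_zero tendsto_ident_at)
  have L_lim: "((\<lambda>t. (1 / t) *\<^sub>R L t) \<longlongrightarrow> C 0) (at_right 0)"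
  proof (intro vec_tendstoI)
    fix i j
    show "((\<lambda>t. ((1 / t) *\<^sub>R L t) $ i $ j) \<longlongrightarrow> C 0 $ i $ j) (at_right 0)"
    proof (rule LIM_zero_cancel, rule Lim_null_comparison[OF _ lim0[of l]])
      show "\<forall>\<^sub>F t in at_right 0. norm (((1 / t) *\<^sub>R L t) $ i $ j - C 0 $ i $ j) \<le> l * t"
      proof (rule eventually_at_rightI[of 0 1])
        fix t :: real assume t: "t \<in> {0<..<1}"
        have "((1 / t) *\<^sub>R L t) $ i $ j - C 0 $ i $ j = (L t $ i $ j - t * C 0 $ i $ j) / t"
          using t by (simp add: field_simps)
        then show "norm (((1 / t) *\<^sub>R L t) $ i $ j - C 0 $ i $ j) \<le> l * t"
          using L_approx[of t i j] t by (simp add: abs_divide pos_divide_le_eq mult_ac)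
      qed simp
    qed
  qed
  have J_lim: "((\<lambda>t. (1 / t) *\<^sub>R J t) \<longlongrightarrow> 0) (at_right 0)"
  proof (intro vec_tendstoI)
    fix i j
    show "((\<lambda>t. ((1 / t) *\<^sub>R J t) $ i $ j) \<longlongrightarrow> 0 $ i $ j) (at_right 0)"
      unfolding zero_index
    proof (rule Lim_null_comparison[OF _ lim0[of m]])
      show "\<forall>\<^sub>F t in at_right 0. norm (((1 / t) *\<^sub>R J t) $ i $ j) \<le> m * t"
      proof (rule eventually_at_rightI[of 0 1])
        fix t :: real assume t: "t \<in> {0<..<1}"
        then show "norm (((1 / t) *\<^sub>R J t) $ i $ j) \<le> m * t"
          using J_small[of t i j] by (simp add: abs_divide pos_divide_le_eq mult_ac)
      qed simp
    qed
  qed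
  have "((\<lambda>t. A ** ((1 / t) *\<^sub>R L t) + transpose (A ** ((1 / t) *\<^sub>R L t)) +
      (A ** ((1 / t) *\<^sub>R J t)) ** transpose A) \<longlongrightarrow>
      A ** C 0 + transpose (A ** C 0) + (A ** 0) ** transpose A) (at_right 0)"
    by (intro tendsto_add tendsto_matrix_mult tendsto_transpose tendsto_const L_lim J_lim)
  \<comment> \<open>After division by t the noise identity has \<Sigma> on one side for every t > 0,
    so \<Sigma> is also the limit.\<close>
  moreover have "\<forall>\<^sub>F t in at_right 0. A ** ((1 / t) *\<^sub>R L t) + transpose (A ** ((1 / t) *\<^sub>R L t)) +
      (A ** ((1 / t) *\<^sub>R J t)) ** transpose A = \<Sigma>"
  proof (rule eventually_at_rightI[of 0 1])
    fix t :: real assume t: "t \<in> {0<..<1}"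
    have "A ** ((1 / t) *\<^sub>R L t) + transpose (A ** ((1 / t) *\<^sub>R L t)) + (A ** ((1 / t) *\<^sub>R J t)) ** transpose A =
        (1 / t) *\<^sub>R (A ** L t + transpose (A ** L t) + (A ** J t) ** transpose A)"
      by (simp add: matrix_scalar_ac transpose_scalar scaleR_add_right flip: scalar_matrix_assoc)
    also have "\<dots> = (1 / t) *\<^sub>R (t *\<^sub>R \<Sigma>)" using noise[of t] t by simp
    also have "\<dots> = \<Sigma>" using t by simp
    finally show "A ** ((1 / t) *\<^sub>R L t) + transpose (A ** ((1 / t) *\<^sub>R L t)) +
      (A ** ((1 / t) *\<^sub>R J t)) ** transpose A = \<Sigma>" .
  qed simp
  ultimately have "((\<lambda>t. \<Sigma>) \<longlongrightarrow> A ** C 0 + transpose (A ** C 0) + (A ** 0) ** transpose A) (at_right (0::real))"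
    by (rule Lim_transform_eventually)
  then have "A ** C 0 + transpose (A ** C 0) + (A ** 0) ** transpose A = \<Sigma>"
    by (rule tendsto_unique[OF trivial_limit_at_right_real _ tendsto_const])
  then have AC: "A ** C 0 + C 0 ** transpose A = \<Sigma>"
    by (simp add: matrix_transpose_mul C0_sym)
  have AS: "A ** S + S ** transpose A = \<Sigma>" by (rule drift_lyapunov[OF S \<Sigma> Q])
  have "A ** (C 0 - S) + (C 0 - S) ** transpose A =
      (A ** C 0 + C 0 ** transpose A) - (A ** S + S ** transpose A)"
    unfolding matrix_matrix_mult_def vec_eq_iff
    by (simp add: left_diff_distrib right_diff_distrib sum_subtractf)
  also have "\<dots> = 0" unfolding AC AS by simp
  finally have zero: "A ** (C 0 - S) + (C 0 - S) ** transpose A = 0" .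
  have sym: "transpose (C 0 - S) = C 0 - S"
  proof -
    have "transpose (C 0 - S) = transpose (C 0) - transpose S" by (simp add: transpose_def vec_eq_iff)
    then show ?thesis unfolding C0_sym sym_posdef_sym[OF S] .
  qed
  from homogeneous_lyapunov[OF S \<Sigma> sym AS zero]
  show ?thesis by simp
qed

text \<open>The integral equation bootstraps regularity: its right side is an indefinite integral,
  so C is continuous, hence differentiable. The matrix is applied to a fixed p so that uniqueness
  for vector equations is applicable.\<close>

lemma C_has_vector_derivative:
  assumes t: "0 \<le> t"
  shows "((\<lambda>s. C s *v p) has_vector_derivative - (A *v (C t *v p))) (at t within {0..})"
proof -
  have C_integrable: "(\<lambda>s. C s $ i $ j) integrable_on {0..b}" if "0 \<le> b" for b i j
    using cross_moment_I(1)[OF that square_integrable_x0] by (simp add: C_def)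
  have I_C: "cross_moment M (I b) (x 0) $ i $ j = integral {0..b} (\<lambda>s. C s $ i $ j)" if "0 \<le> b" for b i j
    using cross_moment_I(2)[OF that square_integrable_x0] by (simp add: C_def)
  have C_eq: "C b $ i $ j = C 0 $ i $ j - (\<Sum>k\<in>UNIV. A $ i $ k * integral {0..b} (\<lambda>s. C s $ k $ j))"
    if "0 \<le> b" for b i j
    using C_integral_equation[OF that] by (simp add: matrix_matrix_mult_def I_C that)
  have "continuous_on {0..b} (\<lambda>s. C s $ i $ j)" if "0 \<le> b" for b i j
  proof -
    have "continuous_on {0..b}
        (\<lambda>u. C 0 $ i $ j - (\<Sum>k\<in>UNIV. A $ i $ k * integral {0..u} (\<lambda>s. C s $ k $ j)))"
      using C_integrable[OF that] by (intro continuous_intros indefinite_integral_continuous_1)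
    then show ?thesis by (rule continuous_on_eq) (rule C_eq[symmetric], simp)
  qed
  then have C_cont: "continuous_on {0..b} C" if "0 \<le> b" for b
  proof -
    have "continuous_on {0..b} (\<lambda>s. \<chi> i j. C s $ i $ j)"
      using \<open>\<And>b i j. 0 \<le> b \<Longrightarrow> continuous_on {0..b} (\<lambda>s. C s $ i $ j)\<close>[OF that]
      by (intro continuous_on_vec_lambda)
    then show ?thesis by simp
  qed
  have C_int: "integral {0..b} C = cross_moment M (I b) (x 0)" if "0 \<le> b" for b
  proof -
    have 1: "C integrable_on {0..b}" by (rule integrable_continuous_interval[OF C_cont[OF that]])
    have 2: "(\<lambda>s. C s $ i) integrable_on {0..b}" for i
      by (rule integrable_linear[OF 1 bounded_linear_vec_nth, unfolded o_def])
    have "integral {0..b} (\<lambda>s. C s $ i $ j) = integral {0..b} C $ i $ j" for i j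
      using integral_linear[OF 1 bounded_linear_vec_nth, of i] 2 by (simp add: o_def)
    then show ?thesis using I_C[OF that] by (simp add: vec_eq_iff)
  qed
  have "continuous_on {0..} C"
    unfolding continuous_on_eq_continuous_within
  proof
    fix s :: real assume s: "s \<in> {0..}"
    have nhd: "at s within {0..s + 1} = at s within {0..}"
      by (rule at_within_nhd[of s "{..<s + 1}"]) auto
    have "continuous (at s within {0..s + 1}) C"
      using C_cont[of "s + 1"] s by (simp add: continuous_on_eq_continuous_within)
    then show "continuous (at s within {0..}) C" unfolding nhd .
  qed
  from integral_halfline_has_vector_derivative[OF this t]
  have *: "((\<lambda>s. integral {0..s} C) has_vector_derivative C t) (at t within {0..})" .
  have "linear (\<lambda>X. A *v (X *v p))"
    by (intro linearI) (simp_all add: matrix_vector_mult_add_rdistrib matrix_vector_right_distrib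
        matrix_vector_mult_scaleR flip: scaleR_matrix_vector_assoc)
  then have "bounded_linear (\<lambda>X. A *v (X *v p))" by (simp add: linear_conv_bounded_linear)
  from bounded_linear.has_vector_derivative[OF this *]
  have "((\<lambda>s. C 0 *v p - A *v (integral {0..s} C *v p)) has_vector_derivative - (A *v (C t *v p)))
      (at t within {0..})"
    by (auto intro!: derivative_eq_intros)
  then show ?thesis
  proof (rule has_vector_derivative_transform[rotated 2])
    show "C s *v p = C 0 *v p - A *v (integral {0..s} C *v p)" if "s \<in> {0..}" for s
      using C_integral_equation[of s] C_int[of s] that
      by (simp add: matrix_vector_mult_diff_rdistrib matrix_vector_mul_assoc)
  qed (use t in auto)
qed

end

subsection \<open>From the pathwise definition to moments\<close>

lemma cross_moment_mean:
  "cross_moment M X (\<lambda>_. vec 1 :: real^'m) = 0 \<longleftrightarrow> (\<forall>i. (\<integral>\<omega>. X \<omega> $ i \<partial>M) = 0)"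
  by (simp add: cross_moment_def vec_eq_iff)

lemma brownian_increment_moments:
  fixes W :: "real \<Rightarrow> 'a \<Rightarrow> real^'n"
  assumes W: "standard_brownian_motion M W" and t: "0 < t"
  defines "D \<equiv> \<lambda>\<omega>. W t \<omega> - W 0 \<omega>"
  shows "square_integrable M D" "(\<integral>\<omega>. D \<omega> $ i \<partial>M) = 0" "cross_moment M D D = t *\<^sub>R mat 1"
proof -
  interpret prob_space M using W by (simp add: standard_brownian_motion_def)
  have "\<forall>s t. 0 \<le> s \<and> s < t \<longrightarrow>
      (\<forall>i. distributed M lborel (\<lambda>\<omega>. (W t \<omega> - W s \<omega>) $ i) (normal_density 0 (sqrt (t - s)))) \<and>
      indep_vars (\<lambda>_. borel) (\<lambda>i \<omega>. (W t \<omega> - W s \<omega>) $ i) UNIV"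
    using W by (simp add: standard_brownian_motion_def)
  from this[THEN spec, THEN spec, THEN mp, of 0 t] t
  have inc: "\<forall>i. distributed M lborel (\<lambda>\<omega>. D \<omega> $ i) (normal_density 0 (sqrt (t - 0)))"
    "indep_vars (\<lambda>_. borel) (\<lambda>i \<omega>. D \<omega> $ i) UNIV"
    unfolding D_def by blast+
  have normal: "distributed M lborel (\<lambda>\<omega>. D \<omega> $ i) (normal_density 0 (sqrt t))" for i
    using inc(1) by simp
  have indep: "indep_vars (\<lambda>_. borel) (\<lambda>i \<omega>. D \<omega> $ i) UNIV"
    by (rule inc(2))
  have \<sigma>: "0 < sqrt t" using t by simp
  have mean: "expectation (\<lambda>\<omega>. D \<omega> $ i) = 0" for i
    by (rule normal_distributed_expectation[OF \<sigma> normal])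
  have int2: "integrable M (\<lambda>\<omega>. (D \<omega> $ i)\<^sup>2)" for i
    using distributed_integrable[OF normal, of "\<lambda>x. x\<^sup>2"] integrable_normal_moment[OF \<sigma>, of 0 2] by simp
  have int1: "integrable M (\<lambda>\<omega>. D \<omega> $ i)" for i
    using distributed_integrable[OF normal, of "\<lambda>x. x"] integrable_normal_moment[OF \<sigma>, of 0 1] by simp
  have var: "expectation (\<lambda>\<omega>. (D \<omega> $ i)\<^sup>2) = t" for i
    using normal_distributed_variance[OF \<sigma> normal, of i] mean t by simp
  have meas: "D \<in> borel_measurable M"
    using W t unfolding standard_brownian_motion_def D_def by (intro borel_measurable_diff) auto
  show "square_integrable M D" using meas int2 by (simp add: square_integrable_def)
  show "(\<integral>\<omega>. D \<omega> $ i \<partial>M) = 0" by (rule mean)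
  have "expectation (\<lambda>\<omega>. D \<omega> $ i * D \<omega> $ j) = 0" if "i \<noteq> j" for i j
  proof -
    have "indep_vars (\<lambda>_. borel) (\<lambda>i \<omega>. D \<omega> $ i) {i, j}"
      by (rule indep_vars_subset[OF indep]) simp
    from indep_vars_lebesgue_integral[OF _ this] int1 show ?thesis
      using that by (simp add: mean)
  qed
  then show "cross_moment M D D = t *\<^sub>R mat 1"
    using var by (auto simp: cross_moment_def mat_def vec_eq_iff power2_eq_square)
qed

text \<open>W 0 vanishes only almost surely, so the moments are those of the increment from time 0,
  carried over along an almost sure equality. At t = 0 the normal density degenerates and the
  increment is replaced by the constant 0.\<close>

lemma brownian_moments:
  fixes W :: "real \<Rightarrow> 'a \<Rightarrow> real^'n"
  assumes W: "standard_brownian_motion M W" and t: "0 \<le> t"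
  shows "square_integrable M (W t)" "(\<integral>\<omega>. W t \<omega> $ i \<partial>M) = 0"
    "cross_moment M (W t) (W t) = t *\<^sub>R mat 1"
proof -
  have meas: "W t \<in> borel_measurable M" "W 0 \<in> borel_measurable M"
    using W t by (auto simp: standard_brownian_motion_def)
  have W0: "AE \<omega> in M. W 0 \<omega> = 0" using W by (simp add: standard_brownian_motion_def)
  obtain D :: "'a \<Rightarrow> real^'n" where D: "AE \<omega> in M. D \<omega> = W t \<omega>" "square_integrable M D"
    "\<And>i. (\<integral>\<omega>. D \<omega> $ i \<partial>M) = 0" "cross_moment M D D = t *\<^sub>R mat 1"
  proof (cases "t = 0")
    case True
    show thesis
    proof (rule that)
      show "AE \<omega> in M. (\<lambda>_. 0) \<omega> = W t \<omega>" using W0 True by (auto elim: eventually_mono)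
    qed (simp_all add: square_integrable_zero cross_moment_def vec_eq_iff True)
  next
    case False
    show thesis
    proof (rule that)
      show "AE \<omega> in M. W t \<omega> - W 0 \<omega> = W t \<omega>" using W0 by eventually_elim simp
    qed (use brownian_increment_moments[OF W, of t] False t in auto)
  qed
  have D_meas: "D \<in> borel_measurable M" by (rule square_integrable_measurable[OF D(2)])
  show "square_integrable M (W t)" by (rule square_integrable_cong_AE[OF D(1,2) meas(1)])
  have "cross_moment M D D = cross_moment M (W t) (W t)"
    by (rule cross_moment_cong_AE[OF D(1) D(1) D_meas meas(1) D_meas meas(1)])
  then show "cross_moment M (W t) (W t) = t *\<^sub>R mat 1" using D(4) by simp
  have "(\<integral>\<omega>. D \<omega> $ i \<partial>M) = (\<integral>\<omega>. W t \<omega> $ i \<partial>M)"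
    using D(1) by (intro integral_cong_AE borel_measurable_vec_nth D_meas meas) auto
  then show "(\<integral>\<omega>. W t \<omega> $ i \<partial>M) = 0" using D(3) by simp
qed

lemma process_path_measurable:
  assumes "\<And>t. 0 \<le> t \<Longrightarrow> x t \<in> borel_measurable M"
  shows "process_path x \<in> M \<rightarrow>\<^sub>M PiM {0..} (\<lambda>_. borel)"
  unfolding process_path_def[abs_def] using assms by (intro measurable_restrict) auto

text \<open>Evaluation at h and 0 is a measurable map on path space; the invariance of the path law
  is pushed through it.\<close>

lemma stationary_pair_law:
  fixes x :: "real \<Rightarrow> 'a \<Rightarrow> real^'n"
  assumes stat: "stationary M x" and meas: "\<And>t. 0 \<le> t \<Longrightarrow> x t \<in> borel_measurable M"
    and "0 \<le> s" "0 \<le> h"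
  shows "distr M (borel \<Otimes>\<^sub>M borel) (\<lambda>\<omega>. (x (s + h) \<omega>, x s \<omega>)) =
    distr M (borel \<Otimes>\<^sub>M borel) (\<lambda>\<omega>. (x h \<omega>, x 0 \<omega>))"
proof -
  let ?\<Pi> = "PiM {0..} (\<lambda>_. borel :: (real^'n) measure)"
  have f: "(\<lambda>p. (p h, p 0)) \<in> ?\<Pi> \<rightarrow>\<^sub>M borel \<Otimes>\<^sub>M borel"
    using assms by (intro measurable_Pair measurable_component_singleton) auto
  have "distr M ?\<Pi> (process_path (\<lambda>t. x (s + t))) = distr M ?\<Pi> (process_path x)"
    using stat assms(3) by (simp add: stationary_def)
  then have "distr (distr M ?\<Pi> (process_path (\<lambda>t. x (s + t)))) (borel \<Otimes>\<^sub>M borel) (\<lambda>p. (p h, p 0)) =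
      distr (distr M ?\<Pi> (process_path x)) (borel \<Otimes>\<^sub>M borel) (\<lambda>p. (p h, p 0))" by simp
  moreover have "process_path (\<lambda>t. x (s + t)) \<in> M \<rightarrow>\<^sub>M ?\<Pi>" "process_path x \<in> M \<rightarrow>\<^sub>M ?\<Pi>"
    using assms(3) by (auto intro!: process_path_measurable meas)
  ultimately show ?thesis
    using assms(4) by (simp add: distr_distr[OF f] comp_def process_path_def)
qed

text \<open>Independence is given for the sigma-algebras of X and of the whole noise path. Single
  coordinates generate smaller ones, so expectations of their products factor, and the noise has
  mean zero.\<close>

lemma (in prob_space) initial_value_noise_orthogonal:
  fixes X :: "'a \<Rightarrow> real^'n" and W :: "real \<Rightarrow> 'a \<Rightarrow> real^'n"
  assumes indep: "indep_set (sets (vimage_algebra (space M) X borel))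
      (sets (vimage_algebra (space M) (process_path W) (PiM {0..} (\<lambda>_. borel))))"
    and x0: "square_integrable M X" and Wt: "square_integrable M (W t)"
    and mean: "\<And>j. expectation (\<lambda>\<omega>. W t \<omega> $ j) = 0" and t: "0 \<le> t"
  shows "cross_moment M (W t) X = 0"
proof -
  let ?\<Pi> = "PiM {0..} (\<lambda>_. borel :: (real^'n) measure)"
  have L1: "integrable M (\<lambda>\<omega>. Y \<omega> $ i)" if "square_integrable M Y" for Y :: "'a \<Rightarrow> real^'n" and i
    using square_integrable_mult[OF that, of "\<lambda>_. 1" i i] by (simp add: square_integrable_def)
  have "expectation (\<lambda>\<omega>. X \<omega> $ i * W t \<omega> $ j) = 0" for i j
  proof -
    have "indep_var borel (\<lambda>\<omega>. X \<omega> $ i) borel (\<lambda>\<omega>. W t \<omega> $ j)"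
      unfolding indep_var_eq
    proof (intro conjI square_integrable_component_measurable x0 Wt)
      have "sigma_sets (space M) {(\<lambda>\<omega>. X \<omega> $ i) -` A \<inter> space M |A. A \<in> sets borel} \<subseteq>
          sets (vimage_algebra (space M) X borel)"
      proof -
        have "(\<lambda>\<omega>. X \<omega> $ i) -` A \<inter> space M \<in> sets (vimage_algebra (space M) X borel)"
          if A: "A \<in> sets borel" for A
        proof -
          have "(\<lambda>v :: real^'n. v $ i) -` A \<inter> space borel \<in> sets borel"
            by (rule measurable_sets[OF borel_measurable_vec_nth A]) simp
          from in_vimage_algebra[OF this, of X "space M"] show ?thesis
            by (simp add: vimage_def)
        qed
        then show ?thesis
          using sets.sigma_sets_subset[of "{(\<lambda>\<omega>. X \<omega> $ i) -` A \<inter> space M |A. A \<in> sets borel}"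
              "vimage_algebra (space M) X borel"] by auto
      qed
      moreover have "sigma_sets (space M) {(\<lambda>\<omega>. W t \<omega> $ j) -` A \<inter> space M |A. A \<in> sets borel} \<subseteq>
          sets (vimage_algebra (space M) (process_path W) ?\<Pi>)"
      proof -
        have "(\<lambda>\<omega>. W t \<omega> $ j) -` A \<inter> space M \<in> sets (vimage_algebra (space M) (process_path W) ?\<Pi>)"
          if A: "A \<in> sets borel" for A
        proof -
          have "(\<lambda>p. p t $ j) -` A \<inter> space ?\<Pi> \<in> sets ?\<Pi>"
            using t by (intro measurable_sets[OF borel_measurable_vec_nth A] measurable_component_singleton) auto
          from in_vimage_algebra[OF this, of "process_path W" "space M"]
          have "process_path W -` ((\<lambda>p. p t $ j) -` A \<inter> space ?\<Pi>) \<inter> space M \<in>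
              sets (vimage_algebra (space M) (process_path W) ?\<Pi>)" .
          \<comment> \<open>Restricted paths are extensional and so always lie in the product space;
            intersecting with \<open>space\<close> changes nothing.\<close>
          also have "process_path W -` ((\<lambda>p. p t $ j) -` A \<inter> space ?\<Pi>) \<inter> space M =
              (\<lambda>\<omega>. W t \<omega> $ j) -` A \<inter> space M"
            using t by (auto simp: process_path_def space_PiM)
          finally show ?thesis .
        qed
        then show ?thesis
          using sets.sigma_sets_subset[of "{(\<lambda>\<omega>. W t \<omega> $ j) -` A \<inter> space M |A. A \<in> sets borel}"
              "vimage_algebra (space M) (process_path W) ?\<Pi>"] by auto
      qed
      ultimately show "indep_set (sigma_sets (space M) {(\<lambda>\<omega>. X \<omega> $ i) -` A \<inter> space M |A. A \<in> sets borel})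
          (sigma_sets (space M) {(\<lambda>\<omega>. W t \<omega> $ j) -` A \<inter> space M |A. A \<in> sets borel})"
        using indep unfolding indep_sets2_eq by blast
    qed
    from indep_var_lebesgue_integral[OF this L1[OF x0] L1[OF Wt]] show ?thesis by (simp add: mean)
  qed
  then show ?thesis by (simp add: cross_moment_def vec_eq_iff mult.commute)
qed

text \<open>On the exceptional null set both processes become zero, which satisfies the equation
  trivially. Moments see each fixed time only almost surely, so equality at each fixed time is
  enough to return to x.\<close>

lemma stationary_OU_ou_process:
  fixes x :: "real \<Rightarrow> 'a \<Rightarrow> real^'n"
  assumes S: "sym_posdef S" and \<Sigma>: "sym_posdef \<Sigma>" and Q: "antisymmetric Q"
    and OU: "stationary_OU M (drift S \<Sigma> Q) \<Sigma> x"
  obtains y W R where "ou_process M y W S \<Sigma> Q R"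
    "\<And>t. 0 \<le> t \<Longrightarrow> AE \<omega> in M. y t \<omega> = x t \<omega>"
proof -
  define A where "A = drift S \<Sigma> Q"
  interpret prob_space M using OU by (simp add: stationary_OU_def)
  have x_meas: "x t \<in> borel_measurable M" if "0 \<le> t" for t using OU that by (simp add: stationary_OU_def)
  have stat: "stationary M x" using OU by (simp add: stationary_OU_def)
  obtain R W where R: "sym_posdef R" "R ** R = \<Sigma>" and W: "standard_brownian_motion M W"
    and indep: "indep_set (sets (vimage_algebra (space M) (x 0) borel))
      (sets (vimage_algebra (space M) (process_path W) (PiM {0..} (\<lambda>_. borel))))"
    and eq: "AE \<omega> in M. \<forall>t\<ge>0. x t \<omega> = x 0 \<omega> - integral {0..t} (\<lambda>s. A *v x s \<omega>) + R *v W t \<omega>"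
    using OU unfolding stationary_OU_def A_def by blast
  have W_meas: "W t \<in> borel_measurable M" if "0 \<le> t" for t
    using W that by (simp add: standard_brownian_motion_def)
  have all: "AE \<omega> in M. continuous_on {0..} (\<lambda>t. x t \<omega>) \<and> continuous_on {0..} (\<lambda>t. W t \<omega>) \<and>
      (\<forall>t\<ge>0. x t \<omega> = x 0 \<omega> - integral {0..t} (\<lambda>s. A *v x s \<omega>) + R *v W t \<omega>)"
    using OU W eq by (auto simp: stationary_OU_def standard_brownian_motion_def)
  obtain N where good: "\<And>\<omega>. \<omega> \<in> space M - N \<Longrightarrow> continuous_on {0..} (\<lambda>t. x t \<omega>) \<and> continuous_on {0..} (\<lambda>t. W t \<omega>) \<and>
      (\<forall>t\<ge>0. x t \<omega> = x 0 \<omega> - integral {0..t} (\<lambda>s. A *v x s \<omega>) + R *v W t \<omega>)"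
    and N: "N \<in> null_sets M"
    by (rule AE_E3[OF all]) (rule that)
  define G where "G = space M - N"
  have G: "G \<in> sets M" using N by (auto simp: G_def)
  have AE_G: "AE \<omega> in M. \<omega> \<in> G" using AE_not_in[OF N] by (auto simp: G_def elim: eventually_mono)
  define y V where "y t \<omega> = indicator G \<omega> *\<^sub>R x (max 0 t) \<omega>"
    and "V t \<omega> = indicator G \<omega> *\<^sub>R W (max 0 t) \<omega>" for t \<omega>
  have y_meas: "y t \<in> borel_measurable M" and V_meas: "V t \<in> borel_measurable M" for t
    unfolding y_def V_def using x_meas[of "max 0 t"] W_meas[of "max 0 t"] G
    by (auto intro!: borel_measurable_scaleR borel_measurable_indicator)
  have y_AE: "AE \<omega> in M. y t \<omega> = x t \<omega>" and V_AE: "AE \<omega> in M. V t \<omega> = W t \<omega>" if "0 \<le> t" for t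
    using AE_G that by (auto simp: y_def V_def elim!: eventually_mono)
  have ext: "continuous_on UNIV (\<lambda>t. indicator G \<omega> *\<^sub>R f (max 0 t))"
    if "\<omega> \<in> G \<Longrightarrow> continuous_on {0..} f" for f :: "real \<Rightarrow> real^'n" and \<omega>
  proof (cases "\<omega> \<in> G")
    case True
    have "continuous_on UNIV (\<lambda>t. f (max 0 t))"
      by (rule continuous_on_compose2[OF that[OF True]]) (auto intro!: continuous_intros)
    then show ?thesis using True by simp
  qed simp
  have "ou_process M y V S \<Sigma> Q R"
  proof (intro ou_process.intro ou_process_axioms.intro prob_space_axioms S \<Sigma> Q R(2) y_meas V_meas
      sym_posdef_sym[OF R(1)])
    show "continuous_on UNIV (\<lambda>t. y t \<omega>)" "continuous_on UNIV (\<lambda>t. V t \<omega>)" for \<omega>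
      unfolding y_def V_def
      using ext[of \<omega> "\<lambda>t. x t \<omega>"] ext[of \<omega> "\<lambda>t. W t \<omega>"] good[of \<omega>] unfolding G_def by blast+
    show "y t \<omega> = y 0 \<omega> - drift S \<Sigma> Q *v integral {0..t} (\<lambda>s. y s \<omega>) + R *v V t \<omega>"
      if "\<omega> \<in> space M" "0 \<le> t" for t \<omega>
    proof (cases "\<omega> \<in> G")
      case True
      have "(\<lambda>s. x s \<omega>) integrable_on {0..t}"
        using good[OF True[unfolded G_def]]
        by (intro integrable_continuous_interval) (auto intro: continuous_on_subset)
      \<comment> \<open>The definition of a solution integrates A x, whereas the locale applies A to
        the integral of x.\<close>
      from integral_linear[OF this matrix_vector_mul_bounded_linear[of A]]
      have 1: "integral {0..t} (\<lambda>s. A *v x s \<omega>) = A *v integral {0..t} (\<lambda>s. x s \<omega>)" by (simp add: comp_def)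
      have 2: "integral {0..t} (\<lambda>s. y s \<omega>) = integral {0..t} (\<lambda>s. x s \<omega>)"
        using True by (intro Henstock_Kurzweil_Integration.integral_cong) (simp add: y_def)
      have 3: "x t \<omega> = x 0 \<omega> - integral {0..t} (\<lambda>s. A *v x s \<omega>) + R *v W t \<omega>"
        using good[OF True[unfolded G_def]] that(2) by blast
      have 4: "y t \<omega> = x t \<omega>" "y 0 \<omega> = x 0 \<omega>" "V t \<omega> = W t \<omega>"
        using True that(2) by (simp_all add: y_def V_def)
      show ?thesis unfolding 4 2 A_def[symmetric] 1[symmetric] by (rule 3)
    qed (simp add: y_def V_def)
    show "distr M (borel \<Otimes>\<^sub>M borel) (\<lambda>\<omega>. (y (s + h) \<omega>, y s \<omega>)) =
        distr M (borel \<Otimes>\<^sub>M borel) (\<lambda>\<omega>. (y h \<omega>, y 0 \<omega>))" if "0 \<le> s" "0 \<le> h" for s h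
    proof -
      have "distr M (borel \<Otimes>\<^sub>M borel) (\<lambda>\<omega>. (y u \<omega>, y v \<omega>)) = distr M (borel \<Otimes>\<^sub>M borel) (\<lambda>\<omega>. (x u \<omega>, x v \<omega>))"
        if "0 \<le> u" "0 \<le> v" for u v
        using y_AE[OF that(1)] y_AE[OF that(2)]
        by (intro distr_cong_AE measurable_Pair y_meas x_meas that) auto
      then show ?thesis using stationary_pair_law[OF stat x_meas that] that by simp
    qed
    fix t :: real assume t: "0 \<le> t"
    note Wt = brownian_moments[OF W t]
    have VW: "AE \<omega> in M. V t \<omega> = W t \<omega>" and WV: "AE \<omega> in M. W t \<omega> = V t \<omega>"
      using V_AE[OF t] by (auto elim: eventually_mono)
    show "square_integrable M (V t)"
      by (rule square_integrable_cong_AE[OF WV Wt(1) V_meas])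
    show "cross_moment M (V t) (V t) = t *\<^sub>R mat 1"
      using cross_moment_cong_AE[OF VW VW V_meas W_meas[OF t] V_meas W_meas[OF t]] Wt(3) by simp
    have "cross_moment M (V t) (\<lambda>_. vec 1 :: real^'n) = cross_moment M (W t) (\<lambda>_. vec 1 :: real^'n)"
      by (rule cross_moment_cong_AE[OF VW _ V_meas W_meas[OF t]]) auto
    then show "cross_moment M (V t) (\<lambda>_. vec 1 :: real^'n) = 0"
      using Wt(2) cross_moment_mean[of M "W t"] by simp
    assume "square_integrable M (y 0)"
    from square_integrable_cong_AE[OF y_AE[OF order_refl] this x_meas[OF order_refl]]
    have "cross_moment M (W t) (x 0) = 0"
      by (rule initial_value_noise_orthogonal[of "x 0" W t, OF indep _ Wt(1,2) t])
    then show "cross_moment M (V t) (y 0) = 0"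
      using cross_moment_cong_AE[OF VW y_AE[OF order_refl] V_meas W_meas[OF t] y_meas x_meas[OF order_refl]]
      by simp
  qed
  then show thesis using y_AE by (rule that)
qed

text \<open>These are the facts that pass from the modified process back to x; everything later
  about moments of x goes through them.\<close>

lemma stationary_OU_moments:
  fixes x :: "real \<Rightarrow> 'a \<Rightarrow> real^'n"
  assumes S: "sym_posdef S" and \<Sigma>: "sym_posdef \<Sigma>" and A: "A \<in> drift_class S \<Sigma>"
    and OU: "stationary_OU M A \<Sigma> x"
  obtains C where "\<And>t. 0 \<le> t \<Longrightarrow> square_integrable M (x t)"
    "\<And>t i. 0 \<le> t \<Longrightarrow> (\<integral>\<omega>. x t \<omega> $ i \<partial>M) = 0"
    "\<And>t h. 0 \<le> t \<Longrightarrow> 0 \<le> h \<Longrightarrow> cross_moment M (x (t + h)) (x t) = C h"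
    "C 0 = S"
    "\<And>t p. 0 \<le> t \<Longrightarrow>
      ((\<lambda>s. C s *v p) has_vector_derivative - (A *v (C t *v p))) (at t within {0..})"
proof -
  obtain Q where Q: "antisymmetric Q" and A_eq: "A = drift S \<Sigma> Q" using A by (auto simp: drift_class_def)
  obtain y W R where proc: "ou_process M y W S \<Sigma> Q R" and yx: "\<And>t. 0 \<le> t \<Longrightarrow> AE \<omega> in M. y t \<omega> = x t \<omega>"
    by (rule stationary_OU_ou_process[OF S \<Sigma> Q OU[unfolded A_eq]]) (rule that)
  interpret ou_process M y W S \<Sigma> Q R by fact
  have meas: "x t \<in> borel_measurable M" if "0 \<le> t" for t using OU that by (simp add: stationary_OU_def)
  show thesis
  proof (rule that[of C])
    show "square_integrable M (x t)" if "0 \<le> t" for t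
      by (rule square_integrable_cong_AE[OF yx[OF that] square_integrable_x[OF that] meas[OF that]])
    show "(\<integral>\<omega>. x t \<omega> $ i \<partial>M) = 0" if "0 \<le> t" for t i
    proof -
      have "(\<integral>\<omega>. y t \<omega> $ i \<partial>M) = (\<integral>\<omega>. x t \<omega> $ i \<partial>M)"
        using yx[OF that] by (intro integral_cong_AE borel_measurable_vec_nth x_meas meas that) auto
      then show ?thesis using mean_zero[OF that] by simp
    qed
    show "cross_moment M (x (t + h)) (x t) = C h" if "0 \<le> t" "0 \<le> h" for t h
      using cross_moment_cong_AE[OF yx[of "t + h"] yx[of t] x_meas meas x_meas meas]
        lagged_cross_moment[OF that] that by simp
    show "((\<lambda>s. C s *v p) has_vector_derivative - (A *v (C t *v p))) (at t within {0..})" if "0 \<le> t" for t p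
      using C_has_vector_derivative[OF that] by (simp add: A_eq)
  qed (rule stationary_covariance)
qed

section \<open>Moments of aggregated records\<close>

lemma lagged_cov_eq_cross_moment: "lagged_cov M x t h = cross_moment M (x (t + h)) (x t)"
  by (simp add: lagged_cov_def cross_moment_def)

lemma covariance_matrix_eq_cross_moment:
  "(\<And>i. (\<integral>\<omega>. X \<omega> $ i \<partial>M) = 0) \<Longrightarrow> covariance_matrix M X = cross_moment M X X"
  by (simp add: covariance_matrix_def cross_moment_def)

text \<open>Among m consecutive observations m - h pairs are h intervals apart, and each contributes
  C(h) + C(h)', twice the symmetric part. One further observation adds one new pair at each lag 1,
  ..., m, which is the induction step.\<close>

lemma aggregate_cross_moment:
  fixes x :: "real \<Rightarrow> 'a \<Rightarrow> real^'n"
  assumes sq: "\<And>t. 0 \<le> t \<Longrightarrow> square_integrable M (x t)"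
    and C: "\<And>t h. 0 \<le> t \<Longrightarrow> 0 \<le> h \<Longrightarrow> cross_moment M (x (t + h)) (x t) = C h"
    and t: "0 \<le> t" and \<delta>: "0 \<le> \<delta>"
  shows "cross_moment M (aggregate m \<delta> x t) (aggregate m \<delta> x t) =
    real m *\<^sub>R C 0 + (\<Sum>h = 1..<m. (2 * real (m - h)) *\<^sub>R sym_part (C (real h * \<delta>)))"
proof (induction m)
  case 0
  show ?case by (simp add: cross_moment_def aggregate_def vec_eq_iff)
next
  case (Suc m)
  let ?X = "aggregate m \<delta> x t" and ?x = "\<lambda>l. x (t + real l * \<delta>)"
  have sq_x: "square_integrable M (?x l)" for l using t \<delta> by (intro sq) simp
  have sq_X: "square_integrable M ?X"
    unfolding aggregate_def[abs_def] by (intro square_integrable_sum sq_x)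
  have step: "aggregate (Suc m) \<delta> x t = (\<lambda>\<omega>. ?X \<omega> + ?x m \<omega>)"
    by (simp add: aggregate_def fun_eq_iff)
  have lag: "cross_moment M (?x m) (?x l) = C (real (m - l) * \<delta>)" if "l \<le> m" for l
  proof -
    have eq: "t + real l * \<delta> + real (m - l) * \<delta> = t + real m * \<delta>"
      using that by (simp add: of_nat_diff algebra_simps)
    show ?thesis
      using C[of "t + real l * \<delta>" "real (m - l) * \<delta>", unfolded eq] t \<delta> by simp
  qed
  have "cross_moment M (?x m) ?X = (\<Sum>l<m. C (real (m - l) * \<delta>))"
    unfolding aggregate_def[abs_def] by (simp add: cross_moment_sum_right sq_x lag)
  also have "\<dots> = (\<Sum>h = 1..m. C (real h * \<delta>))"
    by (rule sum.reindex_bij_witness[of _ "\<lambda>h. m - h" "\<lambda>l. m - l"]) auto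
  finally have xX: "cross_moment M (?x m) ?X = (\<Sum>h = 1..m. C (real h * \<delta>))" .
  have "cross_moment M (?x m) ?X + cross_moment M ?X (?x m) = (\<Sum>h = 1..m. 2 *\<^sub>R sym_part (C (real h * \<delta>)))"
  proof -
    have "cross_moment M ?X (?x m) = transpose (\<Sum>h = 1..m. C (real h * \<delta>))"
      using cross_moment_transpose[of M "?x m" ?X] xX by simp
    also have "\<dots> = (\<Sum>h = 1..m. transpose (C (real h * \<delta>)))" by (simp add: transpose_def vec_eq_iff)
    finally show ?thesis by (simp add: xX sym_part_def sum.distrib)
  qed
  moreover have "cross_moment M (aggregate (Suc m) \<delta> x t) (aggregate (Suc m) \<delta> x t) =
      cross_moment M ?X ?X + (cross_moment M (?x m) ?X + cross_moment M ?X (?x m)) + cross_moment M (?x m) (?x m)"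
    by (simp add: step cross_moment_add_left cross_moment_add_right square_integrable_add sq_x sq_X)
  \<comment> \<open>Every weight grows by one pair. The new lag h = m has old weight m - m = 0, so
    the old sum may be extended up to m.\<close>
  moreover have "(\<Sum>h = 1..<Suc m. (2 * real (Suc m - h)) *\<^sub>R sym_part (C (real h * \<delta>))) =
      (\<Sum>h = 1..<m. (2 * real (m - h)) *\<^sub>R sym_part (C (real h * \<delta>))) +
      (\<Sum>h = 1..m. 2 *\<^sub>R sym_part (C (real h * \<delta>)))"
  proof -
    have "(\<Sum>h = 1..<Suc m. (2 * real (Suc m - h)) *\<^sub>R sym_part (C (real h * \<delta>))) =
        (\<Sum>h = 1..m. (2 * real (m - h)) *\<^sub>R sym_part (C (real h * \<delta>)) + 2 *\<^sub>R sym_part (C (real h * \<delta>)))"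
      by (rule sum.cong) (auto simp: Suc_diff_le algebra_simps simp flip: scaleR_add_left)
    moreover have "(\<Sum>h = 1..m. (2 * real (m - h)) *\<^sub>R sym_part (C (real h * \<delta>))) =
        (\<Sum>h = 1..<m. (2 * real (m - h)) *\<^sub>R sym_part (C (real h * \<delta>)))"
      by (rule sum.mono_neutral_right) auto
    ultimately show ?thesis by (simp add: sum.distrib)
  qed
  ultimately show ?case using Suc.IH lag[of m] by (simp add: scaleR_add_left)
qed

lemma aggregate_mean:
  fixes x :: "real \<Rightarrow> 'a \<Rightarrow> real^'n"
  assumes "prob_space M" and sq: "\<And>t. 0 \<le> t \<Longrightarrow> square_integrable M (x t)"
    and mean: "\<And>t i. 0 \<le> t \<Longrightarrow> (\<integral>\<omega>. x t \<omega> $ i \<partial>M) = 0" and t: "0 \<le> t" and \<delta>: "0 \<le> \<delta>"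
  shows "(\<integral>\<omega>. aggregate m \<delta> x t \<omega> $ i \<partial>M) = 0"
proof -
  interpret prob_space M by fact
  have "integrable M (\<lambda>\<omega>. x s \<omega> $ i)" if "0 \<le> s" for s
    using square_integrable_mult[OF sq[OF that], of "\<lambda>_. 1" i i] by (simp add: square_integrable_def)
  then show ?thesis using t \<delta> by (simp add: aggregate_def mean)
qed

subsection \<open>Dependence on the circulation\<close>

lemma OU_covariance:
  assumes "sym_posdef S" "sym_posdef \<Sigma>" "A \<in> drift_class S \<Sigma>" "stationary_OU M A \<Sigma> x" "0 \<le> t"
  shows "covariance_matrix M (x t) = S"
proof -
  obtain C where C: "\<And>t i. 0 \<le> t \<Longrightarrow> (\<integral>\<omega>. x t \<omega> $ i \<partial>M) = 0"
    "\<And>t h. 0 \<le> t \<Longrightarrow> 0 \<le> h \<Longrightarrow> cross_moment M (x (t + h)) (x t) = C h" "C 0 = S"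
    by (rule stationary_OU_moments[OF assms(1-4)]) (rule that)
  show ?thesis
    using C(2)[OF assms(5) order_refl] C(3)
    by (simp add: covariance_matrix_eq_cross_moment C(1) assms(5))
qed

text \<open>The map h to C(h) p solves the linear equation with initial value S p, and solutions are
  unique. Guessing a solution therefore computes a lagged covariance.\<close>

lemma OU_lagged_cov_column:
  assumes "sym_posdef S" "sym_posdef \<Sigma>" "A \<in> drift_class S \<Sigma>" "stationary_OU M A \<Sigma> x"
    and k: "\<And>s. 0 \<le> s \<Longrightarrow> (k has_vector_derivative - (A *v k s)) (at s within {0..})" "k 0 = S *v p"
    and "0 \<le> t" "0 \<le> h"
  shows "lagged_cov M x t h *v p = k h"
proof -
  obtain C where C: "\<And>t h. 0 \<le> t \<Longrightarrow> 0 \<le> h \<Longrightarrow> cross_moment M (x (t + h)) (x t) = C h" "C 0 = S"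
    "\<And>t p. 0 \<le> t \<Longrightarrow> ((\<lambda>s. C s *v p) has_vector_derivative - (A *v (C t *v p))) (at t within {0..})"
    by (rule stationary_OU_moments[OF assms(1-4)]) (rule that)
  have "C h *v p = k h"
    by (rule linear_ode_unique[OF C(3) k(1)]) (simp_all add: C(2) k(2) assms)
  then show ?thesis
    by (simp add: lagged_cov_eq_cross_moment C(1) assms)
qed

lemma OU_aggregate_covariance:
  assumes "sym_posdef S" "sym_posdef \<Sigma>" "A \<in> drift_class S \<Sigma>" and OU: "stationary_OU M A \<Sigma> x"
    and t: "0 \<le> t" and \<delta>: "0 \<le> \<delta>"
  shows "covariance_matrix M (aggregate m \<delta> x t) =
    real m *\<^sub>R S + (\<Sum>h = 1..<m. (2 * real (m - h)) *\<^sub>R sym_part (lagged_cov M x t (real h * \<delta>)))"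
proof -
  obtain C where C: "\<And>t. 0 \<le> t \<Longrightarrow> square_integrable M (x t)"
    "\<And>t i. 0 \<le> t \<Longrightarrow> (\<integral>\<omega>. x t \<omega> $ i \<partial>M) = 0"
    "\<And>t h. 0 \<le> t \<Longrightarrow> 0 \<le> h \<Longrightarrow> cross_moment M (x (t + h)) (x t) = C h" "C 0 = S"
    by (rule stationary_OU_moments[OF assms(1-4)]) (rule that)
  have M: "prob_space M" using OU by (simp add: stationary_OU_def)
  have "covariance_matrix M (aggregate m \<delta> x t) = cross_moment M (aggregate m \<delta> x t) (aggregate m \<delta> x t)"
    by (intro covariance_matrix_eq_cross_moment aggregate_mean[OF M C(1,2) t \<delta>])
  then show ?thesis
    using t \<delta> by (simp add: aggregate_cross_moment[OF C(1,3) t \<delta>] lagged_cov_eq_cross_moment C(3,4))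
qed

lemma sampling_grid_nonneg: "sampling_grid \<tau> \<Longrightarrow> 0 \<le> \<tau> k"
  unfolding sampling_grid_def by (metis le0 order_trans strict_mono_less_eq)

lemma sym_part_quadratic: "v \<bullet> (sym_part X *v v) = v \<bullet> (X *v v)"
  using dot_matrix_transpose[of v X v]
  by (simp add: sym_part_def matrix_vector_mult_add_rdistrib inner_add_right inner_commute
      flip: scaleR_matrix_vector_assoc)

text \<open>The quadratic form at v sees only the symmetric part. On the rotating plane it equals
  exp(-\<mu> \<tau>) cos(w \<tau>) plus a multiple of sin(w \<tau>) that involves the unknown v . z;
  frequencies with w \<tau> a multiple of pi remove that term.\<close>

lemma lagged_sym_part_depends_on_circulation:
  fixes S \<Sigma> :: "real^'n^'n"
  assumes S: "sym_posdef S" and \<Sigma>: "sym_posdef \<Sigma>" and n: "2 \<le> CARD('n)" and \<tau>: "0 < \<tau>"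
  obtains Q1 Q2 where "antisymmetric Q1" "antisymmetric Q2"
    "\<And>(M1 :: 'a measure) x1 (M2 :: 'b measure) x2 t.
       stationary_OU M1 (drift S \<Sigma> Q1) \<Sigma> x1 \<Longrightarrow> stationary_OU M2 (drift S \<Sigma> Q2) \<Sigma> x2 \<Longrightarrow> 0 \<le> t \<Longrightarrow>
       sym_part (lagged_cov M1 x1 t \<tau>) \<noteq> sym_part (lagged_cov M2 x2 t \<tau>)"
proof -
  obtain v \<mu> where v: "v \<bullet> (S *v v) = 1"
    "\<And>w. \<exists>Q z. antisymmetric Q \<and> drift S \<Sigma> Q *v (S *v v) = \<mu> *\<^sub>R (S *v v) + z \<and>
       drift S \<Sigma> Q *v z = \<mu> *\<^sub>R z - w\<^sup>2 *\<^sub>R (S *v v)"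
    by (rule rotating_drift[OF S \<Sigma> n]) (rule that)
  have turn: "v \<bullet> (sym_part (lagged_cov M x t \<tau>) *v v) = exp (- \<mu> * \<tau>) * cos (w * \<tau>)"
    if "antisymmetric Q" "drift S \<Sigma> Q *v (S *v v) = \<mu> *\<^sub>R (S *v v) + z"
      "drift S \<Sigma> Q *v z = \<mu> *\<^sub>R z - w\<^sup>2 *\<^sub>R (S *v v)" "w \<noteq> 0" "sin (w * \<tau>) = 0"
      "stationary_OU M (drift S \<Sigma> Q) \<Sigma> x" "0 \<le> t"
    for M :: "'c measure" and x t w Q z
  proof -
    define k where "k = (\<lambda>s. (exp (- \<mu> * s) * cos (w * s)) *\<^sub>R (S *v v) + (- exp (- \<mu> * s) * sin (w * s) / w) *\<^sub>R z)"
    have "drift S \<Sigma> Q \<in> drift_class S \<Sigma>" using that(1) by (auto simp: drift_class_def)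
    then have "lagged_cov M x t \<tau> *v v = k \<tau>"
      using \<tau> by (intro OU_lagged_cov_column[OF S \<Sigma> _ that(6) damped_rotation_solution[OF that(2,3,4) k_def] _ that(7)])
        (auto simp: k_def)
    then show ?thesis using v(1) that(5) by (simp add: sym_part_quadratic k_def)
  qed
  obtain Q1 z1 where 1: "antisymmetric Q1" "drift S \<Sigma> Q1 *v (S *v v) = \<mu> *\<^sub>R (S *v v) + z1"
    "drift S \<Sigma> Q1 *v z1 = \<mu> *\<^sub>R z1 - (pi / \<tau>)\<^sup>2 *\<^sub>R (S *v v)" using v(2) by blast
  obtain Q2 z2 where 2: "antisymmetric Q2" "drift S \<Sigma> Q2 *v (S *v v) = \<mu> *\<^sub>R (S *v v) + z2"
    "drift S \<Sigma> Q2 *v z2 = \<mu> *\<^sub>R z2 - (2 * pi / \<tau>)\<^sup>2 *\<^sub>R (S *v v)" using v(2) by blast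
  show thesis
  proof (rule that[OF 1(1) 2(1)])
    fix M1 :: "'a measure" and x1 and M2 :: "'b measure" and x2 and t :: real
    assume OU: "stationary_OU M1 (drift S \<Sigma> Q1) \<Sigma> x1" "stationary_OU M2 (drift S \<Sigma> Q2) \<Sigma> x2" "0 \<le> t"
    have "v \<bullet> (sym_part (lagged_cov M1 x1 t \<tau>) *v v) = - exp (- \<mu> * \<tau>)"
      using turn[OF 1 _ _ OU(1,3)] \<tau> by simp
    moreover have "v \<bullet> (sym_part (lagged_cov M2 x2 t \<tau>) *v v) = exp (- \<mu> * \<tau>)"
      using turn[OF 2 _ _ OU(2,3)] \<tau> by simp
    moreover have "exp (- \<mu> * \<tau>) \<noteq> - exp (- \<mu> * \<tau>)"
      by (metis exp_gt_zero less_irrefl neg_0_less_iff_less order_less_trans)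
    ultimately show "sym_part (lagged_cov M1 x1 t \<tau>) \<noteq> sym_part (lagged_cov M2 x2 t \<tau>)"
      by metis
  qed
qed

lemma sym_part_component: "sym_part X $ i $ j = ((X *v axis j 1) $ i + (X *v axis i 1) $ j) / 2"
  by (simp add: sym_part_def transpose_def matrix_vector_mult_basis column_def)

text \<open>With circulation of size \<open>c = 1\<close> the flow shears the \<open>a\<close>-\<open>b\<close> plane. With \<open>c\<^sup>2 = 1 + (\<pi> / \<delta>)\<^sup>2\<close> it
  has turned that plane by a multiple of \<open>\<pi>\<close> at each observation.\<close>

lemma shear_and_rotation_example:
  fixes a b :: "'n::finite"
  assumes ab: "a \<noteq> b" and \<delta>: "0 < \<delta>"
  obtains \<Sigma> Q1 Q2 :: "real^'n^'n" where "sym_posdef \<Sigma>" "antisymmetric Q1" "antisymmetric Q2"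
    "\<And>(M :: 'a measure) x t h. stationary_OU M (drift (mat 1) \<Sigma> Q1) \<Sigma> x \<Longrightarrow> 0 \<le> t \<Longrightarrow> 0 < h \<Longrightarrow>
       sym_part (lagged_cov M x t h) $ a $ b < 0 \<and>
       sym_part (lagged_cov M x t h) $ a $ a > 0 \<and> sym_part (lagged_cov M x t h) $ b $ b > 0"
    "\<And>(M :: 'b measure) x t l. stationary_OU M (drift (mat 1) \<Sigma> Q2) \<Sigma> x \<Longrightarrow> 0 \<le> t \<Longrightarrow>
       sym_part (lagged_cov M x t (real l * \<delta>)) $ a $ b = 0"
proof -
  define E :: "'n \<Rightarrow> 'n \<Rightarrow> real^'n^'n" where "E i j = (\<chi> k l. if k = i \<and> l = j then 1 else 0)" for i j
  have E: "E i j *v v = (v $ j) *\<^sub>R axis i 1" for i j v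
    by (auto simp: E_def vec_eq_iff matrix_vector_mult_def axis_def if_distrib if_distribR sum.delta cong: if_cong)
  have Et: "transpose (E i j) = E j i" for i j by (auto simp: E_def transpose_def vec_eq_iff)
  \<comment> \<open>With S the identity, A = \<Sigma> / 2 + Q acts on the a-b plane as 2 plus
    off-diagonal entries 1 + c and 1 - c. Their product 1 - c^2 is the square of A - 2 there: zero
    for c = 1, and -(pi / \<delta>)^2 for the second choice of c.\<close>
  define \<Sigma> where "\<Sigma> = 4 *\<^sub>R mat 1 + 2 *\<^sub>R (E a b + E b a)"
  define Q where "Q c = c *\<^sub>R (E a b - E b a)" for c :: real
  have S: "sym_posdef (mat 1 :: real^'n^'n)" by (simp add: sym_posdef_def)
  have \<Sigma>v: "\<Sigma> *v v = 4 *\<^sub>R v + 2 *\<^sub>R ((v $ b) *\<^sub>R axis a 1 + (v $ a) *\<^sub>R axis b 1)" for v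
    by (simp add: \<Sigma>_def matrix_vector_mult_add_rdistrib E flip: scaleR_matrix_vector_assoc)
  have \<Sigma>: "sym_posdef \<Sigma>"
    unfolding sym_posdef_def
  proof (intro conjI allI impI)
    have "transpose \<Sigma> = 4 *\<^sub>R transpose (mat 1) + 2 *\<^sub>R (transpose (E a b) + transpose (E b a))"
      by (simp add: \<Sigma>_def transpose_def vec_eq_iff)
    then show "transpose \<Sigma> = \<Sigma>" by (simp add: Et \<Sigma>_def add.commute)
    fix v :: "real^'n" assume "v \<noteq> 0"
    have "(v $ a)\<^sup>2 + (v $ b)\<^sup>2 = (\<Sum>i\<in>{a, b}. (v $ i)\<^sup>2)" using ab by simp
    also have "\<dots> \<le> (\<Sum>i\<in>UNIV. (v $ i)\<^sup>2)" by (rule sum_mono2) auto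
    also have "\<dots> = v \<bullet> v" by (simp add: inner_vec_def power2_eq_square)
    finally have "(v $ a)\<^sup>2 + (v $ b)\<^sup>2 \<le> v \<bullet> v" .
    \<comment> \<open>Bounds the cross term 4 v_a v_b below by -2 (v_a^2 + v_b^2), at most half of
      what 4 (v . v) offers.\<close>
    moreover have "0 \<le> (v $ a + v $ b)\<^sup>2" by simp
    moreover have "v \<bullet> (\<Sigma> *v v) = 4 * (v \<bullet> v) + 4 * (v $ a * v $ b)"
      by (simp add: \<Sigma>v inner_add_right inner_axis)
    moreover have "0 < v \<bullet> v" using \<open>v \<noteq> 0\<close> by simp
    ultimately show "0 < v \<bullet> (\<Sigma> *v v)" unfolding power2_sum by linarith
  qed
  have Q: "antisymmetric (Q c)" for c
  proof -
    have "transpose (Q c) = c *\<^sub>R (transpose (E a b) - transpose (E b a))"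
      by (simp add: Q_def transpose_def vec_eq_iff)
    then show ?thesis by (simp add: antisymmetric_def Et Q_def algebra_simps)
  qed
  let ?A = "\<lambda>c. drift (mat 1) \<Sigma> (Q c)" and ?a = "axis a 1 :: real^'n" and ?b = "axis b 1 :: real^'n"
  have A_eq: "?A c = (1/2) *\<^sub>R \<Sigma> + Q c" for c using drift_times[OF S, of \<Sigma> "Q c"] by simp
  have A: "?A c *v v = 2 *\<^sub>R v + ((1 + c) * v $ b) *\<^sub>R ?a + ((1 - c) * v $ a) *\<^sub>R ?b" for c v
    unfolding A_eq
    by (simp add: Q_def matrix_vector_mult_add_rdistrib matrix_vector_mult_diff_rdistrib E \<Sigma>v
        algebra_simps flip: scaleR_matrix_vector_assoc)
  have ax: "?a $ a = 1" "?b $ b = 1" "?a $ b = 0" "?b $ a = 0" using ab by (simp_all add: axis_def)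
  have cls: "?A c \<in> drift_class (mat 1) \<Sigma>" for c using Q by (auto simp: drift_class_def)
  show thesis
  proof (rule that[OF \<Sigma> Q[of 1] Q[of "sqrt (1 + (pi / \<delta>)\<^sup>2)"]])
    fix M :: "'a measure" and x and t h :: real
    assume OU: "stationary_OU M (?A 1) \<Sigma> x" and t: "0 \<le> t" and h: "0 < h"
    \<comment> \<open>For c = 1 axis a is an eigenvector, while A - 2 sends axis b to twice axis a.
      So C(h) has the entry -2 h exp(-2 h) at (a, b), 0 at (b, a) and exp(-2 h) at (a, a) and (b,
      b).\<close>
    define ka where "ka = (\<lambda>s. exp (- 2 * s) *\<^sub>R ?a + (- exp (- 2 * s) * s) *\<^sub>R (0 :: real^'n))"
    define kb where "kb = (\<lambda>s. exp (- 2 * s) *\<^sub>R ?b + (- exp (- 2 * s) * s) *\<^sub>R (2 *\<^sub>R ?a))"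
    have "lagged_cov M x t h *v ?a = ka h"
      using h by (intro OU_lagged_cov_column[OF S \<Sigma> cls OU damped_shear_solution[OF _ _ ka_def] _ t])
        (simp_all add: A ax ka_def)
    moreover have "lagged_cov M x t h *v ?b = kb h"
      using h by (intro OU_lagged_cov_column[OF S \<Sigma> cls OU damped_shear_solution[OF _ _ kb_def] _ t])
        (simp_all add: A ax kb_def)
    ultimately show "sym_part (lagged_cov M x t h) $ a $ b < 0 \<and>
       sym_part (lagged_cov M x t h) $ a $ a > 0 \<and> sym_part (lagged_cov M x t h) $ b $ b > 0"
      using h by (simp add: sym_part_component ka_def kb_def ax)
  next
    let ?c = "sqrt (1 + (pi / \<delta>)\<^sup>2)"
    fix M :: "'b measure" and x and t :: real and l :: nat
    assume OU: "stationary_OU M (?A ?c) \<Sigma> x" and t: "0 \<le> t"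
    have c: "(1 + ?c) * (1 - ?c) = - (pi / \<delta>)\<^sup>2" by (simp add: algebra_simps)
    define k where "k u z = (\<lambda>s. (exp (- 2 * s) * cos (pi / \<delta> * s)) *\<^sub>R u +
      (- exp (- 2 * s) * sin (pi / \<delta> * s) / (pi / \<delta>)) *\<^sub>R z)" for u z :: "real^'n"
    have w: "pi / \<delta> \<noteq> 0" using \<delta> by simp
    have sin0: "sin (pi / \<delta> * (real l * \<delta>)) = 0" using \<delta> by simp
    have "lagged_cov M x t (real l * \<delta>) *v ?a = k ?a ((1 - ?c) *\<^sub>R ?b) (real l * \<delta>)"
    proof (rule OU_lagged_cov_column[OF S \<Sigma> cls OU damped_rotation_solution[OF _ _ w k_def] _ t])
      show "?A ?c *v ?a = 2 *\<^sub>R ?a + (1 - ?c) *\<^sub>R ?b" by (simp add: A ax)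
      show "?A ?c *v ((1 - ?c) *\<^sub>R ?b) = 2 *\<^sub>R ((1 - ?c) *\<^sub>R ?b) - (pi / \<delta>)\<^sup>2 *\<^sub>R ?a"
        using c by (simp add: A ax)
    qed (use \<delta> in \<open>simp_all add: k_def\<close>)
    moreover have "lagged_cov M x t (real l * \<delta>) *v ?b = k ?b ((1 + ?c) *\<^sub>R ?a) (real l * \<delta>)"
    proof (rule OU_lagged_cov_column[OF S \<Sigma> cls OU damped_rotation_solution[OF _ _ w k_def] _ t])
      show "?A ?c *v ?b = 2 *\<^sub>R ?b + (1 + ?c) *\<^sub>R ?a" by (simp add: A ax)
      show "?A ?c *v ((1 + ?c) *\<^sub>R ?a) = 2 *\<^sub>R ((1 + ?c) *\<^sub>R ?a) - (pi / \<delta>)\<^sup>2 *\<^sub>R ?b"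
        using c by (simp add: A ax mult.commute)
    qed (use \<delta> in \<open>simp_all add: k_def\<close>)
    ultimately show "sym_part (lagged_cov M x t (real l * \<delta>)) $ a $ b = 0"
      using sin0 by (simp add: sym_part_component k_def ax)
  qed
qed

text \<open>The sign of an entry survives normalisation by positive variances. At (a, b) every lag
  contributes a negative term for the sheared system, while every observation lag contributes zero
  for the rotating one.\<close>

lemma aggregate_correlation_depends_on_circulation:
  fixes m :: nat and \<delta> :: real
  assumes n: "2 \<le> CARD('n::finite)" and m: "2 \<le> m" and \<delta>: "0 < \<delta>"
  obtains S \<Sigma> A1 A2 :: "real^'n^'n" where "sym_posdef S" "sym_posdef \<Sigma>"
    "A1 \<in> drift_class S \<Sigma>" "A2 \<in> drift_class S \<Sigma>"
    "\<And>(M1 :: 'a measure) x1 (M2 :: 'b measure) x2 t.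
       stationary_OU M1 A1 \<Sigma> x1 \<Longrightarrow> stationary_OU M2 A2 \<Sigma> x2 \<Longrightarrow> 0 \<le> t \<Longrightarrow>
       correlation_matrix M1 (aggregate m \<delta> x1 t) \<noteq> correlation_matrix M2 (aggregate m \<delta> x2 t)"
proof -
  have "\<not> CARD('n) \<le> Suc 0" using n by simp
  then obtain a b :: 'n where ab: "a \<noteq> b" by (auto simp: card_le_Suc0_iff_eq)
  obtain \<Sigma> Q1 Q2 :: "real^'n^'n" where \<Sigma>: "sym_posdef \<Sigma>" and Q: "antisymmetric Q1" "antisymmetric Q2"
    and shear: "\<And>(M :: 'a measure) x t h. stationary_OU M (drift (mat 1) \<Sigma> Q1) \<Sigma> x \<Longrightarrow> 0 \<le> t \<Longrightarrow> 0 < h \<Longrightarrow>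
       sym_part (lagged_cov M x t h) $ a $ b < 0 \<and>
       sym_part (lagged_cov M x t h) $ a $ a > 0 \<and> sym_part (lagged_cov M x t h) $ b $ b > 0"
    and rotation: "\<And>(M :: 'b measure) x t l. stationary_OU M (drift (mat 1) \<Sigma> Q2) \<Sigma> x \<Longrightarrow> 0 \<le> t \<Longrightarrow>
       sym_part (lagged_cov M x t (real l * \<delta>)) $ a $ b = 0"
    by (rule shear_and_rotation_example[OF ab \<delta>]) (rule that)
  have S: "sym_posdef (mat 1 :: real^'n^'n)" by (simp add: sym_posdef_def)
  have cls: "drift (mat 1) \<Sigma> Q1 \<in> drift_class (mat 1) \<Sigma>" "drift (mat 1) \<Sigma> Q2 \<in> drift_class (mat 1) \<Sigma>"
    using Q by (auto simp: drift_class_def)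
  show thesis
  proof (rule that[OF S \<Sigma> cls])
    fix M1 :: "'a measure" and x1 and M2 :: "'b measure" and x2 and t :: real
    assume OU1: "stationary_OU M1 (drift (mat 1) \<Sigma> Q1) \<Sigma> x1"
      and OU2: "stationary_OU M2 (drift (mat 1) \<Sigma> Q2) \<Sigma> x2" and t: "0 \<le> t"
    let ?V1 = "covariance_matrix M1 (aggregate m \<delta> x1 t)"
    let ?V2 = "covariance_matrix M2 (aggregate m \<delta> x2 t)"
    let ?s = "\<lambda>h. sym_part (lagged_cov M1 x1 t (real h * \<delta>))"
    have V1: "?V1 $ i $ j = real m * (mat 1 :: real^'n^'n) $ i $ j + (\<Sum>h = 1..<m. (2 * real (m - h)) * ?s h $ i $ j)" for i j
      using \<delta> by (simp add: OU_aggregate_covariance[OF S \<Sigma> cls(1) OU1 t])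
    have V2: "?V2 $ a $ b = 0"
      using \<delta> ab by (simp add: OU_aggregate_covariance[OF S \<Sigma> cls(2) OU2 t] rotation[OF OU2 t] mat_def)
    have s: "?s h $ a $ b < 0 \<and> ?s h $ a $ a > 0 \<and> ?s h $ b $ b > 0" if "h \<in> {1..<m}" for h
      using shear[OF OU1 t, of "real h * \<delta>"] that \<delta> by simp
    have "(\<Sum>h = 1..<m. (2 * real (m - h)) * ?s h $ a $ b) < (\<Sum>h = 1..<m. 0)"
    proof (rule sum_strict_mono)
      show "(2 * real (m - h)) * ?s h $ a $ b < 0" if "h \<in> {1..<m}" for h
        using s[OF that] that by (intro mult_pos_neg) auto
    qed (use m in auto)
    then have "?V1 $ a $ b < 0" using ab by (simp add: V1 mat_def)
    \<comment> \<open>The variances are at least m, hence positive, and the negative sign of the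
      covariance passes to the correlation.\<close>
    moreover have "0 \<le> (\<Sum>h = 1..<m. (2 * real (m - h)) * ?s h $ a $ a)"
      "0 \<le> (\<Sum>h = 1..<m. (2 * real (m - h)) * ?s h $ b $ b)"
      using s by (auto intro!: sum_nonneg mult_nonneg_nonneg simp: less_imp_le)
    then have "0 < ?V1 $ a $ a" "0 < ?V1 $ b $ b" using m by (simp_all add: V1 mat_def)
    ultimately have "correlation_matrix M1 (aggregate m \<delta> x1 t) $ a $ b < 0"
      by (simp add: correlation_matrix_def correlation_of_def divide_neg_pos)
    \<comment> \<open>A zero numerator gives zero whatever the variances of this system are.\<close>
    moreover have "correlation_matrix M2 (aggregate m \<delta> x2 t) $ a $ b = 0"
      using V2 by (simp add: correlation_matrix_def correlation_of_def)
    ultimately show "correlation_matrix M1 (aggregate m \<delta> x1 t) \<noteq> correlation_matrix M2 (aggregate m \<delta> x2 t)"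
      by auto
  qed
qed

text \<open>Distances, trees and centralities are functions of the correlation matrix, so the first
  part reduces to computing that matrix as \<open>correlation_of S\<close>. Arbitrary transmission
  directions occur because \<open>circulation\<close> inverts \<open>drift\<close>. Two series are
  the least number admitting a nonzero antisymmetric matrix, hence the bound on
  \<open>CARD('n)\<close> in the last two parts. The final part chooses its own covariance and
  diffusion matrices, since it rests on an explicit example.\<close>

theorem corollary1:
  fixes S \<Sigma> :: "real^'n^'n"
  assumes "sym_posdef S" and "sym_posdef \<Sigma>"
  shows
    "(\<forall>A\<^sub>1\<in>drift_class S \<Sigma>. \<forall>A\<^sub>2\<in>drift_class S \<Sigma>.
       \<forall>(M\<^sub>1 :: 'a measure) x\<^sub>1 (M\<^sub>2 :: 'b measure) x\<^sub>2.
         stationary_OU M\<^sub>1 A\<^sub>1 \<Sigma> x\<^sub>1 \<and> stationary_OU M\<^sub>2 A\<^sub>2 \<Sigma> x\<^sub>2 \<longrightarrow>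
         (\<forall>\<tau> k. sampling_grid \<tau> \<longrightarrow>
           (let \<rho>\<^sub>1 = correlation_matrix M\<^sub>1 (x\<^sub>1 (\<tau> k));
                \<rho>\<^sub>2 = correlation_matrix M\<^sub>2 (x\<^sub>2 (\<tau> k));
                d\<^sub>1 = mantegna_distance \<rho>\<^sub>1;
                d\<^sub>2 = mantegna_distance \<rho>\<^sub>2
            in \<rho>\<^sub>1 = correlation_of S \<and> \<rho>\<^sub>1 = \<rho>\<^sub>2 \<and> d\<^sub>1 = d\<^sub>2 \<and>
               {T. is_mst d\<^sub>1 T} = {T. is_mst d\<^sub>2 T} \<and>
               (\<forall>mst. mst_functional mst \<longrightarrow>
                  mst d\<^sub>1 = mst d\<^sub>2 \<and>
                  (\<forall>centrality :: 'n weighted_graph \<Rightarrow> 'n \<Rightarrow> real.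
                     centrality (tree_graph mst d\<^sub>1) = centrality (tree_graph mst d\<^sub>2))))))
     \<and>
     (\<forall>Q\<^sub>1 Q\<^sub>2. antisymmetric Q\<^sub>1 \<and> antisymmetric Q\<^sub>2 \<longrightarrow>
       (\<exists>A\<^sub>1\<in>drift_class S \<Sigma>. \<exists>A\<^sub>2\<in>drift_class S \<Sigma>.
          circulation S \<Sigma> A\<^sub>1 = Q\<^sub>1 \<and> circulation S \<Sigma> A\<^sub>2 = Q\<^sub>2))
     \<and>
     (\<forall>A\<in>drift_class S \<Sigma>. \<forall>(M :: 'a measure) x m \<delta> t.
       stationary_OU M A \<Sigma> x \<and> 0 < \<delta> \<and> 0 \<le> t \<longrightarrow>
       covariance_matrix M (aggregate m \<delta> x t) =
         real m *\<^sub>R S +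
         (\<Sum>h = 1..<m. (2 * real (m - h)) *\<^sub>R sym_part (lagged_cov M x t (real h * \<delta>))))
     \<and>
     (2 \<le> CARD('n) \<longrightarrow>
       (\<forall>(h::nat) \<delta>. 1 \<le> h \<and> 0 < \<delta> \<longrightarrow>
         (\<exists>Q\<^sub>1 Q\<^sub>2. antisymmetric Q\<^sub>1 \<and> antisymmetric Q\<^sub>2 \<and>
           (\<forall>(M\<^sub>1 :: 'a measure) x\<^sub>1 (M\<^sub>2 :: 'b measure) x\<^sub>2 t.
              stationary_OU M\<^sub>1 (drift S \<Sigma> Q\<^sub>1) \<Sigma> x\<^sub>1 \<and>
              stationary_OU M\<^sub>2 (drift S \<Sigma> Q\<^sub>2) \<Sigma> x\<^sub>2 \<and> 0 \<le> t \<longrightarrow>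
              sym_part (lagged_cov M\<^sub>1 x\<^sub>1 t (real h * \<delta>)) \<noteq>
              sym_part (lagged_cov M\<^sub>2 x\<^sub>2 t (real h * \<delta>))))))
     \<and>
     (2 \<le> CARD('n) \<longrightarrow>
       (\<forall>(m::nat) \<delta>. 2 \<le> m \<and> 0 < \<delta> \<longrightarrow>
         (\<exists>(S' :: real^'n^'n) \<Sigma>'. sym_posdef S' \<and> sym_posdef \<Sigma>' \<and>
           (\<exists>A\<^sub>1\<in>drift_class S' \<Sigma>'. \<exists>A\<^sub>2\<in>drift_class S' \<Sigma>'.
             \<forall>(M\<^sub>1 :: 'a measure) x\<^sub>1 (M\<^sub>2 :: 'b measure) x\<^sub>2 t.
               stationary_OU M\<^sub>1 A\<^sub>1 \<Sigma>' x\<^sub>1 \<and> stationary_OU M\<^sub>2 A\<^sub>2 \<Sigma>' x\<^sub>2 \<and> 0 \<le> t \<longrightarrow>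
               correlation_matrix M\<^sub>1 (aggregate m \<delta> x\<^sub>1 t) \<noteq>
               correlation_matrix M\<^sub>2 (aggregate m \<delta> x\<^sub>2 t)))))"
proof (intro conjI)
  note S = assms(1) and \<Sigma> = assms(2)
  show "\<forall>A\<^sub>1\<in>drift_class S \<Sigma>. \<forall>A\<^sub>2\<in>drift_class S \<Sigma>.
       \<forall>(M\<^sub>1 :: 'a measure) x\<^sub>1 (M\<^sub>2 :: 'b measure) x\<^sub>2.
         stationary_OU M\<^sub>1 A\<^sub>1 \<Sigma> x\<^sub>1 \<and> stationary_OU M\<^sub>2 A\<^sub>2 \<Sigma> x\<^sub>2 \<longrightarrow>
         (\<forall>\<tau> k. sampling_grid \<tau> \<longrightarrow>
           (let \<rho>\<^sub>1 = correlation_matrix M\<^sub>1 (x\<^sub>1 (\<tau> k));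
                \<rho>\<^sub>2 = correlation_matrix M\<^sub>2 (x\<^sub>2 (\<tau> k));
                d\<^sub>1 = mantegna_distance \<rho>\<^sub>1;
                d\<^sub>2 = mantegna_distance \<rho>\<^sub>2
            in \<rho>\<^sub>1 = correlation_of S \<and> \<rho>\<^sub>1 = \<rho>\<^sub>2 \<and> d\<^sub>1 = d\<^sub>2 \<and>
               {T. is_mst d\<^sub>1 T} = {T. is_mst d\<^sub>2 T} \<and>
               (\<forall>mst. mst_functional mst \<longrightarrow>
                  mst d\<^sub>1 = mst d\<^sub>2 \<and>
                  (\<forall>centrality :: 'n weighted_graph \<Rightarrow> 'n \<Rightarrow> real.
                     centrality (tree_graph mst d\<^sub>1) = centrality (tree_graph mst d\<^sub>2)))))"
  proof (intro ballI allI impI)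
    fix A1 A2 and M1 :: "'a measure" and x1 and M2 :: "'b measure" and x2 and \<tau> :: "nat \<Rightarrow> real" and k
    assume A: "A1 \<in> drift_class S \<Sigma>" "A2 \<in> drift_class S \<Sigma>" and "sampling_grid \<tau>"
      and OU: "stationary_OU M1 A1 \<Sigma> x1 \<and> stationary_OU M2 A2 \<Sigma> x2"
    then have "0 \<le> \<tau> k" by (intro sampling_grid_nonneg)
    then have "correlation_matrix M1 (x1 (\<tau> k)) = correlation_of S"
      "correlation_matrix M2 (x2 (\<tau> k)) = correlation_of S"
      using A OU OU_covariance[OF S \<Sigma>] by (auto simp: correlation_matrix_def)
    then show "let \<rho>\<^sub>1 = correlation_matrix M1 (x1 (\<tau> k));
                \<rho>\<^sub>2 = correlation_matrix M2 (x2 (\<tau> k));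
                d\<^sub>1 = mantegna_distance \<rho>\<^sub>1;
                d\<^sub>2 = mantegna_distance \<rho>\<^sub>2
            in \<rho>\<^sub>1 = correlation_of S \<and> \<rho>\<^sub>1 = \<rho>\<^sub>2 \<and> d\<^sub>1 = d\<^sub>2 \<and>
               {T. is_mst d\<^sub>1 T} = {T. is_mst d\<^sub>2 T} \<and>
               (\<forall>mst. mst_functional mst \<longrightarrow>
                  mst d\<^sub>1 = mst d\<^sub>2 \<and>
                  (\<forall>centrality :: 'n weighted_graph \<Rightarrow> 'n \<Rightarrow> real.
                     centrality (tree_graph mst d\<^sub>1) = centrality (tree_graph mst d\<^sub>2)))"
      unfolding Let_def by simp
  qed
  show "\<forall>Q\<^sub>1 Q\<^sub>2. antisymmetric Q\<^sub>1 \<and> antisymmetric Q\<^sub>2 \<longrightarrow>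
       (\<exists>A\<^sub>1\<in>drift_class S \<Sigma>. \<exists>A\<^sub>2\<in>drift_class S \<Sigma>.
          circulation S \<Sigma> A\<^sub>1 = Q\<^sub>1 \<and> circulation S \<Sigma> A\<^sub>2 = Q\<^sub>2)"
  proof (intro allI impI)
    fix Q1 Q2 :: "real^'n^'n" assume "antisymmetric Q1 \<and> antisymmetric Q2"
    then have "drift S \<Sigma> Q1 \<in> drift_class S \<Sigma>" "drift S \<Sigma> Q2 \<in> drift_class S \<Sigma>"
      by (auto simp: drift_class_def)
    then show "\<exists>A\<^sub>1\<in>drift_class S \<Sigma>. \<exists>A\<^sub>2\<in>drift_class S \<Sigma>.
        circulation S \<Sigma> A\<^sub>1 = Q1 \<and> circulation S \<Sigma> A\<^sub>2 = Q2"
      using circulation_drift[OF S] by blast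
  qed
  show "\<forall>A\<in>drift_class S \<Sigma>. \<forall>(M :: 'a measure) x m \<delta> t.
       stationary_OU M A \<Sigma> x \<and> 0 < \<delta> \<and> 0 \<le> t \<longrightarrow>
       covariance_matrix M (aggregate m \<delta> x t) =
         real m *\<^sub>R S +
         (\<Sum>h = 1..<m. (2 * real (m - h)) *\<^sub>R sym_part (lagged_cov M x t (real h * \<delta>)))"
    by (intro ballI allI impI OU_aggregate_covariance[OF S \<Sigma>]) auto
  show "2 \<le> CARD('n) \<longrightarrow>
       (\<forall>(h::nat) \<delta>. 1 \<le> h \<and> 0 < \<delta> \<longrightarrow>
         (\<exists>Q\<^sub>1 Q\<^sub>2. antisymmetric Q\<^sub>1 \<and> antisymmetric Q\<^sub>2 \<and>
           (\<forall>(M\<^sub>1 :: 'a measure) x\<^sub>1 (M\<^sub>2 :: 'b measure) x\<^sub>2 t.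
              stationary_OU M\<^sub>1 (drift S \<Sigma> Q\<^sub>1) \<Sigma> x\<^sub>1 \<and>
              stationary_OU M\<^sub>2 (drift S \<Sigma> Q\<^sub>2) \<Sigma> x\<^sub>2 \<and> 0 \<le> t \<longrightarrow>
              sym_part (lagged_cov M\<^sub>1 x\<^sub>1 t (real h * \<delta>)) \<noteq>
              sym_part (lagged_cov M\<^sub>2 x\<^sub>2 t (real h * \<delta>)))))"
  proof (intro allI impI)
    fix h :: nat and \<delta> :: real
    assume n: "2 \<le> CARD('n)" and "1 \<le> h \<and> 0 < \<delta>"
    then have "0 < real h * \<delta>" by simp
    from lagged_sym_part_depends_on_circulation[OF S \<Sigma> n this, where ?'a = 'a and ?'b = 'b]
    obtain Q1 Q2 :: "real^'n^'n" where "antisymmetric Q1" "antisymmetric Q2"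
      "\<And>(M1 :: 'a measure) x1 (M2 :: 'b measure) x2 t.
         stationary_OU M1 (drift S \<Sigma> Q1) \<Sigma> x1 \<Longrightarrow> stationary_OU M2 (drift S \<Sigma> Q2) \<Sigma> x2 \<Longrightarrow> 0 \<le> t \<Longrightarrow>
         sym_part (lagged_cov M1 x1 t (real h * \<delta>)) \<noteq> sym_part (lagged_cov M2 x2 t (real h * \<delta>))"
      by blast
    then show "\<exists>Q\<^sub>1 Q\<^sub>2. antisymmetric Q\<^sub>1 \<and> antisymmetric Q\<^sub>2 \<and>
           (\<forall>(M\<^sub>1 :: 'a measure) x\<^sub>1 (M\<^sub>2 :: 'b measure) x\<^sub>2 t.
              stationary_OU M\<^sub>1 (drift S \<Sigma> Q\<^sub>1) \<Sigma> x\<^sub>1 \<and>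
              stationary_OU M\<^sub>2 (drift S \<Sigma> Q\<^sub>2) \<Sigma> x\<^sub>2 \<and> 0 \<le> t \<longrightarrow>
              sym_part (lagged_cov M\<^sub>1 x\<^sub>1 t (real h * \<delta>)) \<noteq>
              sym_part (lagged_cov M\<^sub>2 x\<^sub>2 t (real h * \<delta>)))"
      by (intro exI[of _ Q1] exI[of _ Q2]) simp
  qed
  show "2 \<le> CARD('n) \<longrightarrow>
       (\<forall>(m::nat) \<delta>. 2 \<le> m \<and> 0 < \<delta> \<longrightarrow>
         (\<exists>(S' :: real^'n^'n) \<Sigma>'. sym_posdef S' \<and> sym_posdef \<Sigma>' \<and>
           (\<exists>A\<^sub>1\<in>drift_class S' \<Sigma>'. \<exists>A\<^sub>2\<in>drift_class S' \<Sigma>'.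
             \<forall>(M\<^sub>1 :: 'a measure) x\<^sub>1 (M\<^sub>2 :: 'b measure) x\<^sub>2 t.
               stationary_OU M\<^sub>1 A\<^sub>1 \<Sigma>' x\<^sub>1 \<and> stationary_OU M\<^sub>2 A\<^sub>2 \<Sigma>' x\<^sub>2 \<and> 0 \<le> t \<longrightarrow>
               correlation_matrix M\<^sub>1 (aggregate m \<delta> x\<^sub>1 t) \<noteq>
               correlation_matrix M\<^sub>2 (aggregate m \<delta> x\<^sub>2 t))))"
  proof (intro allI impI)
    fix m :: nat and \<delta> :: real
    assume n: "2 \<le> CARD('n)" and "2 \<le> m \<and> 0 < \<delta>"
    then have m: "2 \<le> m" and \<delta>: "0 < \<delta>" by auto
    obtain S' \<Sigma>' A1 A2 :: "real^'n^'n" where *: "sym_posdef S'" "sym_posdef \<Sigma>'"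
      "A1 \<in> drift_class S' \<Sigma>'" "A2 \<in> drift_class S' \<Sigma>'"
      "\<And>(M1 :: 'a measure) x1 (M2 :: 'b measure) x2 t.
         stationary_OU M1 A1 \<Sigma>' x1 \<Longrightarrow> stationary_OU M2 A2 \<Sigma>' x2 \<Longrightarrow> 0 \<le> t \<Longrightarrow>
         correlation_matrix M1 (aggregate m \<delta> x1 t) \<noteq> correlation_matrix M2 (aggregate m \<delta> x2 t)"
      by (rule aggregate_correlation_depends_on_circulation[OF n m \<delta>]) (rule that)
    show "\<exists>(S' :: real^'n^'n) \<Sigma>'. sym_posdef S' \<and> sym_posdef \<Sigma>' \<and>
           (\<exists>A\<^sub>1\<in>drift_class S' \<Sigma>'. \<exists>A\<^sub>2\<in>drift_class S' \<Sigma>'.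
             \<forall>(M\<^sub>1 :: 'a measure) x\<^sub>1 (M\<^sub>2 :: 'b measure) x\<^sub>2 t.
               stationary_OU M\<^sub>1 A\<^sub>1 \<Sigma>' x\<^sub>1 \<and> stationary_OU M\<^sub>2 A\<^sub>2 \<Sigma>' x\<^sub>2 \<and> 0 \<le> t \<longrightarrow>
               correlation_matrix M\<^sub>1 (aggregate m \<delta> x\<^sub>1 t) \<noteq>
               correlation_matrix M\<^sub>2 (aggregate m \<delta> x\<^sub>2 t))"
      by (rule exI[of _ S'], rule exI[of _ \<Sigma>'], intro conjI *(1,2) bexI[OF _ *(3)] bexI[OF _ *(4)])
        (use *(5) in simp)
  qed
qed

end
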